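(* Let $D$ be a Noetherian domain with integral closure $D'$ (in its quotient field) such that $(D:D')\neq (0)$. The following are equivalent. (a) $D$ is a TAF-domain. (b) $D'$ is a Dedekind domain and $D_M$ is a PVD for each $M\in V(D:D')$. (c) There exist a Dedekind overring $E$ of $D$, distinct maximal ideals $M_1,\dots,M_n$ of $E$ and finite field extensions $K_i\subseteq E/M_i$ ($i=1,\dots,n$) such that $D$ is the pullback domain $\pi^{-1}\left(\prod_{i=1}^n K_i\right)$, where $\pi:E\rightarrow \prod_{i=1}^n E/M_i$ is the canonical map.
   Context: All rings are commutative with identity. An ideal $I$ of a ring $R$ is a 2-absorbing ideal (TA-ideal) if whenever $a,b,c\in R$ and $abc\in I$, then $ab\in I$ or $ac\in I$ or $bc\in I$. A TA-factorization of an ideal $I$ is an expression $I=J_1\cdots J_n$ as a product of proper TA-ideals. A TAF-domain is an integral domain in which every proper ideal has a TA-factorization. $(D:D')=\{x\in D\mid xD'\subseteq D\}$ is the conductor, and $V(D:D')$ is the set of prime ideals of $D$ containing it. An overring of $D$ is a ring between $D$ and its quotient field. A local domain $(D,M)$ with quotient field $K$ is a pseudo-valuation domain (PVD) if it is a field or if $(M:M)=\{x\in K\mid xM\subseteq M\}$ is a valuation domain with maximal ideal $M$. Fields are counted as Dedekind domains. *)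

theory Defs
  imports "HOL-Algebra.Algebra"
begin

abbreviation restrict_ring :: "('a, 'm) ring_scheme \<Rightarrow> 'a set \<Rightarrow> ('a, 'm) ring_scheme" where
  "restrict_ring K D \<equiv> K\<lparr>carrier := D\<rparr>"

text \<open>A domain is represented as a subring \<open>D\<close> of its quotient field \<open>K\<close>, so that its overrings,
  its localizations and its integral closure are subsets of \<open>carrier K\<close>.\<close>

definition quotient_field_of :: "('a, 'm) ring_scheme \<Rightarrow> 'a set \<Rightarrow> bool" where
  "quotient_field_of K D \<longleftrightarrow> field K \<and> subring D K \<and>
     (\<forall>x\<in>carrier K. \<exists>a\<in>D. \<exists>b\<in>D. b \<noteq> \<zero>\<^bsub>K\<^esub> \<and> x = a \<otimes>\<^bsub>K\<^esub> inv\<^bsub>K\<^esub> b)"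

definition overring :: "('a, 'm) ring_scheme \<Rightarrow> 'a set \<Rightarrow> 'a set \<Rightarrow> bool" where
  "overring K D E \<longleftrightarrow> quotient_field_of K D \<and> subring E K \<and> D \<subseteq> E"

text \<open>Polynomials are coefficient lists with the leading coefficient first.\<close>

definition integral_closure :: "('a, 'm) ring_scheme \<Rightarrow> 'a set \<Rightarrow> 'a set" where
  "integral_closure K D = {x \<in> carrier K. \<exists>p. p \<noteq> [] \<and> polynomial\<^bsub>K\<^esub> D p \<and>
     lead_coeff p = \<one>\<^bsub>K\<^esub> \<and> ring.eval K p x = \<zero>\<^bsub>K\<^esub>}"

text \<open>\<open>colon K A B C\<close> is \<open>{x \<in> A. x B \<subseteq> C}\<close>. The conductor \<open>(D : D')\<close> is \<open>colon K D D' D\<close>, whereas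
  for an ideal \<open>M\<close> the ring \<open>(M : M)\<close> is formed in the quotient field and is
  \<open>colon K (carrier K) M M\<close>.\<close>

definition colon :: "('a, 'm) ring_scheme \<Rightarrow> 'a set \<Rightarrow> 'a set \<Rightarrow> 'a set \<Rightarrow> 'a set" where
  "colon K A B C = {x \<in> A. \<forall>y\<in>B. x \<otimes>\<^bsub>K\<^esub> y \<in> C}"

definition conductor :: "('a, 'm) ring_scheme \<Rightarrow> 'a set \<Rightarrow> 'a set \<Rightarrow> 'a set" where
  "conductor K D D' = colon K D D' D"

definition prime_ideals_over :: "('a, 'm) ring_scheme \<Rightarrow> 'a set \<Rightarrow> 'a set set" where
  "prime_ideals_over R I = {P. primeideal P R \<and> I \<subseteq> P}"

definition localization :: "('a, 'm) ring_scheme \<Rightarrow> 'a set \<Rightarrow> 'a set \<Rightarrow> 'a set" where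
  "localization K D P = {a \<otimes>\<^bsub>K\<^esub> inv\<^bsub>K\<^esub> s |a s. a \<in> D \<and> s \<in> D - P}"

text \<open>Fields are included.\<close>

definition dedekind_domain :: "('a, 'm) ring_scheme \<Rightarrow> 'a set \<Rightarrow> bool" where
  "dedekind_domain K D \<longleftrightarrow> quotient_field_of K D \<and>
     noetherian_domain (restrict_ring K D) \<and>
     integral_closure K D = D \<and>
     (\<forall>P. primeideal P (restrict_ring K D) \<and> P \<noteq> {\<zero>\<^bsub>K\<^esub>} \<longrightarrow> maximalideal P (restrict_ring K D))"

definition valuation_domain :: "('a, 'm) ring_scheme \<Rightarrow> 'a set \<Rightarrow> bool" where
  "valuation_domain K V \<longleftrightarrow> quotient_field_of K V \<and>
     (\<forall>x\<in>carrier K - {\<zero>\<^bsub>K\<^esub>}. x \<in> V \<or> inv\<^bsub>K\<^esub> x \<in> V)"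

definition local_ring_with :: "('a, 'm) ring_scheme \<Rightarrow> 'a set \<Rightarrow> bool" where
  "local_ring_with R M \<longleftrightarrow> cring R \<and> {P. maximalideal P R} = {M}"

definition pseudo_valuation_domain :: "('a, 'm) ring_scheme \<Rightarrow> 'a set \<Rightarrow> bool" where
  "pseudo_valuation_domain K D \<longleftrightarrow> quotient_field_of K D \<and>
     (\<exists>M. local_ring_with (restrict_ring K D) M \<and>
        (field (restrict_ring K D) \<or>
         (let V = colon K (carrier K) M M
          in valuation_domain K V \<and> local_ring_with (restrict_ring K V) M)))"

definition TA_ideal :: "'a set \<Rightarrow> ('a, 'm) ring_scheme \<Rightarrow> bool" where
  "TA_ideal I R \<longleftrightarrow> ideal I R \<and>
     (\<forall>a\<in>carrier R. \<forall>b\<in>carrier R. \<forall>c\<in>carrier R. a \<otimes>\<^bsub>R\<^esub> b \<otimes>\<^bsub>R\<^esub> c \<in> I \<longrightarrow>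
        a \<otimes>\<^bsub>R\<^esub> b \<in> I \<or> a \<otimes>\<^bsub>R\<^esub> c \<in> I \<or> b \<otimes>\<^bsub>R\<^esub> c \<in> I)"

definition TA_factorization :: "('a, 'm) ring_scheme \<Rightarrow> 'a set \<Rightarrow> 'a set list \<Rightarrow> bool" where
  "TA_factorization R I Js \<longleftrightarrow> Js \<noteq> [] \<and>
     (\<forall>J\<in>set Js. TA_ideal J R \<and> J \<noteq> carrier R) \<and>
     I = foldr (ideal_prod R) Js (carrier R)"

definition TAF_domain :: "('a, 'm) ring_scheme \<Rightarrow> bool" where
  "TAF_domain R \<longleftrightarrow> domain R \<and>
     (\<forall>I. ideal I R \<and> I \<noteq> carrier R \<longrightarrow> (\<exists>Js. TA_factorization R I Js))"

definition canonical_map :: "('a, 'm) ring_scheme \<Rightarrow> nat \<Rightarrow> (nat \<Rightarrow> 'a set) \<Rightarrow> 'a \<Rightarrow> nat \<Rightarrow> 'a set" where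
  "canonical_map R n M x = (\<lambda>i\<in>{1..n}. M i +>\<^bsub>R\<^esub> x)"

definition finite_subextension :: "'a set \<Rightarrow> ('a, 'm) ring_scheme \<Rightarrow> bool" where
  "finite_subextension L F \<longleftrightarrow> field F \<and> subfield L F \<and> ring.finite_dimension F L (carrier F)"

end

(* The whole theorem is governed by one condition on a maximal ideal N of D, namely
   N^2 <= xD + N^3 for all x in N - N^2.

   In a TAF-domain, xD + N^3 is not contained in N^2, so it is not a proper product and must itself be
   a TA-ideal; a TA-ideal containing N^3 contains N^2. Conversely, in dimension one the condition lets one
   factor an N-primary ideal I <= N^2 as (I : p)(pD + N^2) with p in N - N^2, and every ideal between
   N^2 and N is a TA-ideal.

   By Nakayama's lemma the condition says that N_N^2 is contained in xD_N for all such x. This forces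
   dimension one, and it makes (N_N : N_N) = p^-1 N_N a valuation ring with maximal ideal N_N.
   If D is a pullback of a Dedekind domain E, then N lies below a maximal ideal M of E with eM <= N for
   some e = 1 mod N, so the condition is inherited from M = xE + M^2. If all D_N are pseudo-valuation
   domains, then the maximal ideal of the valuation ring over D_N lies in D_N and contracts to a
   maximal ideal of D' containing the conductor, so membership in D can be tested modulo these ideals. *)

theory Submission
  imports Defs
begin

section \<open>TA-ideals and residually principal maximal ideals\<close>

text \<open>The implications form the cycle (a), (b), (c), (a). The condition on N is phrased with
  powers of N in D itself, since TA-factorizations are statements about ideals of D; it is carried
  to D_N only afterwards.

  The nonzero conductor supplies one c <> 0 with cD' <= D. Then cD' is an ideal of D, so chains of
  ideals of D' and generators of D'/M over the image of D can be sought inside the noetherian ring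
  D.

  Sums and products are the awkward point of the integral closure. Over a noetherian domain it
  coincides with the set of almost integral elements, and for these a common denominator of all x^i
  y^j settles the matter. The same notion shows that D' is integrally closed, that a nonzero element
  of D_N is divisible by p only finitely often, and that nonzero maximal ideals of a Dedekind domain
  are invertible.

  If D = D', no proper ideal contains the conductor, yet (c) asks for n >= 1. Hence one arbitrary
  maximal ideal is always added; its residue subfield is again the image of D, so the pullback does
  not change.\<close>

lemma (in cring) ideal_iff:
  "ideal I R \<longleftrightarrow> I \<subseteq> carrier R \<and> \<zero> \<in> I \<and> (\<forall>a\<in>I. \<forall>b\<in>I. a \<oplus> b \<in> I) \<and>
     (\<forall>a\<in>carrier R. \<forall>b\<in>I. a \<otimes> b \<in> I)" (is "_ \<longleftrightarrow> ?rhs")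
proof
  assume "ideal I R"
  then interpret ideal I R .
  show ?rhs using I_l_closed a_subset by auto
next
  assume r: ?rhs
  have neg: "\<ominus> a \<in> I" if "a \<in> I" for a
  proof -
    have "(\<ominus> \<one>) \<otimes> a \<in> I" using r that by blast
    moreover have "(\<ominus> \<one>) \<otimes> a = \<ominus> a" using r that by (metis l_minus l_one one_closed subsetD)
    ultimately show ?thesis by simp
  qed
  show "ideal I R"
  proof (rule idealI[OF ring_axioms])
    show "subgroup I (add_monoid R)"
      using r neg by (intro add.subgroupI) auto
    show "x \<otimes> a \<in> I" "a \<otimes> x \<in> I" if "a \<in> I" "x \<in> carrier R" for a x
      using r that m_comm[of a x] by auto
  qed
qed

lemma (in ring) idealD:
  assumes "ideal I R"
  shows "a \<in> I \<Longrightarrow> a \<in> carrier R" and "\<zero> \<in> I"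
    and "a \<in> I \<Longrightarrow> b \<in> I \<Longrightarrow> a \<oplus> b \<in> I"
    and "a \<in> I \<Longrightarrow> c \<in> carrier R \<Longrightarrow> c \<otimes> a \<in> I"
    and "a \<in> I \<Longrightarrow> c \<in> carrier R \<Longrightarrow> a \<otimes> c \<in> I"
proof -
  interpret ideal I R by fact
  show "a \<in> I \<Longrightarrow> a \<in> carrier R" and "\<zero> \<in> I"
    and "a \<in> I \<Longrightarrow> b \<in> I \<Longrightarrow> a \<oplus> b \<in> I"
    and "a \<in> I \<Longrightarrow> c \<in> carrier R \<Longrightarrow> c \<otimes> a \<in> I"
    and "a \<in> I \<Longrightarrow> c \<in> carrier R \<Longrightarrow> a \<otimes> c \<in> I"
    by (auto intro: I_l_closed I_r_closed)
qed

lemma (in cring) add_PIdl_iff: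
  assumes "ideal I R" "x \<in> carrier R"
  shows "z \<in> I <+> PIdl x \<longleftrightarrow> (\<exists>i\<in>I. \<exists>r\<in>carrier R. z = i \<oplus> x \<otimes> r)"
  using assms m_comm[of x] unfolding set_add_def' cgenideal_def by fastforce

lemma (in cring) ideal_add_PIdl:
  assumes "ideal I R" "x \<in> carrier R"
  shows "ideal (I <+> PIdl x) R" "I \<subseteq> I <+> PIdl x" "x \<in> I <+> PIdl x"
proof -
  have I: "I \<subseteq> carrier R" "\<zero> \<in> I" using assms idealD by blast+
  show "ideal (I <+> PIdl x) R"
    using add_ideals[OF assms(1) cgenideal_ideal[OF assms(2)]] .
  show "I \<subseteq> I <+> PIdl x"
  proof
    fix i assume "i \<in> I"
    then have "i = i \<oplus> x \<otimes> \<zero>" using I assms by auto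
    then show "i \<in> I <+> PIdl x" unfolding add_PIdl_iff[OF assms] using \<open>i \<in> I\<close> by blast
  qed
  have "x = \<zero> \<oplus> x \<otimes> \<one>" using assms by auto
  then show "x \<in> I <+> PIdl x" unfolding add_PIdl_iff[OF assms] using I by blast
qed

text \<open>The identity \<open>n \<oplus> x \<otimes> y = \<one>\<close> can be multiplied, squared
  and moved between subrings of a field, so later arguments work with it in place of classes in a
  residue field.\<close>

lemma (in cring) maximalideal_iff:
  "maximalideal N R \<longleftrightarrow> ideal N R \<and> \<one> \<notin> N \<and>
     (\<forall>x\<in>carrier R - N. \<exists>y\<in>carrier R. \<exists>n\<in>N. n \<oplus> x \<otimes> y = \<one>)" (is "_ \<longleftrightarrow> ?rhs")
proof
  assume "maximalideal N R"
  then interpret maximalideal N R .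
  have "\<exists>y\<in>carrier R. \<exists>n\<in>N. n \<oplus> x \<otimes> y = \<one>" if x: "x \<in> carrier R" "x \<notin> N" for x
  proof -
    note A = ideal_add_PIdl[OF is_ideal x(1)]
    have "N <+> PIdl x = carrier R"
      using I_maximal[OF A(1,2)] A(3) x(2) ideal.Icarr[OF A(1)] by auto
    then have "\<one> \<in> N <+> PIdl x" by simp
    then show ?thesis unfolding add_PIdl_iff[OF is_ideal x(1)] by metis
  qed
  then show ?rhs using is_ideal one_imp_carrier I_notcarr by blast
next
  assume r: ?rhs
  then have N: "ideal N R" by auto
  show "maximalideal N R"
  proof (rule maximalidealI[OF N])
    show "carrier R \<noteq> N" using r by auto
    fix J assume J: "ideal J R" "N \<subseteq> J" "J \<subseteq> carrier R"
    show "J = N \<or> J = carrier R"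
    proof (cases "J = N")
      case False
      then obtain x where x: "x \<in> J" "x \<notin> N" using J by blast
      then obtain y n where "y \<in> carrier R" "n \<in> N" "n \<oplus> x \<otimes> y = \<one>" using r J by blast
      then have "\<one> \<in> J" using J(2) x idealD(3,5)[OF J(1)] by (metis subsetD)
      then show ?thesis using ideal.one_imp_carrier[OF J(1)] by blast
    qed auto
  qed
qed

lemma (in cring) primeideal_iff:
  "primeideal P R \<longleftrightarrow> ideal P R \<and> \<one> \<notin> P \<and>
     (\<forall>x\<in>carrier R. \<forall>y\<in>carrier R. x \<otimes> y \<in> P \<longrightarrow> x \<in> P \<or> y \<in> P)"
  using primeidealI[OF _ is_cring] primeideal.I_prime primeideal.I_notcarr primeideal.axioms(1)
    ideal.one_imp_carrier one_closed
  by (metis)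

text \<open>In a noetherian ring the union of a nonempty chain of ideals belongs to the chain, so
  Zorn's lemma applies to any nonempty family.\<close>

lemma (in noetherian_ring) ideal_maximal_element:
  assumes "S \<noteq> {}" "\<And>I. I \<in> S \<Longrightarrow> ideal I R"
  shows "\<exists>J\<in>S. \<forall>I\<in>S. J \<subseteq> I \<longrightarrow> I = J"
proof (rule subset_Zorn_nonempty[OF assms(1)])
  fix C assume C: "C \<noteq> {}" "subset.chain S C"
  have CS: "C \<subseteq> S" using C(2) unfolding pred_on.chain_def by (rule conjunct1)
  have "C \<subseteq> {I. ideal I R}" using CS assms(2) by auto
  then have "subset.chain {I. ideal I R} C"
    using conjunct2[OF C(2)[unfolded pred_on.chain_def]] unfolding pred_on.chain_def by (rule conjI)
  then have "\<Union>C \<in> C" by (rule ideal_chain_is_trivial[OF C(1)])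
  then show "\<Union>C \<in> S" by (rule subsetD[OF CS])
qed

text \<open>A maximal member of a chain is its union. This converse transfers noetherianity along
  injective monotone maps between ideals, as needed for overrings and localizations.\<close>

lemma (in ring) noetherian_ring_if_maximal_element:
  assumes "\<And>S. S \<noteq> {} \<Longrightarrow> (\<And>I. I \<in> S \<Longrightarrow> ideal I R) \<Longrightarrow> \<exists>J\<in>S. \<forall>I\<in>S. J \<subseteq> I \<longrightarrow> I = J"
  shows "noetherian_ring R"
proof (rule trivial_ideal_chain_imp_noetherian)
  fix C assume C: "C \<noteq> {}" "subset.chain {I. ideal I R} C"
  have ids: "ideal I R" if "I \<in> C" for I
    using conjunct1[OF C(2)[unfolded pred_on.chain_def]] that by auto
  obtain J where J: "J \<in> C" "\<forall>I\<in>C. J \<subseteq> I \<longrightarrow> I = J"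
    using assms[OF C(1) ids] by blast
  have "I \<subseteq> J" if I: "I \<in> C" for I
  proof -
    have "I \<subset> J \<or> I = J \<or> J \<subset> I"
      using conjunct2[OF C(2)[unfolded pred_on.chain_def], rule_format, OF I J(1)] by auto
    then show ?thesis using I J(2) by auto
  qed
  then have "\<Union>C = J" using J by blast
  then show "\<Union>C \<in> C" using J by simp
qed

section \<open>Products and powers of ideals\<close>

abbreviation ideal_prod_list :: "('a, 'm) ring_scheme \<Rightarrow> 'a set list \<Rightarrow> 'a set" where
  "ideal_prod_list R Is \<equiv> foldr (ideal_prod R) Is (carrier R)"

abbreviation ideal_pow :: "('a, 'm) ring_scheme \<Rightarrow> 'a set \<Rightarrow> nat \<Rightarrow> 'a set" where
  "ideal_pow R I n \<equiv> ideal_prod_list R (replicate n I)"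

lemma (in ring) ideal_prod_subsetI:
  assumes "ideal Z R" "\<And>a b. a \<in> I \<Longrightarrow> b \<in> J \<Longrightarrow> a \<otimes> b \<in> Z"
  shows "I \<cdot> J \<subseteq> Z"
proof
  fix z assume "z \<in> I \<cdot> J"
  then show "z \<in> Z"
    by (induct z rule: ideal_prod.induct)
      (auto simp: assms additive_subgroup.a_closed[OF ideal.axioms(1)[OF assms(1)]])
qed

lemma (in ring) ideal_prod_mono:
  assumes "I \<subseteq> I'" "J \<subseteq> J'"
  shows "I \<cdot> J \<subseteq> I' \<cdot> J'"
proof
  fix z assume "z \<in> I \<cdot> J"
  then show "z \<in> I' \<cdot> J'"
    by (induct z rule: ideal_prod.induct) (use assms in \<open>auto intro: ideal_prod.intros\<close>)
qed

lemma (in ring) ideal_ideal_prod_list: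
  assumes "\<And>I. I \<in> set Is \<Longrightarrow> ideal I R"
  shows "ideal (ideal_prod_list R Is) R"
  using assms by (induct Is) (auto simp: oneideal ideal_prod_is_ideal)

lemma (in cring) one_ideal_prod: "ideal I R \<Longrightarrow> carrier R \<cdot> I = I"
  using ideal_prod_commute[OF oneideal] ideal_prod_one by metis

lemma (in cring) ideal_prod_list_append:
  assumes "\<And>I. I \<in> set Is \<union> set Js \<Longrightarrow> ideal I R"
  shows "ideal_prod_list R (Is @ Js) = ideal_prod_list R Is \<cdot> ideal_prod_list R Js"
  using assms
proof (induct Is)
  case Nil
  then show ?case using one_ideal_prod[OF ideal_ideal_prod_list] by simp
next
  case (Cons I Is)
  have "ideal (ideal_prod_list R Is) R" "ideal (ideal_prod_list R Js) R"
    using Cons(2) by (auto intro!: ideal_ideal_prod_list)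
  then show ?case using Cons by (simp add: ideal_prod_assoc)
qed

lemma (in cring) ideal_pow_add:
  assumes "ideal I R"
  shows "ideal_pow R I (m + n) = ideal_pow R I m \<cdot> ideal_pow R I n"
  unfolding replicate_add using assms by (intro ideal_prod_list_append) auto

lemma (in cring) ideal_ideal_pow: "ideal I R \<Longrightarrow> ideal (ideal_pow R I n) R"
  by (rule ideal_ideal_prod_list) auto

lemma (in cring) ideal_pow_2: "ideal I R \<Longrightarrow> ideal_pow R I 2 = I \<cdot> I"
  by (simp add: numeral_2_eq_2 ideal_prod_one)

lemma (in cring) ideal_pow_3: "ideal I R \<Longrightarrow> ideal_pow R I 3 = I \<cdot> (I \<cdot> I)"
  by (simp add: numeral_3_eq_3 ideal_prod_one)

text \<open>This condition at every maximal ideal \<open>N\<close> is the elementary content of \<open>D\<^sub>N\<close> being a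
  pseudo-valuation domain over a discrete valuation ring: \<open>N\<^sup>2 \<subseteq> xD + N\<^sup>3\<close> for all \<open>x \<in> N - N\<^sup>2\<close>.\<close>

definition residually_principal :: "('a, 'm) ring_scheme \<Rightarrow> 'a set \<Rightarrow> bool" where
  "residually_principal R N \<longleftrightarrow> (\<forall>x\<in>N - N \<cdot>\<^bsub>R\<^esub> N. \<forall>a\<in>N. \<forall>b\<in>N.
     \<exists>r\<in>carrier R. \<exists>z\<in>N \<cdot>\<^bsub>R\<^esub> (N \<cdot>\<^bsub>R\<^esub> N). a \<otimes>\<^bsub>R\<^esub> b = z \<oplus>\<^bsub>R\<^esub> x \<otimes>\<^bsub>R\<^esub> r)"

lemma (in cring) residually_principal_subset:
  assumes N: "ideal N R" and rp: "residually_principal R N" and x: "x \<in> N - N \<cdot> N"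
  shows "N \<cdot> N \<subseteq> (N \<cdot> (N \<cdot> N)) <+> PIdl x"
proof (rule ideal_prod_subsetI)
  have x': "x \<in> carrier R" using x idealD(1)[OF N] by blast
  have N3: "ideal (N \<cdot> (N \<cdot> N)) R" using N ideal_prod_is_ideal by blast
  show "ideal ((N \<cdot> (N \<cdot> N)) <+> PIdl x) R" using ideal_add_PIdl(1)[OF N3 x'] .
  show "a \<otimes> b \<in> (N \<cdot> (N \<cdot> N)) <+> PIdl x" if "a \<in> N" "b \<in> N" for a b
    using rp x that unfolding residually_principal_def add_PIdl_iff[OF N3 x'] by blast
qed

section \<open>TA-ideals near a maximal ideal\<close>

lemma (in cring) maximalideal_supset_pow:
  assumes N: "maximalideal N R" and I: "ideal I R" "\<one> \<notin> I" "ideal_pow R N n \<subseteq> I"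
  shows "I \<subseteq> N"
proof (rule ccontr)
  assume "\<not> I \<subseteq> N"
  then obtain x where x: "x \<in> I" "x \<notin> N" by blast
  have N': "ideal N R" using N maximalideal_iff by auto
  have xc: "x \<in> carrier R" using x idealD(1)[OF I(1)] by blast
  obtain y m where y: "y \<in> carrier R" "m \<in> N" "m \<oplus> x \<otimes> y = \<one>"
    using N x xc unfolding maximalideal_iff by blast
  have mc: "m \<in> carrier R" using y idealD(1)[OF N'] by blast
  have xy: "x \<otimes> y \<in> I" using x y idealD(5)[OF I(1)] by metis
  \<comment> \<open>A unit modulo \<open>N\<close> stays a unit modulo every power: multiplying
    \<open>p \<oplus> i = \<one>\<close> by \<open>m\<close> and adding \<open>x \<otimes> y\<close>
    gives the next decomposition.\<close>
  have "\<exists>p\<in>ideal_pow R N n. \<exists>i\<in>I. p \<oplus> i = \<one>"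
  proof (induct n)
    case 0
    then show ?case using idealD(2)[OF I(1)] by force
  next
    case (Suc n)
    then obtain p i where p: "p \<in> ideal_pow R N n" "i \<in> I" "p \<oplus> i = \<one>" by blast
    have c: "p \<in> carrier R" "i \<in> carrier R"
      using p idealD(1)[OF I(1)] idealD(1)[OF ideal_ideal_pow[OF N']] by blast+
    have "m \<otimes> p \<oplus> (m \<otimes> i \<oplus> x \<otimes> y) = m \<otimes> (p \<oplus> i) \<oplus> x \<otimes> y" using c mc xc y by algebra
    also have "\<dots> = \<one>" using p y mc by simp
    finally have "m \<otimes> p \<oplus> (m \<otimes> i \<oplus> x \<otimes> y) = \<one>" .
    moreover have "m \<otimes> p \<in> ideal_pow R N (Suc n)" using y p by (simp add: ideal_prod.prod)
    moreover have "m \<otimes> i \<oplus> x \<otimes> y \<in> I" using idealD(3,4)[OF I(1)] mc p xy by metis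
    ultimately show ?case by blast
  qed
  then have "\<one> \<in> I" using idealD(3)[OF I(1)] I(3) by (metis subsetD)
  then show False using I by simp
qed

text \<open>If one of the three factors lies outside \<open>N\<close>, it is a unit modulo N^2,
  hence modulo \<open>I\<close>, and cancels. If all lie in \<open>N\<close>, every product of two
  is already in \<open>I\<close>.\<close>

lemma (in cring) TA_ideal_if_square_subset:
  assumes N: "maximalideal N R" and I: "ideal I R" "I \<subseteq> N" "N \<cdot> N \<subseteq> I"
  shows "TA_ideal I R"
  unfolding TA_ideal_def
proof (intro conjI ballI impI I)
  fix a b c assume c: "a \<in> carrier R" "b \<in> carrier R" "c \<in> carrier R" and abc: "a \<otimes> b \<otimes> c \<in> I"
  have unit: "u \<in> I" if u: "u \<in> carrier R" "v \<in> carrier R" "u \<otimes> v \<in> I" "v \<notin> N" for u v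
  proof -
    have Nid: "ideal N R" using N maximalideal_iff by auto
    obtain y m where y: "y \<in> carrier R" "m \<in> N" "m \<oplus> v \<otimes> y = \<one>"
      using N u unfolding maximalideal_iff by blast
    have mc: "m \<in> carrier R" using y idealD(1)[OF Nid] by blast
    obtain p where p: "p = m \<otimes> m" "p \<in> I" "p \<in> carrier R"
      using I(3) y mc by (auto intro: ideal_prod.prod)
    \<comment> \<open>Squaring \<open>m \<oplus> v \<otimes> y = \<one>\<close> replaces the error
      \<open>m\<close> by its square, which lies in \<open>I\<close>.\<close>
    have "u = u \<otimes> ((m \<oplus> v \<otimes> y) \<otimes> (m \<oplus> v \<otimes> y))" unfolding y(3) using u by simp
    also have "\<dots> = u \<otimes> (m \<otimes> m) \<oplus> (m \<otimes> y \<oplus> m \<otimes> y \<oplus> v \<otimes> y \<otimes> y) \<otimes> (u \<otimes> v)"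
      using u y(1) mc by algebra
    also have "\<dots> \<in> I" using idealD(3-5)[OF I(1)] u y mc p by auto
    finally show ?thesis .
  qed
  have eq: "a \<otimes> b \<otimes> c = a \<otimes> c \<otimes> b" "a \<otimes> b \<otimes> c = b \<otimes> c \<otimes> a" using c by algebra+
  show "a \<otimes> b \<in> I \<or> a \<otimes> c \<in> I \<or> b \<otimes> c \<in> I"
    using unit[of "a \<otimes> b" c] unit[of "a \<otimes> c" b] unit[of "b \<otimes> c" a] abc c
      I(3) ideal_prod.prod[of a N b N R] unfolding eq[symmetric] by auto
qed

text \<open>Applied to a, a, a the TA-property puts all squares of elements of \<open>N\<close> into
  \<open>I\<close>. Applied to a + b, a, b, whose product b a^2 + a b^2 is then in \<open>I\<close>,
  it gives ab directly or after removing a square; no division by 2 occurs.\<close>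

lemma (in cring) square_subset_if_TA_ideal:
  assumes I: "TA_ideal I R" and N: "ideal N R" and cube: "N \<cdot> (N \<cdot> N) \<subseteq> I"
  shows "N \<cdot> N \<subseteq> I"
proof (rule ideal_prod_subsetI)
  show Ii: "ideal I R" using I TA_ideal_def by auto
  have TA: "a \<otimes> b \<in> I \<or> a \<otimes> c \<in> I \<or> b \<otimes> c \<in> I"
    if "a \<in> carrier R" "b \<in> carrier R" "c \<in> carrier R" "a \<otimes> b \<otimes> c \<in> I" for a b c
    using I that unfolding TA_ideal_def by blast
  have sq: "a \<otimes> a \<in> I" "a \<in> carrier R" if "a \<in> N" for a
  proof -
    show a: "a \<in> carrier R" using that idealD(1)[OF N] by blast
    have "a \<otimes> (a \<otimes> a) \<in> I" using cube that by (auto intro: ideal_prod.prod)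
    then show "a \<otimes> a \<in> I" using TA[of a a a] a m_assoc by auto
  qed
  fix a b assume ab: "a \<in> N" "b \<in> N"
  note c = sq[OF ab(1)] sq[OF ab(2)]
  have add: "x \<oplus> y \<in> I" if "x \<in> I" "y \<in> I" for x y using that idealD[OF Ii] by blast
  have mul: "x \<otimes> y \<in> I" if "x \<in> carrier R" "y \<in> I" for x y using that idealD[OF Ii] by blast
  have minus: "y \<in> I" if "x \<in> I" "x \<oplus> y \<in> I" "y \<in> carrier R" for x y
  proof -
    have xc: "x \<in> carrier R" using that idealD[OF Ii] by blast
    have "y = (\<ominus> \<one>) \<otimes> x \<oplus> (x \<oplus> y)" using that xc by algebra
    then show ?thesis using add mul that by (metis a_inv_closed one_closed)
  qed
  have "(a \<oplus> b) \<otimes> a \<otimes> b = b \<otimes> (a \<otimes> a) \<oplus> a \<otimes> (b \<otimes> b)" using c by algebra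
  then have "(a \<oplus> b) \<otimes> a \<otimes> b \<in> I" using add mul c by auto
  then consider "(a \<oplus> b) \<otimes> a \<in> I" | "(a \<oplus> b) \<otimes> b \<in> I" | "a \<otimes> b \<in> I"
    using TA[of "a \<oplus> b" a b] c by auto
  then show "a \<otimes> b \<in> I"
  proof cases
    case 1
    have "(a \<oplus> b) \<otimes> a = a \<otimes> a \<oplus> a \<otimes> b" using c by algebra
    then show ?thesis using 1 minus c by (metis m_closed)
  next
    case 2
    have "(a \<oplus> b) \<otimes> b = b \<otimes> b \<oplus> a \<otimes> b" using c by algebra
    then show ?thesis using 2 minus c by (metis m_closed)
  qed
qed

theorem (in domain) TAF_domain_residually_principal:
  assumes TAF: "TAF_domain R" and N: "maximalideal N R"
  shows "residually_principal R N"
  unfolding residually_principal_def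
proof (intro ballI)
  fix x a b assume x: "x \<in> N - N \<cdot> N" and ab: "a \<in> N" "b \<in> N"
  have Ni: "ideal N R" using N maximalideal_iff by auto
  have xc: "x \<in> carrier R" using x idealD(1)[OF Ni] by blast
  let ?C = "N \<cdot> (N \<cdot> N)" let ?I = "?C <+>\<^bsub>R\<^esub> PIdl x"
  have C: "ideal ?C R" using Ni ideal_prod_is_ideal by blast
  have CN: "?C \<subseteq> N" using ideal_prod_inter[OF Ni] Ni ideal_prod_is_ideal by blast
  note I = ideal_add_PIdl[OF C xc]
  have IN: "?I \<subseteq> N"
  proof
    fix z assume "z \<in> ?I"
    then obtain i r where "i \<in> ?C" "r \<in> carrier R" "z = i \<oplus> x \<otimes> r"
      using add_PIdl_iff[OF C xc] by blast
    then show "z \<in> N" using CN x idealD(3,5)[OF Ni] by auto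
  qed
  have "?I \<noteq> carrier R" using IN N maximalideal_iff by (metis one_closed subsetD)
  then obtain Js where Js: "TA_factorization R ?I Js"
    using TAF I(1) unfolding TAF_domain_def by blast
  have Jid: "ideal J R" "J \<noteq> carrier R" if "J \<in> set Js" for J
    using Js that unfolding TA_factorization_def TA_ideal_def by auto
  have sub: "ideal_prod_list R Ks \<subseteq> J" if "J \<in> set Ks" "set Ks \<subseteq> set Js" for J Ks
    using that
  proof (induct Ks)
    case (Cons K Ks)
    have "K \<cdot> ideal_prod_list R Ks \<subseteq> K \<inter> ideal_prod_list R Ks"
      using Cons Jid by (intro ideal_prod_inter ideal_ideal_prod_list) auto
    then show ?case using Cons by auto
  qed auto
  \<comment> \<open>Each factor contains the whole product, hence N^3, and is proper.\<close>
  have JN: "J \<subseteq> N" if "J \<in> set Js" for J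
  proof (rule maximalideal_supset_pow[OF N Jid(1)[OF that], of 3])
    show "\<one> \<notin> J" using Jid[OF that] ideal.one_imp_carrier by blast
    show "ideal_pow R N 3 \<subseteq> J"
      using sub[OF that] Js I(2) unfolding ideal_pow_3[OF Ni] TA_factorization_def by blast
  qed
  obtain J Ks where JK: "Js = J # Ks" using Js unfolding TA_factorization_def by (cases Js) auto
  \<comment> \<open>A second factor, also inside \<open>N\<close>, would put the product and with it
    \<open>x\<close> into N^2.\<close>
  have "Ks = []"
  proof (rule ccontr)
    assume "Ks \<noteq> []"
    then obtain K where K: "K \<in> set Ks" by (cases Ks) auto
    have "ideal_prod_list R Ks \<subseteq> N" using sub[OF K] JN[of K] K JK by auto
    then have "?I \<subseteq> N \<cdot> N"
      using Js JN[of J] JK ideal_prod_mono unfolding TA_factorization_def by auto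
    then show False using I(3) x by blast
  qed
  then have "?I = J" using Js JK Jid[of J] ideal_prod_one unfolding TA_factorization_def by auto
  then have "TA_ideal ?I R" using Js JK unfolding TA_factorization_def by auto
  then have "N \<cdot> N \<subseteq> ?I" using square_subset_if_TA_ideal Ni I(2) by blast
  then have "a \<otimes> b \<in> ?I" using ab by (auto intro: ideal_prod.prod)
  then show "\<exists>r\<in>carrier R. \<exists>z\<in>?C. a \<otimes> b = z \<oplus> x \<otimes> r"
    unfolding add_PIdl_iff[OF C xc] by blast
qed

section \<open>TA-factorizations of ideals containing a power of a maximal ideal\<close>

definition TA_factorable :: "('a, 'm) ring_scheme \<Rightarrow> 'a set \<Rightarrow> bool" where
  "TA_factorable R I \<longleftrightarrow> I = carrier R \<or> (\<exists>Js. TA_factorization R I Js)"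

text \<open>Counting the unit ideal as factorable spares a case distinction: the cofactors (I : p)
  and the sums I + A below may be the whole ring.\<close>

lemma (in cring) TA_factorable_prod:
  assumes "TA_factorable R I" "TA_factorable R J" "ideal I R" "ideal J R"
  shows "TA_factorable R (I \<cdot> J)"
proof -
  consider "I = carrier R" | "J = carrier R"
    | Is Js where "TA_factorization R I Is" "TA_factorization R J Js"
    using assms unfolding TA_factorable_def by blast
  then show ?thesis
  proof cases
    case 1
    then show ?thesis using assms one_ideal_prod by simp
  next
    case 2
    then show ?thesis using assms ideal_prod_one by simp
  next
    case 3
    then have "I \<cdot> J = ideal_prod_list R (Is @ Js)"
      unfolding TA_factorization_def TA_ideal_def by (subst ideal_prod_list_append) auto
    then have "TA_factorization R (I \<cdot> J) (Is @ Js)"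
      using 3 unfolding TA_factorization_def by auto
    then show ?thesis unfolding TA_factorable_def by blast
  qed
qed

lemma (in cring) TA_ideal_factorable:
  assumes "TA_ideal I R"
  shows "TA_factorable R I"
proof (cases "I = carrier R")
  case False
  have "I = ideal_prod_list R [I]" using assms ideal_prod_one unfolding TA_ideal_def by simp
  then have "TA_factorization R I [I]" using assms False unfolding TA_factorization_def by simp
  then show ?thesis unfolding TA_factorable_def by blast
qed (simp add: TA_factorable_def)

lemma (in cring) add_PIdl_subset:
  assumes "ideal I R" "ideal N R" "I \<subseteq> N" "x \<in> N"
  shows "I <+>\<^bsub>R\<^esub> PIdl x \<subseteq> N"
proof
  fix z assume "z \<in> I <+>\<^bsub>R\<^esub> PIdl x"
  then obtain i r where "i \<in> I" "r \<in> carrier R" "z = i \<oplus> x \<otimes> r"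
    using add_PIdl_iff[OF assms(1) idealD(1)[OF assms(2,4)]] by blast
  then show "z \<in> N" using assms(3,4) idealD(3,5)[OF assms(2)] by auto
qed

text \<open>Multiplying N^2 <= xR + N^3 by N^j gives N^(j+2) <= xR + N^(j+3). Since \<open>I\<close>
  absorbs high powers of \<open>N\<close>, this chain can be descended to exponent 2.\<close>

lemma (in cring) square_subset_principal_add:
  assumes N: "ideal N R" and rp: "residually_principal R N" and x: "x \<in> N - N \<cdot> N"
    and I: "ideal I R" "ideal_pow R N n \<subseteq> I"
  shows "N \<cdot> N \<subseteq> I <+>\<^bsub>R\<^esub> PIdl x"
proof -
  have xc: "x \<in> carrier R" using x idealD(1)[OF N] by blast
  let ?Z = "I <+>\<^bsub>R\<^esub> PIdl x"
  note Z = ideal_add_PIdl[OF I(1) xc]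
  note pow = ideal_ideal_pow[OF N]
  \<comment> \<open>The descent starts at exponent n + 2, so that its last step k = n ends exactly
    at N^2 and no subtraction is truncated.\<close>
  have "ideal_pow R N (n + 2 - k) \<subseteq> ?Z" if "k \<le> n" for k
    using that
  proof (induct k)
    case 0
    have "ideal_pow R N (n + 2) \<subseteq> ideal_pow R N n"
      unfolding ideal_pow_add[OF N] using ideal_prod_inter[OF pow pow] by blast
    then show ?case using I(2) Z(2) by auto
  next
    case (Suc k)
    define j where "j = n - Suc k"
    have j: "n + 2 - Suc k = j + 2" "n + 2 - k = j + 3" using Suc j_def by auto
    have IH: "ideal_pow R N j \<cdot> (N \<cdot> (N \<cdot> N)) \<subseteq> ?Z"
      using Suc unfolding j ideal_pow_add[OF N] ideal_pow_3[OF N] by simp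
    have "ideal_pow R N j \<cdot> (N \<cdot> N) \<subseteq> ?Z"
    proof (rule ideal_prod_subsetI[OF Z(1)])
      fix u v assume u: "u \<in> ideal_pow R N j" and v: "v \<in> N \<cdot> N"
      have N3: "ideal (N \<cdot> (N \<cdot> N)) R" using N ideal_prod_is_ideal by blast
      obtain z r where z: "z \<in> N \<cdot> (N \<cdot> N)" "r \<in> carrier R" "v = z \<oplus> x \<otimes> r"
        using residually_principal_subset[OF N rp x] v add_PIdl_iff[OF N3 xc] by blast
      have c: "u \<in> carrier R" "z \<in> carrier R" using u z idealD(1)[OF pow] idealD(1)[OF N3] by blast+
      have "u \<otimes> v = u \<otimes> z \<oplus> x \<otimes> (u \<otimes> r)" using c z(2) xc unfolding z(3) by algebra
      moreover have "u \<otimes> z \<in> ?Z" using IH u z by (auto intro: ideal_prod.prod)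
      moreover have "x \<otimes> (u \<otimes> r) \<in> ?Z" using Z idealD(5)[OF Z(1) Z(3)] c z by auto
      ultimately show "u \<otimes> v \<in> ?Z" using idealD(3)[OF Z(1)] by simp
    qed
    then show ?case unfolding j ideal_pow_add[OF N] ideal_pow_2[OF N] .
  qed
  from this[of n] show ?thesis using ideal_pow_2[OF N] by simp
qed

lemma (in cring) ideal_pow_Suc_subset:
  assumes "ideal N R"
  shows "ideal_pow R N (Suc n) \<subseteq> ideal_pow R N n"
  using ideal_prod_inter[OF assms ideal_ideal_pow[OF assms]] by auto

text \<open>Induction on the exponent: passing from I to (I : p) lowers it by one, because p N^n <=
  N^(n+1) <= I. A proper I with an element x outside N^2 contains N^2, as N^2 <= I + xR = I, so only
  I <= N^2 has to be split.\<close>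

lemma (in cring) TA_factorable_if_pow_subset:
  assumes N: "maximalideal N R" and rp: "residually_principal R N"
    and I: "ideal I R" "ideal_pow R N n \<subseteq> I"
  shows "TA_factorable R I"
  using I
proof (induct n arbitrary: I)
  case 0
  then have "I = carrier R" using idealD(1)[OF 0(1)] by auto
  then show ?case by (simp add: TA_factorable_def)
next
  case (Suc n)
  have Ni: "ideal N R" using N maximalideal_iff by blast
  note pow = ideal_ideal_pow[OF Ni]
  have N2: "ideal (N \<cdot> N) R" using Ni ideal_prod_is_ideal by blast
  show ?case
  proof (cases "I = carrier R \<or> N \<cdot> N \<subseteq> I")
    case True
    moreover have "TA_ideal I R" if "N \<cdot> N \<subseteq> I" "I \<noteq> carrier R"
      using TA_ideal_if_square_subset[OF N Suc(2) _ that(1)]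
        maximalideal_supset_pow[OF N Suc(2) _ Suc(3)] ideal.one_imp_carrier[OF Suc(2)] that by blast
    ultimately show ?thesis using TA_ideal_factorable by (auto simp: TA_factorable_def)
  next
    case False
    then have IN: "I \<subseteq> N"
      using maximalideal_supset_pow[OF N Suc(2) _ Suc(3)] ideal.one_imp_carrier[OF Suc(2)] by blast
    have IN2: "I \<subseteq> N \<cdot> N"
    proof
      fix x assume x: "x \<in> I"
      show "x \<in> N \<cdot> N"
      proof (rule ccontr)
        assume "x \<notin> N \<cdot> N"
        then have xN: "x \<in> N - N \<cdot> N" using x IN by auto
        have xc: "x \<in> carrier R" using x idealD(1)[OF Suc(2)] by blast
        have "I <+>\<^bsub>R\<^esub> PIdl x \<subseteq> I"
          using add_PIdl_subset[OF Suc(2) Suc(2) _ x] by blast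
        then show False
          using square_subset_principal_add[OF Ni rp xN Suc(2,3)] False by blast
      qed
    qed
    show ?thesis
    proof (cases "N \<subseteq> N \<cdot> N")
      case True
      \<comment> \<open>An idempotent \<open>N\<close> equals all its positive powers and would lie
        in \<open>I\<close>, against the assumption that N^2 does not.\<close>
      have "N \<subseteq> ideal_pow R N (Suc k)" for k
      proof (induct k)
        case 0 then show ?case using ideal_prod_one[OF Ni] by simp
      next
        case (Suc k) then show ?case using True ideal_prod_mono[of N N N] by auto
      qed
      then show ?thesis using Suc(3) IN2 False ideal_prod_inter[OF Ni Ni] by blast
    next
      case False
      then obtain p where p: "p \<in> N - N \<cdot> N" by blast
      have pc: "p \<in> carrier R" using p idealD(1)[OF Ni] by blast
      define T where "T = {t \<in> carrier R. p \<otimes> t \<in> I}"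
      define B where "B = (N \<cdot> N) <+>\<^bsub>R\<^esub> PIdl p"
      note B = ideal_add_PIdl[OF N2 pc, folded B_def]
      have T: "ideal T R"
        unfolding ideal_iff
      proof (intro conjI ballI)
        show "\<zero> \<in> T" using pc idealD(2)[OF Suc(2)] by (simp add: T_def)
        show "a \<oplus> b \<in> T" if "a \<in> T" "b \<in> T" for a b
          using that pc idealD(3)[OF Suc(2)] by (simp add: T_def r_distr)
        show "a \<otimes> b \<in> T" if "a \<in> carrier R" "b \<in> T" for a b
          using that pc idealD(4)[OF Suc(2), of "p \<otimes> b" a] m_lcomm[of a p b]
          by (simp add: T_def)
      qed (auto simp: T_def)
      have powT: "ideal_pow R N n \<subseteq> T"
      proof
        fix u assume u: "u \<in> ideal_pow R N n"
        then have "p \<otimes> u \<in> ideal_pow R N (Suc n)" using p by (auto intro: ideal_prod.prod)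
        then show "u \<in> T" using u Suc(3) idealD(1)[OF pow] by (auto simp: T_def)
      qed
      note N2p = square_subset_principal_add[OF Ni rp p]
      \<comment> \<open>Modulo \<open>I\<close> every element of N^2, and thus of \<open>B\<close>,
        is a multiple of p, and \<open>T\<close> consists of the elements that p carries into
        \<open>I\<close>.\<close>
      have "T \<cdot> B \<subseteq> I"
      proof (rule ideal_prod_subsetI[OF Suc(2)])
        fix t b assume t: "t \<in> T" and b: "b \<in> B"
        have tc: "t \<in> carrier R" "p \<otimes> t \<in> I" using t by (auto simp: T_def)
        obtain w r where w: "w \<in> N \<cdot> N" "r \<in> carrier R" "b = w \<oplus> p \<otimes> r"
          using b add_PIdl_iff[OF N2 pc] unfolding B_def by blast
        obtain i r' where i: "i \<in> I" "r' \<in> carrier R" "w = i \<oplus> p \<otimes> r'"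
          using N2p[OF Suc(2,3)] w(1) add_PIdl_iff[OF Suc(2) pc] by blast
        have ic: "i \<in> carrier R" using i idealD(1)[OF Suc(2)] by blast
        have "t \<otimes> b = t \<otimes> i \<oplus> (r' \<oplus> r) \<otimes> (p \<otimes> t)"
          using tc(1) pc ic i(2) w(2) unfolding w(3) i(3) by algebra
        also have "\<dots> \<in> I" using idealD(3,4)[OF Suc(2)] i w tc by simp
        finally show "t \<otimes> b \<in> I" .
      qed
      \<comment> \<open>Write y = m + pd with m in N^(n+2). This exponent is small enough for m in
        N^n N^2 <= TB and large enough for m in \<open>I\<close>, which forces pd in
        \<open>I\<close>, that is, d in \<open>T\<close>.\<close>
      moreover have "I \<subseteq> T \<cdot> B"
      proof
        fix y assume y: "y \<in> I"
        have TB: "ideal (T \<cdot> B) R" using T B(1) ideal_prod_is_ideal by blast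
        obtain m d where m: "m \<in> ideal_pow R N (Suc (Suc n))" "d \<in> carrier R" "y = m \<oplus> p \<otimes> d"
          using N2p[OF pow, of "Suc (Suc n)" "Suc (Suc n)"] y IN2 add_PIdl_iff[OF pow pc] by blast
        have mI: "m \<in> I" using m(1) ideal_pow_Suc_subset[OF Ni, of "Suc n"] Suc(3) by blast
        have c: "m \<in> carrier R" using mI idealD(1)[OF Suc(2)] by blast
        have "p \<otimes> d = y \<oplus> (\<ominus> \<one>) \<otimes> m" using m c pc by algebra
        then have "p \<otimes> d \<in> I" using idealD(3,4)[OF Suc(2)] y mI by simp
        then have "d \<in> T" using m by (simp add: T_def)
        then have 1: "p \<otimes> d \<in> T \<cdot> B" using B(3) ideal_prod.prod[of d T p B R] m_comm pc m by simp
        have "Suc (Suc n) = n + 2" by simp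
        then have "m \<in> ideal_pow R N n \<cdot> (N \<cdot> N)"
          using m(1) ideal_pow_add[OF Ni, of n 2] unfolding ideal_pow_2[OF Ni] by metis
        then have "m \<in> T \<cdot> B" using ideal_prod_mono[OF powT B(2)] by blast
        then show "y \<in> T \<cdot> B" using 1 idealD(3)[OF TB] m by simp
      qed
      ultimately have "I = T \<cdot> B" by blast
      moreover have "TA_factorable R T" using Suc(1)[OF T powT] .
      moreover have "B \<subseteq> N"
        using add_PIdl_subset[OF N2 Ni] ideal_prod_inter[OF Ni Ni] p unfolding B_def by blast
      then have "TA_factorable R B"
        using TA_ideal_if_square_subset[OF N B(1) _ B(2)] TA_ideal_factorable by blast
      ultimately show ?thesis using TA_factorable_prod T B(1) by simp
    qed
  qed
qed

section \<open>Comaximal ideals and ideals below products of maximal ideals\<close>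

definition comaximal :: "('a, 'm) ring_scheme \<Rightarrow> 'a set \<Rightarrow> 'a set \<Rightarrow> bool" where
  "comaximal R I J \<longleftrightarrow> (\<exists>a\<in>I. \<exists>b\<in>J. a \<oplus>\<^bsub>R\<^esub> b = \<one>\<^bsub>R\<^esub>)"

lemma (in cring) comaximal_sym:
  "ideal I R \<Longrightarrow> ideal J R \<Longrightarrow> comaximal R I J \<Longrightarrow> comaximal R J I"
  unfolding comaximal_def using idealD(1) a_comm by metis

lemma (in cring) comaximal_prod:
  assumes "ideal I R" "ideal J R" "ideal L R" "comaximal R I J" "comaximal R I L"
  shows "comaximal R I (J \<cdot> L)"
proof -
  obtain a b c d where *: "a \<in> I" "b \<in> J" "a \<oplus> b = \<one>" "c \<in> I" "d \<in> L" "c \<oplus> d = \<one>"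
    using assms unfolding comaximal_def by blast
  have C: "a \<in> carrier R" "b \<in> carrier R" "c \<in> carrier R" "d \<in> carrier R"
    using * idealD(1)[OF assms(1)] idealD(1)[OF assms(2)] idealD(1)[OF assms(3)] by blast+
  have "(a \<otimes> c \<oplus> a \<otimes> d \<oplus> b \<otimes> c) \<oplus> b \<otimes> d = (a \<oplus> b) \<otimes> (c \<oplus> d)" using C by algebra
  then have "(a \<otimes> c \<oplus> a \<otimes> d \<oplus> b \<otimes> c) \<oplus> b \<otimes> d = \<one>" using * by simp
  moreover have "a \<otimes> c \<oplus> a \<otimes> d \<oplus> b \<otimes> c \<in> I" using * C idealD(3-5)[OF assms(1)] by simp
  moreover have "b \<otimes> d \<in> J \<cdot> L" using * by (auto intro: ideal_prod.prod)
  ultimately show ?thesis unfolding comaximal_def by blast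
qed

lemma (in cring) comaximal_prod_list:
  assumes "ideal I R" "\<And>J. J \<in> set Js \<Longrightarrow> ideal J R \<and> comaximal R I J"
  shows "comaximal R I (ideal_prod_list R Js)"
  using assms(2)
proof (induct Js)
  case Nil
  have "\<zero> \<oplus> \<one> = \<one>" by simp
  then show ?case using idealD(2)[OF assms(1)] unfolding comaximal_def by fastforce
next
  case (Cons J Js)
  then show ?case using comaximal_prod[OF assms(1)] ideal_ideal_prod_list[of Js] by auto
qed

lemma (in cring) comaximal_maximalideals:
  assumes "maximalideal M R" "maximalideal N R" "M \<noteq> N"
  shows "comaximal R M N"
proof -
  have i: "ideal M R" "ideal N R" using assms maximalideal_iff by blast+
  have "\<not> N \<subseteq> M"
    using maximalideal.I_maximal[OF assms(2) i(1)] assms(3) maximalideal.I_notcarr[OF assms(1)]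
      idealD(1)[OF i(1)] by blast
  then obtain x where x: "x \<in> N" "x \<notin> M" by blast
  then obtain y m where "y \<in> carrier R" "m \<in> M" "m \<oplus> x \<otimes> y = \<one>"
    using assms(1) idealD(1)[OF i(2)] unfolding maximalideal_iff by blast
  then show ?thesis using x idealD(5)[OF i(2)] unfolding comaximal_def by blast
qed

text \<open>Expanding (I + A)(I + B) leaves AB as the only term not visibly in I. Conversely, a + b
  = 1 gives x = ax + xb, where each product has one factor in I + A and the other in I + B.\<close>

lemma (in cring) ideal_eq_prod_if_comaximal:
  assumes I: "ideal I R" and A: "ideal A R" and B: "ideal B R"
    and AB: "comaximal R A B" "A \<cdot> B \<subseteq> I"
  shows "I = (I <+>\<^bsub>R\<^esub> A) \<cdot> (I <+>\<^bsub>R\<^esub> B)"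
proof
  have IA: "ideal (I <+>\<^bsub>R\<^esub> A) R" and IB: "ideal (I <+>\<^bsub>R\<^esub> B) R" using I A B add_ideals by auto
  note m = idealD(1)[OF I] idealD(1)[OF A] idealD(1)[OF B]
  show "(I <+>\<^bsub>R\<^esub> A) \<cdot> (I <+>\<^bsub>R\<^esub> B) \<subseteq> I"
  proof (rule ideal_prod_subsetI[OF I])
    fix u v assume "u \<in> I <+>\<^bsub>R\<^esub> A" "v \<in> I <+>\<^bsub>R\<^esub> B"
    then obtain i a j b where *: "i \<in> I" "a \<in> A" "u = i \<oplus> a" "j \<in> I" "b \<in> B" "v = j \<oplus> b"
      unfolding set_add_def' by blast
    have "u \<otimes> v = i \<otimes> (j \<oplus> b) \<oplus> a \<otimes> j \<oplus> a \<otimes> b"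
      using m(1)[OF *(1)] m(2)[OF *(2)] m(1)[OF *(4)] m(3)[OF *(5)] unfolding *(3,6) by algebra
    moreover have "a \<otimes> b \<in> I" using * AB(2) by (auto intro: ideal_prod.prod)
    ultimately show "u \<otimes> v \<in> I" using idealD(3-5)[OF I] m * by simp
  qed
  show "I \<subseteq> (I <+>\<^bsub>R\<^esub> A) \<cdot> (I <+>\<^bsub>R\<^esub> B)"
  proof
    fix x assume x: "x \<in> I"
    obtain a b where ab: "a \<in> A" "b \<in> B" "a \<oplus> b = \<one>" using AB unfolding comaximal_def by blast
    have c: "x \<in> carrier R" "a \<in> carrier R" "b \<in> carrier R" using x ab m by auto
    have mem: "x \<in> I <+>\<^bsub>R\<^esub> A" "x \<in> I <+>\<^bsub>R\<^esub> B" "a \<in> I <+>\<^bsub>R\<^esub> A" "b \<in> I <+>\<^bsub>R\<^esub> B"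
      using x ab c idealD(2)[OF I] idealD(2)[OF A] idealD(2)[OF B] r_zero[of x] l_zero[of a] l_zero[of b]
      unfolding set_add_def' by (simp, metis)+
    have "x = x \<otimes> (a \<oplus> b)" using ab c by simp
    also have "\<dots> = a \<otimes> x \<oplus> x \<otimes> b" using c by algebra
    finally show "x \<in> (I <+>\<^bsub>R\<^esub> A) \<cdot> (I <+>\<^bsub>R\<^esub> B)"
      using mem by (metis ideal_prod.intros)
  qed
qed

lemma (in cring) ideal_prod_list_filter:
  assumes "\<And>I. I \<in> set Is \<Longrightarrow> ideal I R"
  shows "ideal_prod_list R Is =
    ideal_prod_list R (filter P Is) \<cdot> ideal_prod_list R (filter (\<lambda>I. \<not> P I) Is)"
  using assms
proof (induct Is)
  case Nil
  then show ?case using ideal_prod_one[OF oneideal] by simp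
next
  case (Cons I Is)
  have i: "ideal (ideal_prod_list R (filter Q Is)) R" for Q
    using Cons(2) by (intro ideal_ideal_prod_list) auto
  have I: "ideal I R" using Cons by auto
  show ?case
  proof (cases "P I")
    case True
    then show ?thesis using Cons ideal_prod_assoc[OF I i i] by simp
  next
    case False
    then show ?thesis
      using Cons ideal_prod_assoc[OF I i i] ideal_prod_assoc[OF i I i] ideal_prod_commute[OF I i] by simp
  qed
qed

text \<open>Induction on the number of factors. All copies of one N are split off together as a
  power A, since N is not comaximal to itself; A is comaximal to the product B of the rest, and I =
  (I + A)(I + B).\<close>

lemma (in cring) TA_factorable_if_prod_list_subset:
  assumes "\<And>N. N \<in> set Ns \<Longrightarrow> maximalideal N R \<and> residually_principal R N"
    and "ideal I R" "ideal_prod_list R Ns \<subseteq> I"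
  shows "TA_factorable R I"
  using assms
proof (induct "length Ns" arbitrary: Ns I rule: less_induct)
  case less
  show ?case
  proof (cases Ns)
    case Nil
    then have "I = carrier R" using less(4) idealD(1)[OF less(3)] by auto
    then show ?thesis by (simp add: TA_factorable_def)
  next
    case (Cons N Ms)
    have ids: "ideal M R" if "M \<in> set Ns" for M using less(2) that maximalideal_iff by blast
    have N: "maximalideal N R" "ideal N R" "residually_principal R N" using less(2) Cons ids by auto
    define n where "n = length (filter (\<lambda>M. M = N) Ns)"
    have rep: "filter (\<lambda>M. M = N) Ns = replicate n N"
      unfolding n_def by (induct Ns) auto
    define A where "A = ideal_pow R N n"
    define B where "B = ideal_prod_list R (filter (\<lambda>M. M \<noteq> N) Ns)"
    have i: "ideal A R" "ideal B R"
      unfolding A_def B_def using ideal_ideal_pow[OF N(2)]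
      by (blast, intro ideal_ideal_prod_list) (use ids in auto)
    have AB: "A \<cdot> B \<subseteq> I"
      using less(4) ideal_prod_list_filter[of Ns "\<lambda>M. M = N"] ids unfolding A_def B_def rep by auto
    have "comaximal R N B"
      unfolding B_def using less(2) ids comaximal_maximalideals[OF N(1)]
      by (intro comaximal_prod_list[OF N(2)]) auto
    then have "comaximal R B A"
      unfolding A_def using comaximal_sym[OF N(2) i(2)] N(2)
      by (intro comaximal_prod_list[OF i(2)]) auto
    then have comax: "comaximal R A B" using comaximal_sym i by blast
    have sub: "L \<subseteq> I <+>\<^bsub>R\<^esub> L" if "ideal L R" for L
    proof
      fix l assume "l \<in> L"
      then show "l \<in> I <+>\<^bsub>R\<^esub> L"
        using idealD(2)[OF less(3)] idealD(1)[OF that] l_zero[of l] unfolding set_add_def' by force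
    qed
    have ids': "ideal (I <+>\<^bsub>R\<^esub> A) R" "ideal (I <+>\<^bsub>R\<^esub> B) R" using add_ideals less(3) i by auto
    have "TA_factorable R (I <+>\<^bsub>R\<^esub> A)"
      using TA_factorable_if_pow_subset[OF N(1,3) ids'(1)] sub[OF i(1)] unfolding A_def .
    moreover have "TA_factorable R (I <+>\<^bsub>R\<^esub> B)"
    proof (rule less(1)[OF _ _ ids'(2)])
      show "length (filter (\<lambda>M. M \<noteq> N) Ns) < length Ns"
        using Cons by (simp add: le_imp_less_Suc)
    qed (use less(2) sub[OF i(2)] B_def in auto)
    ultimately show ?thesis
      using TA_factorable_prod[OF _ _ ids'] ideal_eq_prod_if_comaximal[OF less(3) i comax AB] by simp
  qed
qed

text \<open>A maximal counterexample J is not prime, so ab is in J with a and b outside. The larger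
  ideals J + aR and J + bR contain products of primes, and their product lies in J. The empty list
  covers the unit ideal.\<close>

lemma (in noetherian_domain) ideal_supset_prod_primes:
  assumes "ideal I R" "I \<noteq> {\<zero>}"
  shows "\<exists>Ps. (\<forall>P\<in>set Ps. primeideal P R \<and> P \<noteq> {\<zero>}) \<and> ideal_prod_list R Ps \<subseteq> I"
proof (rule ccontr)
  let ?ok = "\<lambda>I. \<exists>Ps. (\<forall>P\<in>set Ps. primeideal P R \<and> P \<noteq> {\<zero>}) \<and> ideal_prod_list R Ps \<subseteq> I"
  let ?S = "{I. ideal I R \<and> I \<noteq> {\<zero>} \<and> \<not> ?ok I}"
  assume "\<not> ?ok I"
  then have "?S \<noteq> {}" using assms by blast
  then obtain J where J: "J \<in> ?S" "\<forall>I\<in>?S. J \<subseteq> I \<longrightarrow> I = J"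
    using ideal_maximal_element[of ?S] by blast
  have Ji: "ideal J R" "J \<noteq> {\<zero>}" and nok: "\<not> ?ok J" using J(1) by auto
  have np: "\<not> primeideal J R"
  proof
    assume "primeideal J R"
    then have "(\<forall>P\<in>set [J]. primeideal P R \<and> P \<noteq> {\<zero>}) \<and> ideal_prod_list R [J] \<subseteq> J"
      using Ji ideal_prod_one by simp
    then show False using nok by blast
  qed
  have "\<one> \<notin> J"
  proof
    assume "\<one> \<in> J"
    then have "(\<forall>P\<in>set []. primeideal P R \<and> P \<noteq> {\<zero>}) \<and> ideal_prod_list R [] \<subseteq> J"
      using ideal.one_imp_carrier[OF Ji(1)] by simp
    then show False using nok by blast
  qed
  then obtain a b where ab: "a \<in> carrier R" "b \<in> carrier R" "a \<otimes> b \<in> J" "a \<notin> J" "b \<notin> J"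
    using np Ji unfolding primeideal_iff by blast
  have bigger: "?ok (J <+>\<^bsub>R\<^esub> PIdl c)" if c: "c \<in> carrier R" "c \<notin> J" for c
  proof -
    note s = ideal_add_PIdl[OF Ji(1) c(1)]
    have "J <+>\<^bsub>R\<^esub> PIdl c \<noteq> {\<zero>}" using s(2) Ji idealD(2)[OF Ji(1)] by blast
    moreover have "J <+>\<^bsub>R\<^esub> PIdl c \<noteq> J" using s(3) c(2) by blast
    ultimately show ?thesis using J(2) s(1,2) by blast
  qed
  obtain Ps where Ps: "\<forall>P\<in>set Ps. primeideal P R \<and> P \<noteq> {\<zero>}" "ideal_prod_list R Ps \<subseteq> J <+>\<^bsub>R\<^esub> PIdl a"
    using bigger[OF ab(1,4)] by blast
  obtain Qs where Qs: "\<forall>P\<in>set Qs. primeideal P R \<and> P \<noteq> {\<zero>}" "ideal_prod_list R Qs \<subseteq> J <+>\<^bsub>R\<^esub> PIdl b"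
    using bigger[OF ab(2,5)] by blast
  have "ideal_prod_list R (Ps @ Qs) = ideal_prod_list R Ps \<cdot> ideal_prod_list R Qs"
    by (rule ideal_prod_list_append) (use Ps(1) Qs(1) primeideal.axioms(1) in blast)
  also have "\<dots> \<subseteq> J"
  proof (rule ideal_prod_subsetI[OF Ji(1)])
    fix u v assume "u \<in> ideal_prod_list R Ps" "v \<in> ideal_prod_list R Qs"
    then obtain i r j s where *: "i \<in> J" "r \<in> carrier R" "u = i \<oplus> a \<otimes> r"
      "j \<in> J" "s \<in> carrier R" "v = j \<oplus> b \<otimes> s"
      using Ps(2) Qs(2) add_PIdl_iff[OF Ji(1) ab(1)] add_PIdl_iff[OF Ji(1) ab(2)] by (meson subsetD)
    note c = idealD(1)[OF Ji(1) *(1)] idealD(1)[OF Ji(1) *(4)]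
    have "u \<otimes> v = i \<otimes> (j \<oplus> b \<otimes> s) \<oplus> a \<otimes> r \<otimes> j \<oplus> r \<otimes> s \<otimes> (a \<otimes> b)"
      using c ab(1,2) *(2,5) unfolding *(3,6) by algebra
    also have "\<dots> \<in> J" using idealD(3-5)[OF Ji(1)] * ab c by simp
    finally show "u \<otimes> v \<in> J" .
  qed
  finally show False using nok Ps Qs by (metis Un_iff set_append)
qed

theorem (in noetherian_domain) TAF_domain_if_residually_principal:
  assumes dim: "\<And>P. primeideal P R \<Longrightarrow> P \<noteq> {\<zero>} \<Longrightarrow> maximalideal P R"
    and rp: "\<And>N. maximalideal N R \<Longrightarrow> N \<noteq> {\<zero>} \<Longrightarrow> residually_principal R N"
  shows "TAF_domain R"
proof -
  have "\<exists>Js. TA_factorization R I Js" if I: "ideal I R" "I \<noteq> carrier R" for I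
  proof -
    have "TA_factorable R I"
    proof (cases "I = {\<zero>}")
      case True
      \<comment> \<open>The zero ideal of a domain is prime, and prime ideals are TA-ideals.\<close>
      have "TA_ideal I R"
        unfolding TA_ideal_def using I(1) True by (auto simp: integral_iff)
      then show ?thesis by (rule TA_ideal_factorable)
    next
      case False
      then obtain Ps where "\<forall>P\<in>set Ps. primeideal P R \<and> P \<noteq> {\<zero>}" "ideal_prod_list R Ps \<subseteq> I"
        using ideal_supset_prod_primes[OF I(1)] by blast
      then show ?thesis using TA_factorable_if_prod_list_subset[of Ps I] I(1) dim rp by blast
    qed
    then show ?thesis using I(2) unfolding TA_factorable_def by blast
  qed
  then show ?thesis unfolding TAF_domain_def using domain_axioms by blast
qed

section \<open>Noetherian domains with residually principal maximal ideals\<close>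

lemma (in cring) add_PIdlE:
  assumes "ideal I R" "x \<in> carrier R" "z \<in> I <+>\<^bsub>R\<^esub> PIdl x"
  obtains i r where "i \<in> I" "r \<in> carrier R" "z = i \<oplus> x \<otimes> r"
  using add_PIdl_iff[OF assms(1,2)] assms(3) by blast

lemma (in noetherian_domain) exists_maximalideal:
  assumes "ideal I R" "I \<noteq> carrier R"
  shows "\<exists>N. maximalideal N R \<and> I \<subseteq> N"
proof -
  let ?S = "{J. ideal J R \<and> J \<noteq> carrier R \<and> I \<subseteq> J}"
  have "?S \<noteq> {}" using assms by blast
  then obtain N where N: "N \<in> ?S" "\<forall>J\<in>?S. N \<subseteq> J \<longrightarrow> J = N"
    using ideal_maximal_element[of ?S] by (metis (no_types, lifting) mem_Collect_eq)
  have "maximalideal N R"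
  proof (rule maximalidealI)
    show "J = N \<or> J = carrier R" if "ideal J R" "N \<subseteq> J" "J \<subseteq> carrier R" for J
      using N that by blast
  qed (use N in auto)
  then show ?thesis using N by blast
qed

text \<open>A form of Nakayama's lemma that speaks about the localization at \<open>N\<close> without forming it.\<close>

lemma (in noetherian_domain) local_nakayama:
  assumes N: "primeideal N R" and Z: "ideal Z R" and Y: "ideal Y R"
    and step: "\<And>z. z \<in> Z \<Longrightarrow> \<exists>t\<in>carrier R - N. \<exists>y\<in>Y. \<exists>w\<in>N \<cdot> Z. t \<otimes> z = y \<oplus> w"
  shows "\<exists>s\<in>carrier R - N. \<forall>z\<in>Z. s \<otimes> z \<in> Y"
proof (rule ccontr)
  let ?ok = "\<lambda>Y. \<exists>s\<in>carrier R - N. \<forall>z\<in>Z. s \<otimes> z \<in> Y"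
  let ?S = "{J. ideal J R \<and> Y \<subseteq> J \<and> \<not> ?ok J}"
  have Ni: "ideal N R" "\<one> \<notin> N" using N primeideal_iff by auto
  assume "\<not> ?ok Y"
  then have "?S \<noteq> {}" using Y by blast
  then obtain J where J: "J \<in> ?S" "\<forall>I\<in>?S. J \<subseteq> I \<longrightarrow> I = J"
    using ideal_maximal_element[of ?S] by blast
  then have Ji: "ideal J R" "Y \<subseteq> J" and nok: "\<not> ?ok J" by auto
  have "\<exists>u\<in>Z. u \<notin> J"
  proof (rule ccontr)
    assume "\<not> (\<exists>u\<in>Z. u \<notin> J)"
    then have "\<forall>z\<in>Z. \<one> \<otimes> z \<in> J" using idealD(1)[OF Z] by simp
    then show False using nok Ni by blast
  qed
  then obtain u where u: "u \<in> Z" "u \<notin> J" by blast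
  have uc: "u \<in> carrier R" using u idealD(1)[OF Z] by blast
  note Ju = ideal_add_PIdl[OF Ji(1) uc]
  \<comment> \<open>Maximality of \<open>J\<close> among the ideals over \<open>Y\<close> into which
    no element outside \<open>N\<close> multiplies \<open>Z\<close>.\<close>
  have "?ok (J <+>\<^bsub>R\<^esub> PIdl u)" using J(2) Ju u(2) Ji(2) by blast
  then obtain s where s: "s \<in> carrier R - N" "\<forall>z\<in>Z. s \<otimes> z \<in> J <+>\<^bsub>R\<^esub> PIdl u" by blast
  have sc: "s \<in> carrier R" using s by blast
  obtain t y w where t: "t \<in> carrier R - N" "y \<in> Y" "w \<in> N \<cdot> Z" "t \<otimes> u = y \<oplus> w"
    using step[OF u(1)] by blast
  \<comment> \<open>The elements that \<open>s\<close> carries into J + Nu. They form an ideal, and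
    it contains the products n z because sz is in J + uR.\<close>
  let ?W = "{w \<in> carrier R. \<exists>j\<in>J. \<exists>n\<in>N. s \<otimes> w = j \<oplus> n \<otimes> u}"
  have W: "ideal ?W R"
    unfolding ideal_iff
  proof (intro conjI ballI)
    have "s \<otimes> \<zero> = \<zero> \<oplus> \<zero> \<otimes> u" using sc uc by simp
    then show "\<zero> \<in> ?W" using idealD(2)[OF Ji(1)] idealD(2)[OF Ni(1)] by blast
  next
    fix a b assume "a \<in> ?W" "b \<in> ?W"
    then obtain j n j' n' where *: "a \<in> carrier R" "b \<in> carrier R" "j \<in> J" "n \<in> N" "j' \<in> J" "n' \<in> N"
      "s \<otimes> a = j \<oplus> n \<otimes> u" "s \<otimes> b = j' \<oplus> n' \<otimes> u" by blast
    note c = idealD(1)[OF Ji(1) *(3)] idealD(1)[OF Ji(1) *(5)]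
      idealD(1)[OF Ni(1) *(4)] idealD(1)[OF Ni(1) *(6)]
    have "s \<otimes> (a \<oplus> b) = s \<otimes> a \<oplus> s \<otimes> b" using * sc by algebra
    also have "\<dots> = (j \<oplus> j') \<oplus> (n \<oplus> n') \<otimes> u" unfolding *(7,8) using c uc by algebra
    finally show "a \<oplus> b \<in> ?W" using * idealD(3)[OF Ji(1)] idealD(3)[OF Ni(1)] by blast
  next
    fix a b assume a: "a \<in> carrier R" and "b \<in> ?W"
    then obtain j n where *: "b \<in> carrier R" "j \<in> J" "n \<in> N" "s \<otimes> b = j \<oplus> n \<otimes> u" by blast
    note c = idealD(1)[OF Ji(1) *(2)] idealD(1)[OF Ni(1) *(3)]
    have "s \<otimes> (a \<otimes> b) = a \<otimes> (s \<otimes> b)" using a * sc by algebra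
    also have "\<dots> = a \<otimes> j \<oplus> (a \<otimes> n) \<otimes> u" unfolding *(4) using c uc a by algebra
    finally show "a \<otimes> b \<in> ?W"
      using * a idealD(4)[OF Ji(1) _ a] idealD(4)[OF Ni(1) _ a] by blast
  qed auto
  have "N \<cdot> Z \<subseteq> ?W"
  proof (rule ideal_prod_subsetI[OF W])
    fix n z assume n: "n \<in> N" and z: "z \<in> Z"
    have c: "n \<in> carrier R" "z \<in> carrier R" using n z idealD(1)[OF Ni(1)] idealD(1)[OF Z] by auto
    obtain j r where *: "j \<in> J" "r \<in> carrier R" "s \<otimes> z = j \<oplus> u \<otimes> r"
      by (rule add_PIdlE[OF Ji(1) uc s(2)[rule_format, OF z]])
    have jc: "j \<in> carrier R" using * idealD(1)[OF Ji(1)] by blast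
    have "s \<otimes> (n \<otimes> z) = n \<otimes> (s \<otimes> z)" using c sc by algebra
    also have "\<dots> = n \<otimes> j \<oplus> (n \<otimes> r) \<otimes> u" unfolding *(3) using c *(2) jc uc by algebra
    finally show "n \<otimes> z \<in> ?W"
      using c * idealD(4)[OF Ji(1) *(1) c(1)] idealD(5)[OF Ni(1) n *(2)] by blast
  qed
  then obtain j n where jn: "j \<in> J" "n \<in> N" "s \<otimes> w = j \<oplus> n \<otimes> u" "w \<in> carrier R" using t(3) by blast
  have c: "y \<in> carrier R" "t \<in> carrier R" "j \<in> carrier R" "n \<in> carrier R"
    using t idealD(1)[OF Y] idealD(1)[OF Ji(1) jn(1)] idealD(1)[OF Ni(1) jn(2)] by auto
  \<comment> \<open>Since s(tu) = sy + sw and sw = j + nu, this v carries u into \<open>J\<close>;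
    it is st modulo \<open>N\<close> and therefore outside the prime \<open>N\<close>.\<close>
  define v where "v = s \<otimes> t \<oplus> \<ominus> n"
  have "v \<otimes> u = s \<otimes> (t \<otimes> u) \<oplus> \<ominus> (n \<otimes> u)" unfolding v_def using c sc uc by algebra
  also have "\<dots> = s \<otimes> y \<oplus> s \<otimes> w \<oplus> \<ominus> (n \<otimes> u)" unfolding t(4) using c sc uc jn(4) by algebra
  also have "\<dots> = s \<otimes> y \<oplus> j" unfolding jn(3) using c sc uc by algebra
  finally have vu: "v \<otimes> u \<in> J" using Ji t(2) jn(1) sc idealD(3,4)[OF Ji(1)] by auto
  have vc: "v \<in> carrier R" using c sc by (simp add: v_def)
  have "v \<notin> N"
  proof
    assume "v \<in> N"
    then have "v \<oplus> n \<in> N" using jn idealD(3)[OF Ni(1)] by blast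
    moreover have "v \<oplus> n = s \<otimes> t" unfolding v_def using c sc by algebra
    ultimately have "s \<otimes> t \<in> N" by simp
    then show False using primeideal.I_prime[OF N, of s t] s(1) t(1) by blast
  qed
  then have "v \<otimes> s \<in> carrier R - N" using primeideal.I_prime[OF N, of v s] s(1) vc by auto
  \<comment> \<open>First \<open>s\<close> brings Z into J + uR, then \<open>v\<close> disposes of
    u, contrary to the choice of \<open>J\<close>.\<close>
  moreover have "v \<otimes> s \<otimes> z \<in> J" if "z \<in> Z" for z
  proof -
    obtain j r where *: "j \<in> J" "r \<in> carrier R" "s \<otimes> z = j \<oplus> u \<otimes> r"
      by (rule add_PIdlE[OF Ji(1) uc s(2)[rule_format, OF \<open>z \<in> Z\<close>]])
    have cc: "j \<in> carrier R" "z \<in> carrier R" using * idealD(1)[OF Ji(1)] that idealD(1)[OF Z] by auto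
    have "v \<otimes> s \<otimes> z = v \<otimes> (s \<otimes> z)" using vc sc cc by algebra
    also have "\<dots> = v \<otimes> j \<oplus> r \<otimes> (v \<otimes> u)" unfolding *(3) using vc *(2) cc uc by algebra
    also have "\<dots> \<in> J" using * vu vc idealD(3,4)[OF Ji(1)] by auto
    finally show ?thesis .
  qed
  ultimately show False using nok by blast
qed

text \<open>Nakayama with N^2 as the module and xR as the submodule: one denominator
  \<open>s\<close> serves for all of N^2.\<close>

lemma (in noetherian_domain) square_locally_principal:
  assumes N: "maximalideal N R" and rp: "residually_principal R N" and x: "x \<in> N - N \<cdot> N"
  shows "\<exists>s\<in>carrier R - N. \<forall>z\<in>N \<cdot> N. \<exists>r\<in>carrier R. s \<otimes> z = x \<otimes> r"
proof -
  have Ni: "ideal N R" using N maximalideal_iff by auto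
  have xc: "x \<in> carrier R" using x idealD(1)[OF Ni] by blast
  have N2: "ideal (N \<cdot> N) R" using Ni ideal_prod_is_ideal by blast
  have N3: "ideal (N \<cdot> (N \<cdot> N)) R" using Ni N2 ideal_prod_is_ideal by blast
  have "\<exists>s\<in>carrier R - N. \<forall>z\<in>N \<cdot> N. s \<otimes> z \<in> PIdl x"
  proof (rule local_nakayama[OF maximalideal_prime[OF N] N2 cgenideal_ideal[OF xc]])
    fix z assume z: "z \<in> N \<cdot> N"
    then obtain i r where i: "i \<in> N \<cdot> (N \<cdot> N)" "r \<in> carrier R" "z = i \<oplus> x \<otimes> r"
      using residually_principal_subset[OF Ni rp x] add_PIdl_iff[OF N3 xc] by blast
    have ic: "i \<in> carrier R" using i(1) idealD(1)[OF N3] by blast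
    have "\<one> \<otimes> z = r \<otimes> x \<oplus> i" using ic i(2) xc unfolding i(3) by algebra
    moreover have "\<one> \<in> carrier R - N" using N maximalideal_iff by blast
    moreover have "r \<otimes> x \<in> PIdl x" using i(2) unfolding cgenideal_def by blast
    ultimately show "\<exists>t\<in>carrier R - N. \<exists>y\<in>PIdl x. \<exists>w\<in>N \<cdot> (N \<cdot> N). t \<otimes> z = y \<oplus> w"
      using i(1) by blast
  qed
  then show ?thesis using m_comm[OF xc] unfolding cgenideal_def by fastforce
qed

text \<open>With zero submodule, Nakayama yields an s outside \<open>N\<close>, hence nonzero, that
  annihilates \<open>Z\<close>; a domain has no torsion.\<close>

lemma (in noetherian_domain) eq_zero_if_local_nakayama:
  assumes N: "primeideal N R" and Z: "ideal Z R"
    and step: "\<And>z. z \<in> Z \<Longrightarrow> \<exists>t\<in>carrier R - N. t \<otimes> z \<in> N \<cdot> Z"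
  shows "Z = {\<zero>}"
proof -
  have Ni: "ideal N R" using N primeideal_iff by auto
  have NZ: "ideal (N \<cdot> Z) R" using ideal_prod_is_ideal[OF Ni Z] .
  have "\<exists>s\<in>carrier R - N. \<forall>z\<in>Z. s \<otimes> z \<in> {\<zero>}"
  proof (rule local_nakayama[OF N Z zeroideal])
    fix z assume "z \<in> Z"
    then obtain t where t: "t \<in> carrier R - N" "t \<otimes> z \<in> N \<cdot> Z" using step by blast
    then have "t \<otimes> z = \<zero> \<oplus> t \<otimes> z" using idealD(1)[OF NZ] by simp
    then show "\<exists>t\<in>carrier R - N. \<exists>y\<in>{\<zero>}. \<exists>w\<in>N \<cdot> Z. t \<otimes> z = y \<oplus> w" using t by blast
  qed
  then obtain s where s: "s \<in> carrier R" "s \<notin> N" "\<forall>z\<in>Z. s \<otimes> z = \<zero>" by blast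
  have "s \<noteq> \<zero>" using s(2) idealD(2)[OF Ni] by blast
  then have "z = \<zero>" if "z \<in> Z" for z using s that idealD(1)[OF Z] integral by blast
  then show ?thesis using idealD(2)[OF Z] by blast
qed

lemma (in noetherian_domain) maximalideal_not_idempotent:
  assumes N: "maximalideal N R" "N \<noteq> {\<zero>}"
  shows "\<exists>x. x \<in> N - N \<cdot> N"
proof (rule ccontr)
  assume "\<nexists>x. x \<in> N - N \<cdot> N"
  then have sub: "N \<subseteq> N \<cdot> N" by blast
  have Ni: "ideal N R" "\<one> \<notin> N" using N maximalideal_iff by auto
  have "N = {\<zero>}"
  proof (rule eq_zero_if_local_nakayama[OF maximalideal_prime[OF N(1)] Ni(1)])
    fix z assume "z \<in> N"
    then have "\<one> \<otimes> z \<in> N \<cdot> N" using sub idealD(1)[OF Ni(1)] by auto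
    then show "\<exists>t\<in>carrier R - N. t \<otimes> z \<in> N \<cdot> N" using Ni(2) by blast
  qed
  then show False using N(2) by simp
qed

text \<open>Let P <= N. If P has an element x outside N^2, then s a^2 lies in xR <= P for every a in
  N, so N <= P. If P <= N^2, take x in N - N^2, so x is not in P; writing sz = xr for z in P forces
  r in P, so locally P = NP and P = 0.\<close>

theorem (in noetherian_domain) maximalideal_if_residually_principal:
  assumes rp: "\<And>N. maximalideal N R \<Longrightarrow> residually_principal R N"
    and P: "primeideal P R" "P \<noteq> {\<zero>}"
  shows "maximalideal P R"
proof -
  have Pi: "ideal P R" "P \<noteq> carrier R" using P(1) primeideal_iff by auto
  obtain N where N: "maximalideal N R" "P \<subseteq> N" using exists_maximalideal[OF Pi] by blast
  have Ni: "ideal N R" using N maximalideal_iff by auto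
  have prime: "x \<in> P \<or> y \<in> P" if "x \<in> carrier R" "y \<in> carrier R" "x \<otimes> y \<in> P" for x y
    using P(1) that unfolding primeideal_iff by blast
  have "N \<subseteq> P"
  proof (cases "P \<subseteq> N \<cdot> N")
    case False
    then obtain x where x: "x \<in> P" "x \<in> N - N \<cdot> N" using N by blast
    obtain s where s: "s \<in> carrier R - N" "\<forall>z\<in>N \<cdot> N. \<exists>r\<in>carrier R. s \<otimes> z = x \<otimes> r"
      using square_locally_principal[OF N(1) rp[OF N(1)] x(2)] by blast
    show ?thesis
    proof
      fix a assume a: "a \<in> N"
      have ac: "a \<in> carrier R" using a idealD(1)[OF Ni] by blast
      obtain r where "r \<in> carrier R" "s \<otimes> (a \<otimes> a) = x \<otimes> r"
        using s(2) a ideal_prod.prod[of a N a N R] by blast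
      then have "s \<otimes> (a \<otimes> a) \<in> P" using idealD(5)[OF Pi(1) x(1)] by simp
      then show "a \<in> P" using prime[of s "a \<otimes> a"] prime[of a a] s(1) N(2) ac by blast
    qed
  next
    case True
    have "N \<noteq> {\<zero>}" using N P(2) idealD(2)[OF Pi(1)] by blast
    then obtain x where x: "x \<in> N - N \<cdot> N" using maximalideal_not_idempotent[OF N(1)] by blast
    have xc: "x \<in> carrier R" using x idealD(1)[OF Ni] by blast
    obtain s where s: "s \<in> carrier R - N" "\<forall>z\<in>N \<cdot> N. \<exists>r\<in>carrier R. s \<otimes> z = x \<otimes> r"
      using square_locally_principal[OF N(1) rp[OF N(1)] x] by blast
    have "P = {\<zero>}"
    proof (rule eq_zero_if_local_nakayama[OF maximalideal_prime[OF N(1)] Pi(1)])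
      fix z assume z: "z \<in> P"
      then obtain r where r: "r \<in> carrier R" "s \<otimes> z = x \<otimes> r" using s(2) True by blast
      have "x \<otimes> r \<in> P" using idealD(4)[OF Pi(1) z, of s] s(1) unfolding r(2) by blast
      then have "r \<in> P" using prime[OF xc r(1)] x True by blast
      then have "s \<otimes> z \<in> N \<cdot> P" unfolding r(2) using x by (auto intro: ideal_prod.prod)
      then show "\<exists>t\<in>carrier R - N. t \<otimes> z \<in> N \<cdot> P" using s(1) by blast
    qed
    then show ?thesis using P(2) by simp
  qed
  then show ?thesis using N by simp
qed

section \<open>Subrings of a field and integral closure\<close>

lemma (in field) subring_cring: "subring A R \<Longrightarrow> cring (restrict_ring R A)"
  using subring_is_domain domain.axioms(1) by blast

lemma (in field) subringD:
  assumes "subring A R"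
  shows "a \<in> A \<Longrightarrow> a \<in> carrier R" "\<zero> \<in> A" "\<one> \<in> A"
    "a \<in> A \<Longrightarrow> b \<in> A \<Longrightarrow> a \<oplus> b \<in> A" "a \<in> A \<Longrightarrow> b \<in> A \<Longrightarrow> a \<otimes> b \<in> A" "a \<in> A \<Longrightarrow> \<ominus> a \<in> A"
  using subringE[OF assms] by auto

lemma (in field) subring_pow_closed: "subring A R \<Longrightarrow> a \<in> A \<Longrightarrow> a [^] (n::nat) \<in> A"
  by (induct n) (auto simp: subringD)

lemma (in field) subring_ideal_iff:
  assumes "subring A R"
  shows "ideal I (restrict_ring R A) \<longleftrightarrow> I \<subseteq> A \<and> \<zero> \<in> I \<and> (\<forall>a\<in>I. \<forall>b\<in>I. a \<oplus> b \<in> I) \<and>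
     (\<forall>a\<in>A. \<forall>b\<in>I. a \<otimes> b \<in> I)"
  using cring.ideal_iff[OF subring_cring[OF assms], of I] by simp

lemma (in field) subring_idealI:
  assumes "subring A R" "\<And>a. a \<in> I \<Longrightarrow> a \<in> A" "\<zero> \<in> I"
    "\<And>a b. a \<in> I \<Longrightarrow> b \<in> I \<Longrightarrow> a \<oplus> b \<in> I" "\<And>a b. a \<in> A \<Longrightarrow> b \<in> I \<Longrightarrow> a \<otimes> b \<in> I"
  shows "ideal I (restrict_ring R A)"
  unfolding subring_ideal_iff[OF assms(1)] using assms by blast

lemma (in field) subring_idealD:
  assumes "subring A R" "ideal I (restrict_ring R A)"
  shows "a \<in> I \<Longrightarrow> a \<in> A" "a \<in> I \<Longrightarrow> a \<in> carrier R" "\<zero> \<in> I" "a \<in> I \<Longrightarrow> b \<in> I \<Longrightarrow> a \<oplus> b \<in> I"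
    "a \<in> I \<Longrightarrow> b \<in> A \<Longrightarrow> b \<otimes> a \<in> I" "a \<in> I \<Longrightarrow> b \<in> A \<Longrightarrow> a \<otimes> b \<in> I" "a \<in> I \<Longrightarrow> \<ominus> a \<in> I"
proof -
  note * = assms(2)[unfolded subring_ideal_iff[OF assms(1)]]
  show 1: "a \<in> I \<Longrightarrow> a \<in> A" for a using * by blast
  show 2: "a \<in> I \<Longrightarrow> a \<in> carrier R" for a using 1 subringD[OF assms(1)] by blast
  show "\<zero> \<in> I" "a \<in> I \<Longrightarrow> b \<in> I \<Longrightarrow> a \<oplus> b \<in> I" using * by blast+
  show 3: "a \<in> I \<Longrightarrow> b \<in> A \<Longrightarrow> b \<otimes> a \<in> I" for a b using * by blast
  show "a \<in> I \<Longrightarrow> b \<in> A \<Longrightarrow> a \<otimes> b \<in> I"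
    using 3 m_comm[of a b] 2 subringD(1)[OF assms(1)] by auto
  show "\<ominus> a \<in> I" if "a \<in> I"
  proof -
    have "\<ominus> \<one> \<in> A" using subringD[OF assms(1)] by blast
    then have "(\<ominus> \<one>) \<otimes> a \<in> I" using 3 that by blast
    moreover have "(\<ominus> \<one>) \<otimes> a = \<ominus> a" using 2[OF that] by algebra
    ultimately show ?thesis by simp
  qed
qed

lemma (in field) subring_maximalideal_iff:
  assumes "subring A R"
  shows "maximalideal N (restrict_ring R A) \<longleftrightarrow> ideal N (restrict_ring R A) \<and> \<one> \<notin> N \<and>
     (\<forall>x\<in>A - N. \<exists>y\<in>A. \<exists>n\<in>N. n \<oplus> x \<otimes> y = \<one>)"
  using cring.maximalideal_iff[OF subring_cring[OF assms], of N] by simp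

lemma (in field) subring_primeideal_iff:
  assumes "subring A R"
  shows "primeideal N (restrict_ring R A) \<longleftrightarrow> ideal N (restrict_ring R A) \<and> \<one> \<notin> N \<and>
     (\<forall>x\<in>A. \<forall>y\<in>A. x \<otimes> y \<in> N \<longrightarrow> x \<in> N \<or> y \<in> N)"
  using cring.primeideal_iff[OF subring_cring[OF assms], of N] by simp

lemma (in field) subring_primeidealD:
  assumes "subring A R" "primeideal N (restrict_ring R A)"
  shows "ideal N (restrict_ring R A)" "\<one> \<notin> N"
    "x \<in> A \<Longrightarrow> y \<in> A \<Longrightarrow> x \<otimes> y \<in> N \<Longrightarrow> x \<in> N \<or> y \<in> N"
  using assms(2) unfolding subring_primeideal_iff[OF assms(1)] by blast+

lemma (in field) subring_maximalideal_prime: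
  assumes "subring A R" "maximalideal N (restrict_ring R A)"
  shows "primeideal N (restrict_ring R A)"
  using cring.maximalideal_prime[OF subring_cring[OF assms(1)] assms(2)] .

lemma (in field) inv_nonzero:
  assumes "x \<in> carrier R" "x \<noteq> \<zero>"
  shows "inv x \<in> carrier R" "inv x \<noteq> \<zero>" "x \<otimes> inv x = \<one>" "inv x \<otimes> x = \<one>"
proof -
  have "x \<in> Units R" using assms field_Units by simp
  then show *: "inv x \<in> carrier R" "x \<otimes> inv x = \<one>" "inv x \<otimes> x = \<one>" by auto
  show "inv x \<noteq> \<zero>" using * assms(1) by auto
qed

text \<open>Fractions are replaced by denominators that clear them, so that memberships are checked
  by ring identities without \<open>inv\<close>.\<close>

lemma (in field) quotient_field_of_iff:
  "quotient_field_of R A \<longleftrightarrow>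
     subring A R \<and> (\<forall>x\<in>carrier R. \<exists>b\<in>A. b \<noteq> \<zero> \<and> b \<otimes> x \<in> A)"
proof -
  have "(\<exists>a\<in>A. \<exists>b\<in>A. b \<noteq> \<zero> \<and> x = a \<otimes> inv b) \<longleftrightarrow> (\<exists>b\<in>A. b \<noteq> \<zero> \<and> b \<otimes> x \<in> A)"
    if A: "subring A R" and x: "x \<in> carrier R" for x
  proof
    assume "\<exists>a\<in>A. \<exists>b\<in>A. b \<noteq> \<zero> \<and> x = a \<otimes> inv b"
    then obtain a b where *: "a \<in> A" "b \<in> A" "b \<noteq> \<zero>" "x = a \<otimes> inv b" by blast
    have c: "a \<in> carrier R" "b \<in> carrier R" using * subringD[OF A] by auto
    have "b \<otimes> x = a \<otimes> (b \<otimes> inv b)" unfolding *(4) using c inv_nonzero(1)[OF c(2) *(3)] by algebra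
    then show "\<exists>b\<in>A. b \<noteq> \<zero> \<and> b \<otimes> x \<in> A" using * c inv_nonzero[OF c(2) *(3)] by auto
  next
    assume "\<exists>b\<in>A. b \<noteq> \<zero> \<and> b \<otimes> x \<in> A"
    then obtain b where *: "b \<in> A" "b \<noteq> \<zero>" "b \<otimes> x \<in> A" by blast
    have c: "b \<in> carrier R" using * subringD[OF A] by auto
    have "(b \<otimes> x) \<otimes> inv b = x \<otimes> (b \<otimes> inv b)" using c x inv_nonzero(1)[OF c *(2)] by algebra
    then show "\<exists>a\<in>A. \<exists>b\<in>A. b \<noteq> \<zero> \<and> x = a \<otimes> inv b" using * c x inv_nonzero[OF c *(2)] by force
  qed
  then show ?thesis unfolding quotient_field_of_def using field_axioms by blast
qed

lemma (in field) quotient_field_of_mono: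
  assumes "quotient_field_of R A" "subring B R" "A \<subseteq> B"
  shows "quotient_field_of R B"
  using assms unfolding quotient_field_of_iff by blast

text \<open>Having zero in \<open>P\<close> keeps the denominators nonzero, where \<open>inv\<close>
  is a true inverse.\<close>

lemma (in field) localization_iff:
  assumes A: "subring A R" and P: "\<zero> \<in> P"
  shows "x \<in> localization R A P \<longleftrightarrow> x \<in> carrier R \<and> (\<exists>s\<in>A - P. s \<otimes> x \<in> A)"
proof
  assume "x \<in> localization R A P"
  then obtain a s where *: "a \<in> A" "s \<in> A - P" "x = a \<otimes> inv s" unfolding localization_def by blast
  have s: "s \<noteq> \<zero>" "s \<in> carrier R" "a \<in> carrier R" using * P subringD[OF A] by auto
  have "s \<otimes> x = a \<otimes> (s \<otimes> inv s)" unfolding *(3) using s inv_nonzero(1)[OF s(2,1)] by algebra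
  also have "\<dots> = a" using s inv_nonzero[OF s(2,1)] by simp
  finally have "s \<otimes> x \<in> A" using *(1) by simp
  moreover have "x \<in> carrier R" unfolding *(3) using s inv_nonzero[OF s(2,1)] by simp
  ultimately show "x \<in> carrier R \<and> (\<exists>s\<in>A - P. s \<otimes> x \<in> A)" using *(2) by blast
next
  assume r: "x \<in> carrier R \<and> (\<exists>s\<in>A - P. s \<otimes> x \<in> A)"
  then obtain s where *: "s \<in> A - P" "s \<otimes> x \<in> A" by blast
  have s: "s \<noteq> \<zero>" "s \<in> carrier R" using * P subringD[OF A] by auto
  have "(s \<otimes> x) \<otimes> inv s = x \<otimes> (s \<otimes> inv s)" using s r inv_nonzero(1)[OF s(2,1)] by algebra
  then have "x = (s \<otimes> x) \<otimes> inv s" using s r inv_nonzero[OF s(2,1)] by simp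
  then show "x \<in> localization R A P" unfolding localization_def using * by blast
qed

section \<open>Integral and almost integral elements\<close>

lemma (in field) nat_pow_nonzero: "x \<in> carrier R \<Longrightarrow> x \<noteq> \<zero> \<Longrightarrow> x [^] (n::nat) \<noteq> \<zero>"
  by (induct n) (auto simp: integral_iff)

lemma (in field) eval_Cons: "eval (a # q) x = a \<otimes> x [^] length q \<oplus> eval q x"
  by simp

text \<open>The monic polynomial is cut into its leading 1 and the list \<open>q\<close> of the
  other coefficients. Its degree is then \<open>length q\<close>, and inductions can run over an
  unconstrained list.\<close>

lemma (in field) integral_closureI:
  assumes A: "subring A R" and x: "x \<in> carrier R" and q: "set q \<subseteq> A"
    and eq: "x [^] length q \<oplus> eval q x = \<zero>"
  shows "x \<in> integral_closure R A"
proof -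
  have "polynomial\<^bsub>R\<^esub> A (\<one> # q)" using q subringD[OF A] unfolding polynomial_def by auto
  moreover have "eval (\<one> # q) x = \<zero>" using eq x by simp
  ultimately show ?thesis using x unfolding integral_closure_def by fastforce
qed

lemma (in field) integral_closureE:
  assumes A: "subring A R" and x: "x \<in> integral_closure R A"
  obtains q where "x \<in> carrier R" "set q \<subseteq> A" "x [^] length q \<oplus> eval q x = \<zero>"
proof -
  obtain p where p: "x \<in> carrier R" "p \<noteq> []" "polynomial\<^bsub>R\<^esub> A p" "lead_coeff p = \<one>" "eval p x = \<zero>"
    using x unfolding integral_closure_def by blast
  have c: "x [^] (n::nat) \<in> carrier R" for n using p(1) by simp
  obtain q where q: "p = \<one> # q" using p(2,4) by (cases p) auto
  have "set q \<subseteq> A" using p(3) unfolding q polynomial_def by auto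
  then show thesis using that[of q] p(1,5) c unfolding q by simp
qed

lemma (in field) subset_integral_closure:
  assumes A: "subring A R"
  shows "A \<subseteq> integral_closure R A"
proof
  fix x assume x: "x \<in> A"
  have xc: "x \<in> carrier R" using x subringD[OF A] by blast
  have "x [^] length [\<ominus> x] \<oplus> eval [\<ominus> x] x = \<zero>" using xc by (simp add: r_neg)
  then show "x \<in> integral_closure R A"
    using integral_closureI[OF A xc, of "[\<ominus> x]"] subringD(6)[OF A x] by simp
qed

text \<open>The complete integral closure: all powers of x share a denominator.\<close>

definition almost_integral :: "('a, 'm) ring_scheme \<Rightarrow> 'a set \<Rightarrow> 'a set" where
  "almost_integral R A = {x \<in> carrier R. \<exists>c\<in>A. c \<noteq> \<zero>\<^bsub>R\<^esub> \<and> (\<forall>n::nat. c \<otimes>\<^bsub>R\<^esub> x [^]\<^bsub>R\<^esub> n \<in> A)}"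

text \<open>The lower terms of an integral equation, multiplied by x^j, involve only
  \<open>length q\<close> consecutive powers of x, so a denominator for these clears their
  sum.\<close>

lemma (in field) eval_shift_closed:
  assumes A: "subring A R" and c: "c \<in> carrier R" and x: "x \<in> carrier R" and q: "set q \<subseteq> A"
    and pow: "\<And>i. i < length q \<Longrightarrow> c \<otimes> x [^] (i + j) \<in> A"
  shows "c \<otimes> (x [^] j \<otimes> eval q x) \<in> A"
  using q pow
proof (induct q)
  case Nil
  then show ?case using c x subringD[OF A] by simp
next
  case (Cons a q)
  have cl: "a \<in> carrier R" "eval q x \<in> carrier R" "set q \<subseteq> carrier R"
    using Cons(2) subringD[OF A] x by (auto intro!: eval_in_carrier)
  have xp: "x [^] n \<in> carrier R" for n :: nat using x by simp
  have "c \<otimes> (x [^] j \<otimes> eval (a # q) x) =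
      a \<otimes> (c \<otimes> (x [^] length q \<otimes> x [^] j)) \<oplus> c \<otimes> (x [^] j \<otimes> eval q x)"
    unfolding eval_Cons using cl c xp[of j] xp[of "length q"] by algebra
  also have "x [^] length q \<otimes> x [^] j = x [^] (length q + j)" using x by (simp add: nat_pow_mult)
  finally show ?case using Cons subringD[OF A] by auto
qed

text \<open>If b clears x and the equation has degree k, then b^k clears all x^n with n < k, and the
  equation reduces each higher power to the k powers before it.\<close>

lemma (in field) integral_closure_subset_almost_integral:
  assumes "quotient_field_of R A"
  shows "integral_closure R A \<subseteq> almost_integral R A"
proof
  have A: "subring A R" using assms quotient_field_of_iff by blast
  fix x assume "x \<in> integral_closure R A"
  then obtain q where q: "x \<in> carrier R" "set q \<subseteq> A" "x [^] length q \<oplus> eval q x = \<zero>"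
    by (rule integral_closureE[OF A])
  obtain b where b: "b \<in> A" "b \<noteq> \<zero>" "b \<otimes> x \<in> A"
    using assms q(1) unfolding quotient_field_of_iff by blast
  have bc: "b \<in> carrier R" using b subringD[OF A] by blast
  have ec: "eval q x \<in> carrier R" using q subringD[OF A] by (auto intro!: eval_in_carrier)
  define k where "k = length q"
  define c where "c = b [^] k"
  have c: "c \<in> A" "c \<noteq> \<zero>" "c \<in> carrier R"
    unfolding c_def using b bc subring_pow_closed[OF A] nat_pow_nonzero by auto
  have "c \<otimes> x [^] n \<in> A" for n :: nat
  proof (induct n rule: less_induct)
    case (less n)
    show ?case
    proof (cases "n < k")
      case True
      have "c = b [^] (k - n) \<otimes> b [^] n" unfolding c_def using True bc by (simp add: nat_pow_mult)
      then have "c \<otimes> x [^] n = b [^] (k - n) \<otimes> (b \<otimes> x) [^] n"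
        using bc q(1) by (simp add: nat_pow_distrib m_assoc)
      then show ?thesis using b subring_pow_closed[OF A] subringD[OF A] by simp
    next
      case False
      then have n: "n = n - k + k" by simp
      have "c \<otimes> (x [^] (n - k) \<otimes> eval q x) \<in> A"
        using less False by (intro eval_shift_closed[OF A c(3) q(1,2)]) (auto simp: k_def)
      moreover have "x [^] n = x [^] (n - k) \<otimes> x [^] k"
        using n q(1) nat_pow_mult[of x "n - k" k] by simp
      moreover have "x [^] k = \<ominus> eval q x"
        using q(1,3) ec unfolding k_def by (simp add: minus_equality[symmetric] a_comm add.inv_equality)
      ultimately show ?thesis
        using subringD(6)[OF A] c(3) ec q(1) by (auto simp: r_minus)
    qed
  qed
  then show "x \<in> almost_integral R A" unfolding almost_integral_def using q c by blast
qed

text \<open>The A-module generated by 1, x, ..., x^(n-1). The recursion follows coefficient lists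
  from the top coefficient down; leading zeros are allowed, so each element is the value of a list
  of length exactly n.\<close>

primrec (in ring) powers_span :: "'a set \<Rightarrow> 'a \<Rightarrow> nat \<Rightarrow> 'a set" where
  "powers_span A x 0 = {\<zero>}"
| "powers_span A x (Suc n) = {a \<otimes> x [^] n \<oplus> z | a z. a \<in> A \<and> z \<in> powers_span A x n}"

lemma (in field) powers_span_eval:
  assumes A: "subring A R" and z: "z \<in> powers_span A x n"
  shows "\<exists>q. set q \<subseteq> A \<and> length q = n \<and> z = eval q x"
  using z
proof (induct n arbitrary: z)
  case (Suc n)
  then obtain a y where *: "a \<in> A" "y \<in> powers_span A x n" "z = a \<otimes> x [^] n \<oplus> y" by auto
  then obtain q where "set q \<subseteq> A" "length q = n" "y = eval q x" using Suc(1) by blast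
  then show ?case using * by (intro exI[of _ "a # q"]) auto
qed auto

lemma (in field) powers_span_closed:
  assumes A: "subring A R" and x: "x \<in> carrier R"
  shows "z \<in> powers_span A x n \<Longrightarrow> z \<in> carrier R"
    "\<zero> \<in> powers_span A x n"
    "z \<in> powers_span A x n \<Longrightarrow> z' \<in> powers_span A x n \<Longrightarrow> z \<oplus> z' \<in> powers_span A x n"
    "a \<in> A \<Longrightarrow> z \<in> powers_span A x n \<Longrightarrow> a \<otimes> z \<in> powers_span A x n"
    "powers_span A x n \<subseteq> powers_span A x (Suc n)"
    "x [^] n \<in> powers_span A x (Suc n)"
proof -
  note S = subringD[OF A]
  have xp: "x [^] n \<in> carrier R" for n :: nat using x by simp
  show c: "z \<in> powers_span A x n \<Longrightarrow> z \<in> carrier R" for z n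
    by (induct n arbitrary: z) (use S xp in auto)
  show 0: "\<zero> \<in> powers_span A x n" for n
  proof (induct n)
    case (Suc n)
    have "\<zero> = \<zero> \<otimes> x [^] n \<oplus> \<zero>" using xp by simp
    then show ?case using S(2) Suc by auto
  qed simp
  show "z \<in> powers_span A x n \<Longrightarrow> z' \<in> powers_span A x n \<Longrightarrow> z \<oplus> z' \<in> powers_span A x n"
  proof (induct n arbitrary: z z')
    case (Suc n)
    obtain a y where 1: "a \<in> A" "y \<in> powers_span A x n" "z = a \<otimes> x [^] n \<oplus> y" using Suc by auto
    obtain b w where 2: "b \<in> A" "w \<in> powers_span A x n" "z' = b \<otimes> x [^] n \<oplus> w" using Suc by auto
    have "z \<oplus> z' = (a \<oplus> b) \<otimes> x [^] n \<oplus> (y \<oplus> w)"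
      unfolding 1(3) 2(3) using S(1)[OF 1(1)] S(1)[OF 2(1)] c[OF 1(2)] c[OF 2(2)] xp[of n] by algebra
    moreover have "a \<oplus> b \<in> A" "y \<oplus> w \<in> powers_span A x n" using 1 2 Suc(1) S by auto
    ultimately show ?case by auto
  qed auto
  show "a \<in> A \<Longrightarrow> z \<in> powers_span A x n \<Longrightarrow> a \<otimes> z \<in> powers_span A x n"
  proof (induct n arbitrary: z)
    case (Suc n)
    obtain b y where 1: "b \<in> A" "y \<in> powers_span A x n" "z = b \<otimes> x [^] n \<oplus> y" using Suc by auto
    have "a \<otimes> z = (a \<otimes> b) \<otimes> x [^] n \<oplus> a \<otimes> y"
      unfolding 1(3) using S(1)[OF 1(1)] S(1)[OF Suc(2)] c[OF 1(2)] xp[of n] by algebra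
    moreover have "a \<otimes> b \<in> A" "a \<otimes> y \<in> powers_span A x n" using 1 Suc S by auto
    ultimately show ?case by auto
  qed (use S in auto)
  show "powers_span A x n \<subseteq> powers_span A x (Suc n)"
  proof
    fix z assume z: "z \<in> powers_span A x n"
    have "z = \<zero> \<otimes> x [^] n \<oplus> z" using c[OF z] xp by simp
    then show "z \<in> powers_span A x (Suc n)" using S(2) z by auto
  qed
  have "x [^] n = \<one> \<otimes> x [^] n \<oplus> \<zero>" using xp by simp
  then show "x [^] n \<in> powers_span A x (Suc n)" using S(3) 0 by auto
qed

lemma (in field) noetherian_maximal_element:
  assumes "noetherian_domain (restrict_ring R A)" "S \<noteq> {}" "\<And>I. I \<in> S \<Longrightarrow> ideal I (restrict_ring R A)"
  shows "\<exists>J\<in>S. \<forall>I\<in>S. J \<subseteq> I \<longrightarrow> I = J"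
  using noetherian_ring.ideal_maximal_element[OF noetherian_domain.axioms(1)[OF assms(1)] assms(2,3)] .

text \<open>With c a common denominator, the sets c(A + Ax + ... + Ax^(n-1)) are ideals of A and
  increase with n. Once they are stationary, cx^n lies in the n-th one, and cancelling c leaves a
  monic equation of degree n.\<close>

lemma (in field) almost_integral_subset_integral_closure:
  assumes A: "subring A R" and noeth: "noetherian_domain (restrict_ring R A)"
  shows "almost_integral R A \<subseteq> integral_closure R A"
proof
  note S = subringD[OF A]
  fix x assume "x \<in> almost_integral R A"
  then obtain c where x: "x \<in> carrier R" and c: "c \<in> A" "c \<noteq> \<zero>" "\<And>n::nat. c \<otimes> x [^] n \<in> A"
    unfolding almost_integral_def by blast
  have cc: "c \<in> carrier R" using c S by blast
  note P = powers_span_closed[OF A x]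
  define J where "J n = {c \<otimes> z | z. z \<in> powers_span A x n}" for n
  have inA: "c \<otimes> z \<in> A" if "z \<in> powers_span A x n" for z n
    using that
  proof (induct n arbitrary: z)
    case (Suc n)
    then obtain a y where *: "a \<in> A" "y \<in> powers_span A x n" "z = a \<otimes> x [^] n \<oplus> y" by auto
    have xp: "x [^] n \<in> carrier R" using x by simp
    have "c \<otimes> z = a \<otimes> (c \<otimes> x [^] n) \<oplus> c \<otimes> y"
      unfolding *(3) using S(1)[OF *(1)] P(1)[OF *(2)] cc xp by algebra
    then show ?case using * Suc(1) c S by simp
  qed (use cc S in auto)
  have Jid: "ideal (J n) (restrict_ring R A)" for n
  proof (rule subring_idealI[OF A])
    show "\<zero> \<in> J n" unfolding J_def using P(2)[of n] cc by force
    show "a \<oplus> b \<in> J n" if "a \<in> J n" "b \<in> J n" for a b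
    proof -
      obtain y z where "y \<in> powers_span A x n" "z \<in> powers_span A x n" "a = c \<otimes> y" "b = c \<otimes> z"
        using \<open>a \<in> J n\<close> \<open>b \<in> J n\<close> unfolding J_def by blast
      moreover from this have "a \<oplus> b = c \<otimes> (y \<oplus> z)" using cc P(1) by (simp add: r_distr)
      ultimately show ?thesis unfolding J_def using P(3) by blast
    qed
    show "a \<otimes> b \<in> J n" if "a \<in> A" "b \<in> J n" for a b
    proof -
      obtain z where "z \<in> powers_span A x n" "b = c \<otimes> z"
        using \<open>b \<in> J n\<close> unfolding J_def by blast
      moreover from this have "a \<otimes> b = c \<otimes> (a \<otimes> z)" using cc P(1) S(1)[OF \<open>a \<in> A\<close>] by (simp add: m_lcomm)
      ultimately show ?thesis unfolding J_def using P(4) \<open>a \<in> A\<close> by blast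
    qed
  qed (use inA J_def in auto)
  have "\<exists>I\<in>range J. \<forall>L\<in>range J. I \<subseteq> L \<longrightarrow> L = I"
    by (rule noetherian_maximal_element[OF noeth]) (use Jid in auto)
  then obtain n where n: "\<forall>m. J n \<subseteq> J m \<longrightarrow> J m = J n" by auto
  have "J n \<subseteq> J (Suc n)" using subsetD[OF P(5)[of n]] unfolding J_def by fast
  then have "J (Suc n) = J n" using n by blast
  moreover have "c \<otimes> x [^] n \<in> J (Suc n)" unfolding J_def using P(6)[of n] by fast
  ultimately have "c \<otimes> x [^] n \<in> J n" by simp
  then obtain z where z: "z \<in> powers_span A x n" "c \<otimes> x [^] n = c \<otimes> z" unfolding J_def by blast
  have "x [^] n = z" using z(2) m_lcancel[OF c(2) cc] x P(1)[OF z(1)] by simp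
  have mz: "\<ominus> z = (\<ominus> \<one>) \<otimes> z" using P(1)[OF z(1)] by algebra
  have "\<ominus> z \<in> powers_span A x n" unfolding mz by (rule P(4)[OF S(6)[OF S(3)] z(1)])
  then obtain q where q: "set q \<subseteq> A" "length q = n" "\<ominus> z = eval q x"
    using powers_span_eval[OF A] by blast
  have "x [^] length q \<oplus> eval q x = \<zero>"
    unfolding q(2) q(3)[symmetric] \<open>x [^] n = z\<close> using P(1)[OF z(1)] by (simp add: r_neg)
  then show "x \<in> integral_closure R A" using integral_closureI[OF A x q(1)] by blast
qed

lemma (in field) almost_integral_subring:
  assumes A: "subring A R"
  shows "subring (almost_integral R A) R" "A \<subseteq> almost_integral R A"
proof -
  note S = subringD[OF A]
  show sub: "A \<subseteq> almost_integral R A"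
  proof
    fix x assume x: "x \<in> A"
    have "\<one> \<otimes> x [^] n \<in> A" for n :: nat using S(1) subring_pow_closed[OF A x] by simp
    then show "x \<in> almost_integral R A"
      unfolding almost_integral_def using S(1)[OF x] S(3) one_not_zero by blast
  qed
  \<comment> \<open>The product of denominators for the powers of x and of y clears all monomials,
    which serves sums and products alike.\<close>
  have two: "\<exists>c\<in>A. c \<noteq> \<zero> \<and> (\<forall>(i::nat) (j::nat). c \<otimes> (x [^] i \<otimes> y [^] j) \<in> A)"
    if xy: "x \<in> almost_integral R A" "y \<in> almost_integral R A" for x y
  proof -
    obtain c where c: "c \<in> A" "c \<noteq> \<zero>" "\<And>n::nat. c \<otimes> x [^] n \<in> A" "x \<in> carrier R"
      using xy(1) unfolding almost_integral_def by blast
    obtain d where d: "d \<in> A" "d \<noteq> \<zero>" "\<And>n::nat. d \<otimes> y [^] n \<in> A" "y \<in> carrier R"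
      using xy(2) unfolding almost_integral_def by blast
    have "(c \<otimes> d) \<otimes> (x [^] i \<otimes> y [^] j) \<in> A" for i j :: nat
    proof -
      have "(c \<otimes> d) \<otimes> (x [^] i \<otimes> y [^] j) = (c \<otimes> x [^] i) \<otimes> (d \<otimes> y [^] j)"
        using S(1)[OF c(1)] S(1)[OF d(1)] nat_pow_closed[OF c(4), of i] nat_pow_closed[OF d(4), of j]
        by algebra
      then show ?thesis using S(5)[OF c(3) d(3)] by simp
    qed
    moreover have "c \<otimes> d \<noteq> \<zero>" using c d S(1) integral by blast
    ultimately show ?thesis using S(5)[OF c(1) d(1)] by blast
  qed
  show "subring (almost_integral R A) R"
  proof (rule subringI)
    show "almost_integral R A \<subseteq> carrier R" unfolding almost_integral_def by blast
    show "\<one> \<in> almost_integral R A" using sub S(3) by blast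
    show mult: "x \<otimes> y \<in> almost_integral R A" if xy: "x \<in> almost_integral R A" "y \<in> almost_integral R A" for x y
    proof -
      obtain c where c: "c \<in> A" "c \<noteq> \<zero>" "\<And>(i::nat) (j::nat). c \<otimes> (x [^] i \<otimes> y [^] j) \<in> A"
        using two[OF xy] by blast
      have xyc: "x \<in> carrier R" "y \<in> carrier R" using xy unfolding almost_integral_def by auto
      have "c \<otimes> (x \<otimes> y) [^] n \<in> A" for n :: nat using c(3)[of n n] xyc by (simp add: nat_pow_distrib)
      then show ?thesis unfolding almost_integral_def using c(1,2) xyc by blast
    qed
    show "\<ominus> x \<in> almost_integral R A" if x: "x \<in> almost_integral R A" for x
    proof -
      have "\<ominus> \<one> \<in> almost_integral R A" using sub S(6)[OF S(3)] by blast
      then have "(\<ominus> \<one>) \<otimes> x \<in> almost_integral R A" using mult x by blast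
      moreover have "x \<in> carrier R" using x unfolding almost_integral_def by blast
      then have "(\<ominus> \<one>) \<otimes> x = \<ominus> x" by algebra
      ultimately show ?thesis by simp
    qed
    show "x \<oplus> y \<in> almost_integral R A" if xy: "x \<in> almost_integral R A" "y \<in> almost_integral R A" for x y
    proof -
      obtain c where c: "c \<in> A" "c \<noteq> \<zero>" "\<And>(i::nat) (j::nat). c \<otimes> (x [^] i \<otimes> y [^] j) \<in> A"
        using two[OF xy] by blast
      have xyc: "x \<in> carrier R" "y \<in> carrier R" using xy unfolding almost_integral_def by auto
      note cc = S(1)[OF c(1)]
      \<comment> \<open>The extra monomial makes the induction on n work in place of the binomial
        theorem; i = j = 0 is the case wanted.\<close>
      have "c \<otimes> ((x \<oplus> y) [^] n \<otimes> (x [^] i \<otimes> y [^] j)) \<in> A" for n i j :: nat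
      proof (induct n arbitrary: i j)
        case 0
        then show ?case using c(3) xyc by simp
      next
        case (Suc n)
        have p: "(x \<oplus> y) [^] n \<in> carrier R" "x [^] i \<in> carrier R" "y [^] j \<in> carrier R" using xyc by auto
        have "c \<otimes> ((x \<oplus> y) [^] Suc n \<otimes> (x [^] i \<otimes> y [^] j)) =
            c \<otimes> ((x \<oplus> y) [^] n \<otimes> (x [^] Suc i \<otimes> y [^] j)) \<oplus> c \<otimes> ((x \<oplus> y) [^] n \<otimes> (x [^] i \<otimes> y [^] Suc j))"
          unfolding nat_pow_Suc using p xyc cc by algebra
        then show ?case using S(4)[OF Suc[of "Suc i" j] Suc[of i "Suc j"]] by simp
      qed
      from this[of _ 0 0] have "c \<otimes> (x \<oplus> y) [^] n \<in> A" for n :: nat using xyc cc by simp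
      then show ?thesis unfolding almost_integral_def using c(1,2) xyc by blast
    qed
  qed
qed

text \<open>Horner's rule. The inductions on integral equations peel off constant terms, which stand
  at the end of the list.\<close>

lemma (in field) eval_snoc:
  assumes "set q \<subseteq> carrier R" "d \<in> carrier R" "x \<in> carrier R"
  shows "eval (q @ [d]) x = x \<otimes> eval q x \<oplus> d"
  using assms(1)
proof (induct q)
  case (Cons a q)
  have c: "a \<in> carrier R" "eval q x \<in> carrier R" "x [^] length q \<in> carrier R"
    using Cons(2) assms by (auto intro!: eval_in_carrier)
  have "eval ((a # q) @ [d]) x = a \<otimes> (x [^] length q \<otimes> x) \<oplus> eval (q @ [d]) x"
    by simp
  also have "\<dots> = a \<otimes> (x [^] length q \<otimes> x) \<oplus> (x \<otimes> eval q x \<oplus> d)" using Cons by simp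
  also have "\<dots> = x \<otimes> (a \<otimes> x [^] length q \<oplus> eval q x) \<oplus> d" using c assms by algebra
  finally show ?case by simp
qed (use assms in auto)

text \<open>For a relation \<open>y\<^sup>k + d\<^sub>1 y\<^sup>k\<^sup>-\<^sup>1 + \<dots> + d\<^sub>k \<in> Q\<close> of minimal degree, \<open>d\<^sub>k\<close> is not in \<open>Q\<close>, hence it is
  a unit modulo \<open>Q\<close>, and so is \<open>y\<close>.\<close>

lemma (in field) integral_unit_mod_prime:
  assumes E: "subring E R" and A: "subring A R" "A \<subseteq> E" and Q: "primeideal Q (restrict_ring R E)"
    and unit: "\<And>d. d \<in> A - Q \<Longrightarrow> \<exists>d'\<in>A. \<exists>n\<in>Q. n \<oplus> d \<otimes> d' = \<one>"
    and y: "y \<in> E - Q" and q: "set q \<subseteq> A" "y [^] length q \<oplus> eval q y \<in> Q"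
  shows "\<exists>w\<in>E. \<exists>n\<in>Q. n \<oplus> y \<otimes> w = \<one>"
  using q
proof (induct q rule: rev_induct)
  case Nil
  then show ?case using subring_primeidealD[OF E Q] by simp
next
  case (snoc d q)
  note Qd = subring_primeidealD[OF E Q]
  note Qi = subring_idealD[OF E Qd(1)]
  note SE = subringD[OF E]
  have yc: "y \<in> carrier R" "y \<in> E" using y SE(1) by auto
  have dE: "d \<in> E" "d \<in> A" "set q \<subseteq> A" using snoc A by auto
  have qc: "set q \<subseteq> carrier R" using dE(3) subringD(1)[OF A(1)] by blast
  have eE: "eval q y \<in> E"
    using dE(3) A(2) subring_pow_closed[OF E yc(2)] SE(2,4,5) by (induct q) auto
  define u where "u = y [^] length q \<oplus> eval q y"
  have uE: "u \<in> E" unfolding u_def using eE subring_pow_closed[OF E yc(2)] SE(4) by blast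
  note c = SE(1)[OF uE] SE(1)[OF dE(1)] SE(1)[OF eE] nat_pow_closed[OF yc(1), of "length q"]
  have "y [^] length (q @ [d]) \<oplus> eval (q @ [d]) y = y \<otimes> u \<oplus> d"
    unfolding u_def eval_snoc[OF qc c(2) yc(1)] length_append using c yc(1) by (simp, algebra)
  then have p: "y \<otimes> u \<oplus> d \<in> Q" using snoc(3) by simp
  show ?case
  proof (cases "d \<in> Q")
    case True
    then have "y \<otimes> u \<oplus> d \<oplus> \<ominus> d \<in> Q" using Qi(4)[OF p] Qi(7) by blast
    moreover have "y \<otimes> u \<oplus> d \<oplus> \<ominus> d = y \<otimes> u" using c yc by algebra
    ultimately have "u \<in> Q" using Qd(3)[OF yc(2) uE] y by auto
    then show ?thesis using snoc(1) dE(3) unfolding u_def by blast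
  next
    case False
    then obtain d' n where d': "d' \<in> A" "n \<in> Q" "n \<oplus> d \<otimes> d' = \<one>" using unit dE by blast
    have d'E: "d' \<in> E" using d' A by blast
    note cc = SE(1)[OF d'E] Qi(2)[OF d'(2)]
    \<comment> \<open>Modulo \<open>Q\<close> one has yu = -d and dd' = 1, so -ud' inverts
      y.\<close>
    have "(n \<oplus> d' \<otimes> (y \<otimes> u \<oplus> d)) \<oplus> y \<otimes> (\<ominus> (u \<otimes> d')) = n \<oplus> d \<otimes> d'" using c cc yc by algebra
    moreover have "n \<oplus> d' \<otimes> (y \<otimes> u \<oplus> d) \<in> Q" using Qi(4)[OF d'(2) Qi(5)[OF p d'E]] .
    moreover have "\<ominus> (u \<otimes> d') \<in> E" using SE(5,6) uE d'E by blast
    ultimately show ?thesis using d'(3) by metis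
  qed
qed

text \<open>Multiplication by c turns A-submodules of E into ideals of A, to which the finiteness of
  A applies.\<close>

lemma (in field) ideal_of_scaled_submodule:
  assumes A: "subring A R" and E: "subring E R" "A \<subseteq> E" and c: "c \<in> carrier R" "\<And>y. y \<in> E \<Longrightarrow> c \<otimes> y \<in> A"
    and W: "W \<subseteq> E" "\<zero> \<in> W" "\<And>a b. a \<in> W \<Longrightarrow> b \<in> W \<Longrightarrow> a \<oplus> b \<in> W" "\<And>a b. a \<in> A \<Longrightarrow> b \<in> W \<Longrightarrow> a \<otimes> b \<in> W"
  shows "ideal ((\<lambda>y. c \<otimes> y) ` W) (restrict_ring R A)"
proof (rule subring_idealI[OF A])
  note S = subringD(1)[OF A] subringD(1)[OF E(1)]
  show "\<zero> \<in> (\<lambda>y. c \<otimes> y) ` W" using W(2) c(1) by (intro image_eqI[of _ _ \<zero>]) auto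
  show "a \<in> A" if "a \<in> (\<lambda>y. c \<otimes> y) ` W" for a using that W(1) c(2) by blast
  show "a \<oplus> b \<in> (\<lambda>y. c \<otimes> y) ` W" if ab: "a \<in> (\<lambda>y. c \<otimes> y) ` W" "b \<in> (\<lambda>y. c \<otimes> y) ` W" for a b
  proof -
    obtain x y where *: "x \<in> W" "y \<in> W" "a = c \<otimes> x" "b = c \<otimes> y" using ab by blast
    then have "a \<oplus> b = c \<otimes> (x \<oplus> y)" using c(1) W(1) S(2) by (simp add: r_distr subset_iff)
    then show ?thesis using W(3) * by blast
  qed
  show "a \<otimes> b \<in> (\<lambda>y. c \<otimes> y) ` W" if ab: "a \<in> A" "b \<in> (\<lambda>y. c \<otimes> y) ` W" for a b
  proof -
    obtain y where *: "y \<in> W" "b = c \<otimes> y" using ab(2) by blast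
    then have "a \<otimes> b = c \<otimes> (a \<otimes> y)" using c(1) W(1) S ab(1) by (simp add: m_lcomm subset_iff)
    then show ?thesis using W(4) * ab(1) by blast
  qed
qed

text \<open>The map sending an ideal I of E to cI is monotone and injective into the ideals of A, so
  maximal members can be chosen there.\<close>

lemma (in field) noetherian_overring:
  assumes noeth: "noetherian_domain (restrict_ring R A)"
    and A: "subring A R" and E: "subring E R" "A \<subseteq> E"
    and c: "c \<in> carrier R" "c \<noteq> \<zero>" "\<And>y. y \<in> E \<Longrightarrow> c \<otimes> y \<in> A"
  shows "noetherian_domain (restrict_ring R E)"
proof -
  have dom: "domain (restrict_ring R E)" using subring_is_domain E by blast
  have "noetherian_ring (restrict_ring R E)"
  proof (rule ring.noetherian_ring_if_maximal_element)
    show "ring (restrict_ring R E)" using subring_is_ring E by blast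
    fix S assume S: "S \<noteq> {}" "\<And>I. I \<in> S \<Longrightarrow> ideal I (restrict_ring R E)"
    let ?f = "\<lambda>I. (\<lambda>y. c \<otimes> y) ` I"
    have "\<exists>J\<in>?f ` S. \<forall>I\<in>?f ` S. J \<subseteq> I \<longrightarrow> I = J"
    proof (rule noetherian_maximal_element[OF noeth])
      show "?f ` S \<noteq> {}" using S(1) by simp
      fix L assume "L \<in> ?f ` S"
      then obtain I where I: "I \<in> S" "L = ?f I" by blast
      note Id = subring_idealD[OF E(1) S(2)[OF I(1)]]
      show "ideal L (restrict_ring R A)"
        unfolding I(2) by (rule ideal_of_scaled_submodule[OF A E c(1,3)]) (use Id(1,3,4,5) E(2) in auto)
    qed
    then obtain J where J: "J \<in> S" "\<forall>I\<in>S. ?f J \<subseteq> ?f I \<longrightarrow> ?f I = ?f J" by auto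
    have "I = J" if I: "I \<in> S" "J \<subseteq> I" for I
    proof -
      have cI: "I \<subseteq> carrier R" "J \<subseteq> carrier R"
        using subring_idealD(2)[OF E(1) S(2)[OF I(1)]] subring_idealD(2)[OF E(1) S(2)[OF J(1)]] by auto
      have "?f I = ?f J" using J(2)[rule_format, OF I(1) image_mono[OF I(2)]] .
      moreover have "inj_on (\<lambda>y. c \<otimes> y) (carrier R)"
        using m_lcancel[OF c(2,1)] by (auto intro: inj_onI)
      ultimately show ?thesis using inj_on_image_eq_iff cI by metis
    qed
    then show "\<exists>J\<in>S. \<forall>I\<in>S. J \<subseteq> I \<longrightarrow> I = J" using J(1) by blast
  qed
  then show ?thesis using dom by (intro noetherian_domain.intro)
qed

section \<open>Integral closure in the presence of a nonzero conductor\<close>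

locale noetherian_with_conductor = field R for R (structure) +
  fixes D :: "'a set" and c :: 'a
  assumes qf: "quotient_field_of R D"
    and noeth: "noetherian_domain (restrict_ring R D)"
    and c: "c \<in> D" "c \<noteq> \<zero>" "\<And>y. y \<in> integral_closure R D \<Longrightarrow> c \<otimes> y \<in> D"
begin

abbreviation "D' \<equiv> integral_closure R D"

lemma D: "subring D R"
  using qf quotient_field_of_iff by blast

lemma D'_eq: "D' = almost_integral R D"
  using integral_closure_subset_almost_integral[OF qf]
    almost_integral_subset_integral_closure[OF D noeth] by blast

lemma D': "subring D' R" "D \<subseteq> D'"
  unfolding D'_eq using almost_integral_subring[OF D] by auto

lemma cc: "c \<in> carrier R" using c(1) subringD(1)[OF D] by blast

lemma qf': "quotient_field_of R D'"
  using quotient_field_of_mono[OF qf D'] .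

lemma noeth': "noetherian_domain (restrict_ring R D')"
  using noetherian_overring[OF noeth D D' cc c(2,3)] .

text \<open>If e clears all powers of y into D', then ce clears them into D, so almost integral over
  D' implies almost integral over D.\<close>

lemma integrally_closed: "integral_closure R D' = D'"
proof
  show "D' \<subseteq> integral_closure R D'" using subset_integral_closure[OF D'(1)] .
  show "integral_closure R D' \<subseteq> D'"
  proof
    fix y assume "y \<in> integral_closure R D'"
    then have "y \<in> almost_integral R D'" using integral_closure_subset_almost_integral[OF qf'] by blast
    then obtain e where e: "y \<in> carrier R" "e \<in> D'" "e \<noteq> \<zero>" "\<And>n::nat. e \<otimes> y [^] n \<in> D'"
      unfolding almost_integral_def by blast
    have ec: "e \<in> carrier R" using e subringD(1)[OF D'(1)] by blast
    have "(c \<otimes> e) \<otimes> y [^] n \<in> D" for n :: nat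
      using c(3)[OF e(4)[of n]] ec cc e(1) by (simp add: m_assoc)
    moreover have "c \<otimes> e \<in> D" "c \<otimes> e \<noteq> \<zero>" using c(3)[OF e(2)] integral c(2) e(3) cc ec by auto
    ultimately show "y \<in> D'" unfolding D'_eq almost_integral_def using e(1) by blast
  qed
qed

text \<open>Multiplying a nonzero element of Q by c brings it into D without making it zero.\<close>

lemma contraction_prime:
  assumes Q: "primeideal Q (restrict_ring R D')" "Q \<noteq> {\<zero>}"
  shows "primeideal (Q \<inter> D) (restrict_ring R D)" "Q \<inter> D \<noteq> {\<zero>}"
proof -
  note Qd = subring_primeidealD[OF D'(1) Q(1)]
  note Qi = subring_idealD[OF D'(1) Qd(1)]
  note S = subringD[OF D]
  have "ideal (Q \<inter> D) (restrict_ring R D)"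
    by (rule subring_idealI[OF D]) (use Qi(3,4,5) S(2,4,5) D'(2) in auto)
  then show "primeideal (Q \<inter> D) (restrict_ring R D)"
    unfolding subring_primeideal_iff[OF D] using Qd(2,3) D'(2) by blast
  obtain z where z: "z \<in> Q" "z \<noteq> \<zero>" using Q(2) Qi(3) by blast
  have "c \<otimes> z \<in> Q \<inter> D" using Qi(5)[OF z(1)] c(1) D'(2) c(3)[OF Qi(1)[OF z(1)]] by blast
  moreover have "c \<otimes> z \<noteq> \<zero>" using integral c(2) z cc Qi(2)[OF z(1)] by blast
  ultimately show "Q \<inter> D \<noteq> {\<zero>}" by blast
qed

text \<open>A nonzero prime Q of D' contracts to a nonzero, hence maximal, ideal of D; invertibility
  modulo Q then passes from D to D' along integral equations.\<close>

lemma dedekind_if_dim_le_1: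
  assumes dim: "\<And>P. primeideal P (restrict_ring R D) \<Longrightarrow> P \<noteq> {\<zero>} \<Longrightarrow> maximalideal P (restrict_ring R D)"
  shows "dedekind_domain R D'"
proof -
  have "maximalideal Q (restrict_ring R D')" if Q: "primeideal Q (restrict_ring R D')" "Q \<noteq> {\<zero>}" for Q
  proof -
    note N = dim[OF contraction_prime[OF Q]]
    note Qd = subring_primeidealD[OF D'(1) Q(1)]
    have "\<exists>w\<in>D'. \<exists>n\<in>Q. n \<oplus> y \<otimes> w = \<one>" if y: "y \<in> D' - Q" for y
    proof -
      have "y \<in> D'" using y by blast
      then obtain q where q: "set q \<subseteq> D" "y [^] length q \<oplus> eval q y = \<zero>"
        by (rule integral_closureE[OF D])
      show ?thesis
      proof (rule integral_unit_mod_prime[OF D'(1) D D'(2) Q(1) _ y q(1)])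
        show "\<exists>d'\<in>D. \<exists>n\<in>Q. n \<oplus> d \<otimes> d' = \<one>" if "d \<in> D - Q" for d
          using N that unfolding subring_maximalideal_iff[OF D] by blast
      qed (use q(2) subring_idealD(3)[OF D'(1) Qd(1)] in simp)
    qed
    then show ?thesis unfolding subring_maximalideal_iff[OF D'(1)] using Qd(1,2) by blast
  qed
  then show ?thesis
    unfolding dedekind_domain_def using qf' noeth' integrally_closed by blast
qed

end

section \<open>Localizations as pseudo-valuation domains\<close>

lemma (in field) local_ring_withI:
  assumes A: "subring A R" and m: "ideal m (restrict_ring R A)" "\<one> \<notin> m"
    and unit: "\<And>x. x \<in> A - m \<Longrightarrow> inv x \<in> A"
  shows "local_ring_with (restrict_ring R A) m"
proof -
  note S = subringD[OF A]
  note mi = subring_idealD[OF A m(1)]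
  have inv: "x \<otimes> inv x = \<one>" if "x \<in> A - m" for x
    using that inv_nonzero(3)[of x] S(1) mi(3) by blast
  have max: "maximalideal m (restrict_ring R A)"
    unfolding subring_maximalideal_iff[OF A]
  proof (intro conjI ballI m)
    fix x assume x: "x \<in> A - m"
    have "\<zero> \<oplus> x \<otimes> inv x = \<one>" using inv[OF x] by simp
    then show "\<exists>y\<in>A. \<exists>n\<in>m. n \<oplus> x \<otimes> y = \<one>" using unit[OF x] mi(3) by blast
  qed
  have "P = m" if P: "maximalideal P (restrict_ring R A)" for P
  proof -
    have Pi: "ideal P (restrict_ring R A)" "\<one> \<notin> P" using P subring_maximalideal_iff[OF A] by auto
    note Pd = subring_idealD[OF A Pi(1)]
    have "P \<subseteq> m"
    proof
      fix x assume x: "x \<in> P"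
      show "x \<in> m"
      proof (rule ccontr)
        assume "x \<notin> m"
        then have xA: "x \<in> A - m" using Pd(1)[OF x] by blast
        then have "x \<otimes> inv x \<in> P" using Pd(6)[OF x unit] by blast
        then show False using inv[OF xA] Pi(2) by simp
      qed
    qed
    moreover have "m \<subseteq> A" "m \<noteq> A" using mi(1) m(2) S(3) by auto
    ultimately show ?thesis using maximalideal.I_maximal[OF P m(1)] by simp
  qed
  then show ?thesis unfolding local_ring_with_def using subring_cring[OF A] max by blast
qed

text \<open>Multiplying an integral equation for \<open>x\<close> by a power of \<open>y = x\<^sup>-\<^sup>1\<close> shows that \<open>y\<close> is a unit.\<close>

lemma (in field) integral_inverse_power:
  assumes B: "subring B R" and m: "ideal m (restrict_ring R B)"
    and x: "x \<in> carrier R" and y: "y \<in> m" and xy: "x \<otimes> y = \<one>" and q: "set q \<subseteq> B"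
  shows "\<exists>z\<in>m. y [^] length q \<otimes> (x [^] length q \<oplus> eval q x) = \<one> \<oplus> z"
  using q
proof (induct q rule: rev_induct)
  case Nil
  then show ?case using subring_idealD(3)[OF B m] by force
next
  case (snoc d q)
  note S = subringD[OF B]
  note mi = subring_idealD[OF B m]
  have yB: "y \<in> B" "y \<in> carrier R" using mi(1,2) y by auto
  have qc: "set q \<subseteq> carrier R" "d \<in> carrier R" using snoc(2) S(1) by auto
  obtain z where z: "z \<in> m" "y [^] length q \<otimes> (x [^] length q \<oplus> eval q x) = \<one> \<oplus> z"
    using snoc by auto
  note c = mi(2)[OF z(1)] nat_pow_closed[OF x, of "length q"] nat_pow_closed[OF yB(2), of "length q"]
    eval_in_carrier[OF qc(1) x]
  have "y [^] length (q @ [d]) \<otimes> (x [^] length (q @ [d]) \<oplus> eval (q @ [d]) x) =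
    (y [^] length q \<otimes> y) \<otimes> (x [^] length q \<otimes> x \<oplus> (x \<otimes> eval q x \<oplus> d))"
    unfolding eval_snoc[OF qc x] by simp
  also have "\<dots> = (x \<otimes> y) \<otimes> (y [^] length q \<otimes> (x [^] length q \<oplus> eval q x)) \<oplus> (y [^] length q \<otimes> d) \<otimes> y"
    using c x yB qc by algebra
  also have "\<dots> = \<one> \<oplus> (z \<oplus> (y [^] length q \<otimes> d) \<otimes> y)"
    unfolding xy z(2) using c yB qc by algebra
  finally have "y [^] length (q @ [d]) \<otimes> (x [^] length (q @ [d]) \<oplus> eval (q @ [d]) x) =
    \<one> \<oplus> (z \<oplus> (y [^] length q \<otimes> d) \<otimes> y)" .
  moreover have "y [^] length q \<otimes> d \<in> B" using subring_pow_closed[OF B yB(1)] snoc(2) S(5) by simp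
  then have "z \<oplus> (y [^] length q \<otimes> d) \<otimes> y \<in> m" using mi(4)[OF z(1) mi(5)[OF y]] by blast
  ultimately show ?case by blast
qed

text \<open>Multiplying an integral equation for x = y^-1 by a power of y would give 0 = 1 + z with
  z in m.\<close>

lemma (in field) inverse_of_nonunit_not_integral:
  assumes B: "subring B R" and m: "ideal m (restrict_ring R B)" "\<one> \<notin> m"
    and A: "subring A R" "A \<subseteq> B"
    and x: "x \<in> integral_closure R A" and y: "y \<in> m"
  shows "x \<otimes> y \<noteq> \<one>"
proof
  assume xy: "x \<otimes> y = \<one>"
  obtain q where q: "x \<in> carrier R" "set q \<subseteq> A" "x [^] length q \<oplus> eval q x = \<zero>"
    by (rule integral_closureE[OF A(1) x])
  note mi = subring_idealD[OF B m(1)]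
  obtain z where z: "z \<in> m" "y [^] length q \<otimes> \<zero> = \<one> \<oplus> z"
    using integral_inverse_power[OF B m(1) q(1) y xy, of q] q(2,3) A(2) by auto
  have "\<one> = (\<one> \<oplus> z) \<oplus> \<ominus> z" using mi(2)[OF z(1)] by algebra
  also have "\<dots> = \<ominus> z" using z mi(2)[OF y] mi(2)[OF z(1)] by (simp flip: z(2))
  finally show False using mi(7)[OF z(1)] m(2) by simp
qed

section \<open>Localization at a prime ideal\<close>

definition localization_ideal :: "('a, 'm) ring_scheme \<Rightarrow> 'a set \<Rightarrow> 'a set \<Rightarrow> 'a set" where
  "localization_ideal R D N = {x \<in> carrier R. \<exists>s\<in>D - N. s \<otimes>\<^bsub>R\<^esub> x \<in> N}"

locale localization_at_prime = field R for R (structure) +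
  fixes D N :: "'a set"
  assumes D: "subring D R" and N: "primeideal N (restrict_ring R D)"
begin

abbreviation "A \<equiv> localization R D N"
abbreviation "m \<equiv> localization_ideal R D N"

lemmas SD = subringD[OF D]
lemmas Nd = subring_primeidealD[OF D N]
lemmas Ni = subring_idealD[OF D Nd(1)]

lemma mult_closed: "s \<in> D - N \<Longrightarrow> t \<in> D - N \<Longrightarrow> s \<otimes> t \<in> D - N"
  using Nd(3) SD(5) by blast

lemma A_iff: "x \<in> A \<longleftrightarrow> x \<in> carrier R \<and> (\<exists>s\<in>D - N. s \<otimes> x \<in> D)"
  by (rule localization_iff[OF D Ni(3)])

lemma m_iff: "x \<in> m \<longleftrightarrow> x \<in> carrier R \<and> (\<exists>s\<in>D - N. s \<otimes> x \<in> N)"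
  unfolding localization_ideal_def by blast

lemma one_D: "\<one> \<in> D - N"
  using SD(3) Nd(2) by blast

lemma D_subset: "D \<subseteq> A"
proof
  fix x assume x: "x \<in> D"
  then have "\<one> \<otimes> x \<in> D" using SD(1)[OF x] by simp
  then show "x \<in> A" unfolding A_iff using one_D SD(1)[OF x] by blast
qed

lemma N_subset: "N \<subseteq> m"
proof
  fix x assume x: "x \<in> N"
  then have "\<one> \<otimes> x \<in> N" using Ni(2)[OF x] by simp
  then show "x \<in> m" unfolding m_iff using one_D Ni(2)[OF x] by blast
qed

lemma AE:
  assumes "x \<in> A" obtains s where "x \<in> carrier R" "s \<in> D - N" "s \<in> carrier R" "s \<otimes> x \<in> D"
  using assms SD(1) unfolding A_iff by blast

lemma mE:
  assumes "x \<in> m" obtains s where "x \<in> carrier R" "s \<in> D - N" "s \<in> carrier R" "s \<otimes> x \<in> N"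
  using assms SD(1) unfolding m_iff by blast

lemma A_add: assumes x: "x \<in> A" and y: "y \<in> A" shows "x \<oplus> y \<in> A"
proof -
  obtain s where s: "x \<in> carrier R" "s \<in> D - N" "s \<in> carrier R" "s \<otimes> x \<in> D" using x by (rule AE)
  obtain t where t: "y \<in> carrier R" "t \<in> D - N" "t \<in> carrier R" "t \<otimes> y \<in> D" using y by (rule AE)
  have "(s \<otimes> t) \<otimes> (x \<oplus> y) = t \<otimes> (s \<otimes> x) \<oplus> s \<otimes> (t \<otimes> y)" using s t by algebra
  also have "\<dots> \<in> D" using s(2,4) t(2,4) SD(4,5) by simp
  finally show ?thesis unfolding A_iff using mult_closed[OF s(2) t(2)] s t by blast
qed

lemma A_mult: assumes x: "x \<in> A" and y: "y \<in> A" shows "x \<otimes> y \<in> A"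
proof -
  obtain s where s: "x \<in> carrier R" "s \<in> D - N" "s \<in> carrier R" "s \<otimes> x \<in> D" using x by (rule AE)
  obtain t where t: "y \<in> carrier R" "t \<in> D - N" "t \<in> carrier R" "t \<otimes> y \<in> D" using y by (rule AE)
  have "(s \<otimes> t) \<otimes> (x \<otimes> y) = (s \<otimes> x) \<otimes> (t \<otimes> y)" using s t by algebra
  also have "\<dots> \<in> D" using s(4) t(4) SD(5) by simp
  finally show ?thesis unfolding A_iff using mult_closed[OF s(2) t(2)] s t by blast
qed

lemma A: "subring A R"
proof (rule subringI)
  show "A \<subseteq> carrier R" using A_iff by blast
  show "\<one> \<in> A" using D_subset SD(3) by blast
  show "x \<otimes> y \<in> A" "x \<oplus> y \<in> A" if "x \<in> A" "y \<in> A" for x y using A_add A_mult that by auto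
  show "\<ominus> x \<in> A" if x: "x \<in> A" for x
  proof -
    have "(\<ominus> \<one>) \<otimes> x \<in> A" using A_mult[OF _ x] D_subset SD(6)[OF SD(3)] by blast
    moreover have "x \<in> carrier R" using x A_iff by blast
    then have "(\<ominus> \<one>) \<otimes> x = \<ominus> x" by algebra
    ultimately show ?thesis by simp
  qed
qed

lemma m: "ideal m (restrict_ring R A)" "\<one> \<notin> m"
proof -
  show "ideal m (restrict_ring R A)"
  proof (rule subring_idealI[OF A])
    show "x \<in> A" if "x \<in> m" for x using that Ni(1) unfolding A_iff m_iff by blast
    show "\<zero> \<in> m" using N_subset Ni(3) by blast
    fix x y assume y: "y \<in> m"
    obtain t where t: "y \<in> carrier R" "t \<in> D - N" "t \<in> carrier R" "t \<otimes> y \<in> N" using y by (rule mE)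
    show "x \<oplus> y \<in> m" if x: "x \<in> m"
    proof -
      obtain s where s: "x \<in> carrier R" "s \<in> D - N" "s \<in> carrier R" "s \<otimes> x \<in> N" using x by (rule mE)
      have "(s \<otimes> t) \<otimes> (x \<oplus> y) = t \<otimes> (s \<otimes> x) \<oplus> s \<otimes> (t \<otimes> y)" using s t by algebra
      also have "\<dots> \<in> N" using s(2,4) t(2,4) Ni(4,5) by simp
      finally show ?thesis unfolding m_iff using mult_closed[OF s(2) t(2)] s t by blast
    qed
    show "x \<otimes> y \<in> m" if x: "x \<in> A"
    proof -
      obtain s where s: "x \<in> carrier R" "s \<in> D - N" "s \<in> carrier R" "s \<otimes> x \<in> D" using x by (rule AE)
      have "(s \<otimes> t) \<otimes> (x \<otimes> y) = (s \<otimes> x) \<otimes> (t \<otimes> y)" using s t by algebra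
      also have "\<dots> \<in> N" using s(4) t(4) Ni(5) by simp
      finally show ?thesis unfolding m_iff using mult_closed[OF s(2) t(2)] s t by blast
    qed
  qed
  show "\<one> \<notin> m"
  proof
    assume "\<one> \<in> m"
    then obtain s where "s \<in> D - N" "s \<in> carrier R" "s \<otimes> \<one> \<in> N" by (rule mE)
    then show False by simp
  qed
qed

lemma A_unit: assumes x: "x \<in> A - m" shows "inv x \<in> A"
proof -
  have "x \<in> A" using x by blast
  then obtain s where s: "x \<in> carrier R" "s \<in> D - N" "s \<in> carrier R" "s \<otimes> x \<in> D" by (rule AE)
  have "x \<noteq> \<zero>" using x N_subset Ni(3) by blast
  note ix = inv_nonzero[OF s(1) this]
  have "(s \<otimes> x) \<otimes> inv x = s \<otimes> (x \<otimes> inv x)" using s ix(1) by algebra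
  then have "(s \<otimes> x) \<otimes> inv x \<in> D" using ix s by simp
  moreover have "s \<otimes> x \<in> D - N" using s x m_iff by blast
  ultimately show ?thesis unfolding A_iff using ix(1) by blast
qed

lemma local_A: "local_ring_with (restrict_ring R A) m"
  using local_ring_withI[OF A m A_unit] .

lemma m_contract: assumes "x \<in> m" "x \<in> D" shows "x \<in> N"
  using assms Nd(3) unfolding m_iff by blast

lemma m_cancel: assumes "s \<in> D - N" "x \<in> carrier R" "s \<otimes> x \<in> m" shows "x \<in> m"
proof -
  obtain t where t: "t \<in> D - N" "t \<in> carrier R" "t \<otimes> (s \<otimes> x) \<in> N" using assms(3) by (rule mE)
  have "(t \<otimes> s) \<otimes> x = t \<otimes> (s \<otimes> x)" using t assms SD(1) by (simp add: m_assoc)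
  then have "(t \<otimes> s) \<otimes> x \<in> N" using t by simp
  then show ?thesis unfolding m_iff using mult_closed[OF t(1) assms(1)] assms(2) by blast
qed

text \<open>An ideal of the localization is determined by its contraction to D: each x has a
  multiple sx in D, and s is a unit.\<close>

lemma A_noetherian:
  assumes "noetherian_domain (restrict_ring R D)"
  shows "noetherian_domain (restrict_ring R A)"
proof -
  have dom: "domain (restrict_ring R A)" using subring_is_domain A by blast
  have "noetherian_ring (restrict_ring R A)"
  proof (rule ring.noetherian_ring_if_maximal_element)
    show "ring (restrict_ring R A)" using subring_is_ring A by blast
    fix S assume S: "S \<noteq> {}" "\<And>I. I \<in> S \<Longrightarrow> ideal I (restrict_ring R A)"
    let ?f = "\<lambda>I. I \<inter> D"
    have "\<exists>J\<in>?f ` S. \<forall>I\<in>?f ` S. J \<subseteq> I \<longrightarrow> I = J"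
    proof (rule noetherian_maximal_element[OF assms])
      show "?f ` S \<noteq> {}" using S(1) by simp
      fix L assume "L \<in> ?f ` S"
      then obtain I where I: "I \<in> S" "L = ?f I" by blast
      note Id = subring_idealD[OF A S(2)[OF I(1)]]
      show "ideal L (restrict_ring R D)"
        unfolding I(2) by (rule subring_idealI[OF D]) (use Id(3,4,5) D_subset SD(2,4,5) in auto)
    qed
    then obtain J where J: "J \<in> S" "\<forall>I\<in>S. ?f J \<subseteq> ?f I \<longrightarrow> ?f I = ?f J" by auto
    have "I \<subseteq> J" if I: "I \<in> S" "J \<subseteq> I" for I
    proof
      fix x assume x: "x \<in> I"
      note Id = subring_idealD[OF A S(2)[OF I(1)]] and Jd = subring_idealD[OF A S(2)[OF J(1)]]
      have eq: "?f I = ?f J" using J(2) I by blast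
      obtain s where s: "x \<in> carrier R" "s \<in> D - N" "s \<in> carrier R" "s \<otimes> x \<in> D"
        using Id(1)[OF x] by (rule AE)
      have sA: "s \<in> A - m" using s(2) D_subset m_contract by blast
      have s0: "s \<noteq> \<zero>" using s(2) Ni(3) by blast
      have "s \<otimes> x \<in> ?f I" using Id(5)[OF x] sA s(4) by blast
      then have "s \<otimes> x \<in> J" using eq by blast
      then have "inv s \<otimes> (s \<otimes> x) \<in> J" using Jd(5) A_unit[OF sA] by blast
      moreover have "inv s \<otimes> (s \<otimes> x) = x"
        using s inv_nonzero[OF s(3) s0] by (simp flip: m_assoc)
      ultimately show "x \<in> J" by simp
    qed
    then show "\<exists>J\<in>S. \<forall>I\<in>S. J \<subseteq> I \<longrightarrow> I = J" using J(1) by blast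
  qed
  then show ?thesis using dom by (intro noetherian_domain.intro)
qed

end

section \<open>The valuation ring of a residually principal localization\<close>

locale localization_residually_principal = localization_at_prime +
  assumes qf: "quotient_field_of R D"
    and noeth: "noetherian_domain (restrict_ring R D)"
    and max: "maximalideal N (restrict_ring R D)" and nonzero: "N \<noteq> {\<zero>}"
    and rp: "residually_principal (restrict_ring R D) N"
begin

abbreviation "N2 \<equiv> ideal_prod (restrict_ring R D) N N"

lemma N2_ideal: "ideal N2 (restrict_ring R D)"
  using ring.ideal_prod_is_ideal[OF subring_is_ring[OF D] Nd(1) Nd(1)] .

lemma prod_in_N2: "a \<in> N \<Longrightarrow> b \<in> N \<Longrightarrow> a \<otimes> b \<in> N2"
  using ideal_prod.prod[of a N b N "restrict_ring R D"] by simp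

text \<open>Clearing denominators shows that ab lies in x times the localization. The point is the
  sharper conclusion that the quotient r is a nonunit, which makes p^-1 m a ring.\<close>

lemma m_square:
  assumes x: "x \<in> N - N2" and a: "a \<in> m" and b: "b \<in> m"
  shows "\<exists>r\<in>m. a \<otimes> b = x \<otimes> r"
proof -
  have xc: "x \<in> carrier R" "x \<noteq> \<zero>" using x Ni(2) subring_idealD(3)[OF D N2_ideal] by auto
  note ix = inv_nonzero[OF xc]
  obtain s0 where s0: "s0 \<in> D - N" "\<And>z. z \<in> N2 \<Longrightarrow> \<exists>r\<in>D. s0 \<otimes> z = x \<otimes> r"
    using noetherian_domain.square_locally_principal[OF noeth max rp x] by auto
  obtain s where s: "a \<in> carrier R" "s \<in> D - N" "s \<in> carrier R" "s \<otimes> a \<in> N" using a by (rule mE)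
  obtain t where t: "b \<in> carrier R" "t \<in> D - N" "t \<in> carrier R" "t \<otimes> b \<in> N" using b by (rule mE)
  define r where "r = inv x \<otimes> (a \<otimes> b)"
  have rc: "r \<in> carrier R" unfolding r_def using ix s t by simp
  have "x \<otimes> r = (x \<otimes> inv x) \<otimes> (a \<otimes> b)" unfolding r_def using ix(1) xc s t by algebra
  then have xr: "a \<otimes> b = x \<otimes> r" using ix s t by simp
  obtain d where d: "d \<in> D" "s0 \<otimes> ((s \<otimes> a) \<otimes> (t \<otimes> b)) = x \<otimes> d"
    using s0(2)[OF prod_in_N2[OF s(4) t(4)]] by blast
  have c: "s0 \<in> carrier R" "d \<in> carrier R" using s0 d SD(1) by auto
  define e where "e = s0 \<otimes> (s \<otimes> t)"
  have e: "e \<in> D - N" unfolding e_def using mult_closed s0(1) s(2) t(2) by blast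
  have ec: "e \<in> carrier R" using e SD(1) by blast
  have "x \<otimes> (e \<otimes> r) = e \<otimes> (x \<otimes> r)" using xc ec rc by algebra
  also have "\<dots> = s0 \<otimes> ((s \<otimes> a) \<otimes> (t \<otimes> b))" unfolding xr[symmetric] e_def using c s t by algebra
  finally have er: "e \<otimes> r = d" using d(2) m_lcancel[OF xc(2,1)] ec rc c by simp
  \<comment> \<open>Here dx lies in N^2; if d were invertible modulo \<open>N\<close>, then x itself
    would lie in N^2.\<close>
  have "d \<in> N"
  proof (rule ccontr)
    assume "d \<notin> N"
    have q: "(s0 \<otimes> (s \<otimes> a)) \<otimes> (t \<otimes> b) \<in> N2" using prod_in_N2 Ni(5)[OF s(4)] s0(1) t(4) by blast
    have "(s0 \<otimes> (s \<otimes> a)) \<otimes> (t \<otimes> b) = d \<otimes> x" using d(2) c s t xc by (simp add: m_assoc m_comm[of d])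
    then have dx: "d \<otimes> x \<in> N2" using q by simp
    obtain y n where y: "y \<in> D" "n \<in> N" "n \<oplus> d \<otimes> y = \<one>"
      using max \<open>d \<notin> N\<close> d(1) unfolding subring_maximalideal_iff[OF D] by blast
    have "x = (n \<oplus> d \<otimes> y) \<otimes> x" using y xc by simp
    also have "\<dots> = n \<otimes> x \<oplus> y \<otimes> (d \<otimes> x)" using Ni(2)[OF y(2)] SD(1)[OF y(1)] c xc by algebra
    also have "\<dots> \<in> N2"
      using subring_idealD(4,5)[OF D N2_ideal] prod_in_N2[OF y(2)] x y(1) dx by simp
    finally show False using x by blast
  qed
  then have "r \<in> m" unfolding m_iff using e er rc by blast
  then show ?thesis using xr by blast
qed

lemma N2_multiple:
  assumes x: "x \<in> N - N2" and z: "z \<in> N2"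
  shows "\<exists>r\<in>m. z = x \<otimes> r"
  using z
proof (induct z rule: ideal_prod.induct)
  case (prod i j)
  then show ?case using m_square[OF x, of i j] N_subset by auto
next
  case (sum s1 s2)
  then obtain r r' where "r \<in> m" "s1 = x \<otimes> r" "r' \<in> m" "s2 = x \<otimes> r'" by blast
  moreover from this have "s1 \<oplus> s2 = x \<otimes> (r \<oplus> r')"
    using x Ni(2) subring_idealD(2)[OF A m(1)] by (simp add: r_distr)
  ultimately show ?case using subring_idealD(4)[OF A m(1)] by auto
qed

lemma ex_uniformizer: "\<exists>p. p \<in> N - N2"
  using noetherian_domain.maximalideal_not_idempotent[OF noeth max] nonzero by simp

text \<open>A uniformizer of \<open>V\<close>: by \<open>V_iff\<close> below, m = pV.\<close>

definition p where "p = (SOME p. p \<in> N - N2)"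

lemma p: "p \<in> N - N2" "p \<in> carrier R" "p \<noteq> \<zero>" "p \<in> m"
proof -
  show 1: "p \<in> N - N2" unfolding p_def using someI_ex[OF ex_uniformizer] .
  then show "p \<in> carrier R" "p \<noteq> \<zero>" "p \<in> m"
    using Ni(2) subring_idealD(3)[OF D N2_ideal] N_subset by auto
qed

abbreviation "V \<equiv> colon R (carrier R) m m"

lemmas mi = subring_idealD[OF A m(1)]

text \<open>A single product has to be tested: if vp is in m, then (vp)b lies in m^2 <= pm for each
  b in m, and p cancels.\<close>

lemma V_iff: "v \<in> V \<longleftrightarrow> v \<in> carrier R \<and> v \<otimes> p \<in> m"
proof
  assume "v \<in> V"
  then show "v \<in> carrier R \<and> v \<otimes> p \<in> m" unfolding colon_def using p(4) by blast
next
  assume v: "v \<in> carrier R \<and> v \<otimes> p \<in> m"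
  have "v \<otimes> b \<in> m" if b: "b \<in> m" for b
  proof -
    obtain r where r: "r \<in> m" "(v \<otimes> p) \<otimes> b = p \<otimes> r" using m_square[OF p(1) _ b] v by blast
    have "p \<otimes> (v \<otimes> b) = (v \<otimes> p) \<otimes> b" using v p(2) mi(2)[OF b] by algebra
    then have "v \<otimes> b = r" using r m_lcancel[OF p(3,2)] v mi(2) b by simp
    then show ?thesis using r(1) by simp
  qed
  then show "v \<in> V" unfolding colon_def using v by blast
qed

lemma V_mult_m: "v \<in> V \<Longrightarrow> b \<in> m \<Longrightarrow> v \<otimes> b \<in> m"
  unfolding colon_def by blast

lemma A_subset_V: "A \<subseteq> V"
  unfolding colon_def using mi(5) subringD(1)[OF A] by blast

lemma V: "subring V R"
proof (rule subringI)
  show Vc: "V \<subseteq> carrier R" unfolding colon_def by blast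
  show "\<one> \<in> V" using A_subset_V subringD(3)[OF A] by blast
  fix x y assume x: "x \<in> V"
  have xc: "x \<in> carrier R" using x Vc by blast
  show "\<ominus> x \<in> V"
  proof -
    have "(\<ominus> x) \<otimes> p = \<ominus> (x \<otimes> p)" using xc p(2) by algebra
    then show ?thesis unfolding V_iff using mi(7)[OF V_mult_m[OF x p(4)]] xc by simp
  qed
  assume y: "y \<in> V"
  have yc: "y \<in> carrier R" using y Vc by blast
  have "(x \<otimes> y) \<otimes> p = x \<otimes> (y \<otimes> p)" using xc yc p(2) by algebra
  then show "x \<otimes> y \<in> V" unfolding V_iff using V_mult_m[OF x V_mult_m[OF y p(4)]] xc yc by simp
  have "(x \<oplus> y) \<otimes> p = x \<otimes> p \<oplus> y \<otimes> p" using xc yc p(2) by algebra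
  then show "x \<oplus> y \<in> V"
    unfolding V_iff using mi(4)[OF V_mult_m[OF x p(4)] V_mult_m[OF y p(4)]] xc yc by simp
qed

lemma V_ideal: "ideal m (restrict_ring R V)"
  by (rule subring_idealI[OF V]) (use mi(1,3,4) A_subset_V V_mult_m in auto)

text \<open>For v in V - m some multiple x = svp lies in N - N^2, so the condition holds with x in
  place of p. It gives p^2 = svpr with r in m, hence v^-1 p = sr is in m.\<close>

lemma V_unit: assumes v: "v \<in> V - m" shows "inv v \<in> V"
proof -
  have vc: "v \<in> carrier R" using v subringD(1)[OF V] by blast
  have v0: "v \<noteq> \<zero>" using v mi(3) by blast
  note iv = inv_nonzero[OF vc v0]
  have "v \<otimes> p \<in> m" using v p(4) V_mult_m by blast
  then obtain s where s: "s \<in> D - N" "s \<in> carrier R" "s \<otimes> (v \<otimes> p) \<in> N" by (rule mE)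
  define x where "x = s \<otimes> (v \<otimes> p)"
  have xc: "x \<in> carrier R" using s(3) Ni(2) by (simp add: x_def)
  have "x \<notin> N2"
  proof
    assume "x \<in> N2"
    then obtain r where r: "r \<in> m" "x = p \<otimes> r" using N2_multiple[OF p(1)] by blast
    have "p \<otimes> (s \<otimes> v) = x" unfolding x_def using s(2) vc p(2) by algebra
    then have "s \<otimes> v = r" using r m_lcancel[OF p(3,2)] s(2) vc mi(2) by simp
    then have "v \<in> m" using m_cancel[OF s(1) vc] r(1) by simp
    then show False using v by blast
  qed
  then have x: "x \<in> N - N2" using s(3) x_def by simp
  obtain r where r: "r \<in> m" "p \<otimes> p = x \<otimes> r" using m_square[OF x p(4,4)] by blast
  have rc: "r \<in> carrier R" using mi(2)[OF r(1)] .
  have "p \<otimes> (v \<otimes> (s \<otimes> r)) = x \<otimes> r" unfolding x_def using s(2) vc p(2) rc by algebra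
  then have pv: "v \<otimes> (s \<otimes> r) = p" using r(2) m_lcancel[OF p(3,2), of "v \<otimes> (s \<otimes> r)" p] s(2) vc p(2) rc by auto
  have "inv v \<otimes> p = (inv v \<otimes> v) \<otimes> (s \<otimes> r)"
    unfolding pv[symmetric] using iv(1) vc s(2) rc by algebra
  then have "inv v \<otimes> p = s \<otimes> r" using iv s(2) rc by simp
  moreover have "s \<otimes> r \<in> m" using mi(5)[OF r(1)] s(1) D_subset by blast
  ultimately show ?thesis unfolding V_iff using iv(1) by simp
qed

lemma local_V: "local_ring_with (restrict_ring R V) m"
  using local_ring_withI[OF V V_ideal m(2) V_unit] .

text \<open>If a p^-k were in m for all k, then p^-1 would be almost integral, hence integral, over
  the noetherian localization, although p is a nonunit. At the first k where this fails, a p^-k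
  still lies in V, because for k > 0 multiplying it by p leads back into m.\<close>

lemma uniformizer_exponent:
  assumes a: "a \<in> A" "a \<noteq> \<zero>"
  shows "\<exists>k::nat. \<exists>u\<in>V - m. a = p [^] k \<otimes> u"
proof -
  note ip = inv_nonzero[OF p(2,3)]
  have ac: "a \<in> carrier R" using a subringD(1)[OF A] by blast
  have "\<exists>k::nat. a \<otimes> inv p [^] k \<notin> m"
  proof (rule ccontr)
    assume "\<nexists>k::nat. a \<otimes> inv p [^] k \<notin> m"
    then have "a \<otimes> inv p [^] k \<in> A" for k :: nat using mi(1) by blast
    then have "inv p \<in> almost_integral R A" unfolding almost_integral_def using a ip(1) by blast
    then have "inv p \<in> integral_closure R A"
      using almost_integral_subset_integral_closure[OF A A_noetherian[OF noeth]] by blast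
    then show False
      using inverse_of_nonunit_not_integral[OF A m A _ _ p(4)] ip(4) by blast
  qed
  then obtain k :: nat where k: "a \<otimes> inv p [^] k \<notin> m" "\<And>i. i < k \<Longrightarrow> a \<otimes> inv p [^] i \<in> m"
    using exists_least_iff[of "\<lambda>k::nat. a \<otimes> inv p [^] k \<notin> m"] by blast
  have uc: "a \<otimes> inv p [^] k \<in> carrier R" using ac ip(1) by simp
  have "a \<otimes> inv p [^] k \<in> V"
  proof (cases k)
    case 0
    then show ?thesis using a(1) A_subset_V ac by auto
  next
    case (Suc i)
    have "(a \<otimes> inv p [^] k) \<otimes> p = (a \<otimes> inv p [^] i) \<otimes> (inv p \<otimes> p)"
      unfolding Suc using ac ip(1) p(2) by (simp add: m_assoc)
    also have "\<dots> = a \<otimes> inv p [^] i" using ac ip by simp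
    finally show ?thesis unfolding V_iff using uc k(2)[of i] Suc by simp
  qed
  moreover have "p [^] k \<otimes> (a \<otimes> inv p [^] k) = a \<otimes> (p \<otimes> inv p) [^] k"
    unfolding nat_pow_distrib[OF p(2) ip(1)] using ac ip(1) p(2) by (simp add: m_lcomm)
  then have "a = p [^] k \<otimes> (a \<otimes> inv p [^] k)" using ip(3) ac by simp
  ultimately show ?thesis using k(1) by blast
qed

text \<open>Write bx = p^i u and b = p^j v with u, v units of V. Then x = p^(i-j) u v^-1, and the
  sign of i - j decides whether x or its inverse lies in V.\<close>

lemma V_valuation: "valuation_domain R V"
proof -
  have qfV: "quotient_field_of R V"
    using quotient_field_of_mono[OF qf V] D_subset A_subset_V by blast
  have pV: "p [^] (n::nat) \<in> V" for n
    using subring_pow_closed[OF V] A_subset_V mi(1) p(4) by blast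
  have "x \<in> V \<or> inv x \<in> V" if x: "x \<in> carrier R" "x \<noteq> \<zero>" for x
  proof -
    note ix = inv_nonzero[OF x]
    obtain b where b: "b \<in> D" "b \<noteq> \<zero>" "b \<otimes> x \<in> D" using qf x unfolding quotient_field_of_iff by blast
    have bx: "b \<otimes> x \<noteq> \<zero>" using b SD(1) x integral by blast
    obtain i u where u: "b \<otimes> x = p [^] (i::nat) \<otimes> u" "u \<in> V - m"
      using uniformizer_exponent[OF _ bx] b(3) D_subset by blast
    obtain j v where v: "b = p [^] (j::nat) \<otimes> v" "v \<in> V - m"
      using uniformizer_exponent[OF _ b(2)] b(1) D_subset by blast
    have c: "u \<in> carrier R" "v \<in> carrier R" "u \<noteq> \<zero>" "v \<noteq> \<zero>"
      using u(2) v(2) subringD(1)[OF V] mi(3) by auto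
    note iu = inv_nonzero[OF c(1,3)] and iv = inv_nonzero[OF c(2,4)]
    have pc: "p [^] (n::nat) \<in> carrier R" "p [^] (n::nat) \<noteq> \<zero>" for n
      using p nat_pow_nonzero by auto
    have eq: "p [^] j \<otimes> (v \<otimes> x) = p [^] i \<otimes> u"
      using u(1) unfolding v(1) using c pc x by (simp add: m_assoc)
    show ?thesis
    proof (cases "j \<le> i")
      case True
      have "p [^] i = p [^] j \<otimes> p [^] (i - j)" using True p(2) by (simp add: nat_pow_mult)
      then have "p [^] j \<otimes> (v \<otimes> x) = p [^] j \<otimes> (p [^] (i - j) \<otimes> u)"
        using eq c pc by (simp add: m_assoc)
      then have vx: "v \<otimes> x = p [^] (i - j) \<otimes> u" using m_lcancel[OF pc(2,1)] c pc x by simp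
      have "x = inv v \<otimes> (v \<otimes> x)" using iv c x by (simp flip: m_assoc)
      also have "\<dots> \<in> V" unfolding vx using subringD(5)[OF V] V_unit[OF v(2)] pV u(2) by blast
      finally show ?thesis by simp
    next
      case False
      then have "p [^] j = p [^] i \<otimes> p [^] (j - i)" using p(2) by (simp add: nat_pow_mult)
      then have "p [^] i \<otimes> (p [^] (j - i) \<otimes> (v \<otimes> x)) = p [^] i \<otimes> u"
        using eq c pc x by (simp add: m_assoc)
      then have ux: "p [^] (j - i) \<otimes> (v \<otimes> x) = u" using m_lcancel[OF pc(2,1)] c pc x by simp
      have "inv x = inv x \<otimes> (inv u \<otimes> u)" using iu ix by simp
      also have "\<dots> = inv u \<otimes> (p [^] (j - i) \<otimes> v) \<otimes> (x \<otimes> inv x)"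
        unfolding ux[symmetric] using iu(1)[unfolded ux[symmetric]] ix(1) x c pc(1)[of "j - i"] by algebra
      also have "\<dots> = inv u \<otimes> (p [^] (j - i) \<otimes> v)" using ix iu c pc by simp
      also have "\<dots> \<in> V" using subringD(5)[OF V] V_unit[OF u(2)] pV v(2) by blast
      finally show ?thesis by simp
    qed
  qed
  then show ?thesis unfolding valuation_domain_def using qfV by blast
qed

theorem pseudo_valuation_domain_A: "pseudo_valuation_domain R A"
proof -
  have "quotient_field_of R A" using quotient_field_of_mono[OF qf A D_subset] .
  then show ?thesis
    unfolding pseudo_valuation_domain_def Let_def using local_A V_valuation local_V by blast
qed

end

section \<open>Pullbacks of Dedekind domains\<close>

text \<open>The multiplier \<open>y\<close> witnesses that \<open>M\<close> is invertible.\<close>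

lemma (in field) dedekind_multiplier:
  assumes ded: "dedekind_domain R E" and M: "maximalideal M (restrict_ring R E)" "M \<noteq> {\<zero>}"
  shows "\<exists>y\<in>carrier R. (\<forall>t\<in>M. y \<otimes> t \<in> E) \<and> (\<exists>w\<in>M. y \<otimes> w \<notin> M)"
proof -
  have qf: "quotient_field_of R E" and noeth: "noetherian_domain (restrict_ring R E)"
    and closed: "integral_closure R E = E"
    and dim: "\<And>P. primeideal P (restrict_ring R E) \<Longrightarrow> P \<noteq> {\<zero>} \<Longrightarrow> maximalideal P (restrict_ring R E)"
    using ded unfolding dedekind_domain_def by blast+
  have E: "subring E R" using qf quotient_field_of_iff by blast
  note S = subringD[OF E]
  have Mi: "ideal M (restrict_ring R E)" "\<one> \<notin> M" using M(1) subring_maximalideal_iff[OF E] by auto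
  note Md = subring_idealD[OF E Mi(1)]
  obtain a where a: "a \<in> M" "a \<noteq> \<zero>" using M(2) Md(3) by blast
  have aE: "a \<in> E" "a \<in> carrier R" using Md(1,2) a by auto
  \<comment> \<open>The quotient ideals (aE : b). A maximal one inside \<open>M\<close> is prime and
    contains a, so by dimension one it is \<open>M\<close>; this exhibits \<open>M\<close> as an
    annihilator in E/aE.\<close>
  define L where "L b = {t \<in> E. \<exists>r\<in>E. t \<otimes> b = a \<otimes> r}" for b
  have L_ideal: "ideal (L b) (restrict_ring R E)" if b: "b \<in> E" for b
  proof (rule subring_idealI[OF E])
    note bc = S(1)[OF b]
    show "\<zero> \<in> L b" unfolding L_def using S(2) bc aE by (auto intro!: bexI[of _ \<zero>])
    show "x \<oplus> y \<in> L b" if x: "x \<in> L b" and y: "y \<in> L b" for x y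
    proof -
      obtain r where r: "x \<in> E" "r \<in> E" "x \<otimes> b = a \<otimes> r" using x unfolding L_def by blast
      obtain s where s: "y \<in> E" "s \<in> E" "y \<otimes> b = a \<otimes> s" using y unfolding L_def by blast
      have "(x \<oplus> y) \<otimes> b = a \<otimes> (r \<oplus> s)"
        using r s S(1)[OF r(1)] S(1)[OF r(2)] S(1)[OF s(1)] S(1)[OF s(2)] bc aE(2)
        by (simp add: l_distr r_distr)
      then show ?thesis unfolding L_def using S(4)[OF r(1) s(1)] S(4)[OF r(2) s(2)] by blast
    qed
    show "x \<otimes> y \<in> L b" if x: "x \<in> E" and y: "y \<in> L b" for x y
    proof -
      obtain s where s: "y \<in> E" "s \<in> E" "y \<otimes> b = a \<otimes> s" using y unfolding L_def by blast
      have "(x \<otimes> y) \<otimes> b = a \<otimes> (x \<otimes> s)"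
        using s S(1)[OF x] S(1)[OF s(1)] S(1)[OF s(2)] bc aE(2) by (simp add: m_assoc m_lcomm)
      then show ?thesis unfolding L_def using S(5)[OF x s(1)] S(5)[OF x s(2)] by blast
    qed
  qed (simp add: L_def)
  let ?S = "{L b | b. b \<in> E \<and> L b \<subseteq> M}"
  have "L \<one> \<subseteq> M"
  proof
    fix t assume "t \<in> L \<one>"
    then obtain r where "t \<in> E" "r \<in> E" "t \<otimes> \<one> = a \<otimes> r" unfolding L_def by blast
    then show "t \<in> M" using Md(6)[OF a(1), of r] S(1)[of t] by simp
  qed
  then have "?S \<noteq> {}" using S(3) by blast
  then have "\<exists>J\<in>?S. \<forall>I\<in>?S. J \<subseteq> I \<longrightarrow> I = J"
    by (rule noetherian_maximal_element[OF noeth]) (use L_ideal in auto)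
  then obtain J where J: "J \<in> ?S" "\<forall>I\<in>?S. J \<subseteq> I \<longrightarrow> I = J" by blast
  then obtain b where b: "b \<in> E" "L b \<subseteq> M" "J = L b" by blast
  have b: "b \<in> E" "L b \<subseteq> M" "\<And>b'. b' \<in> E \<Longrightarrow> L b' \<subseteq> M \<Longrightarrow> L b \<subseteq> L b' \<Longrightarrow> L b' = L b"
    using b J(2) by blast+
  note bc = S(1)[OF b(1)]
  have mono: "L b \<subseteq> L (u \<otimes> b)" if u: "u \<in> E" for u
  proof
    fix t assume t: "t \<in> L b"
    then obtain r where r: "t \<in> E" "r \<in> E" "t \<otimes> b = a \<otimes> r" unfolding L_def by blast
    have "t \<otimes> (u \<otimes> b) = u \<otimes> (t \<otimes> b)" using S(1)[OF r(1)] S(1)[OF u] bc by algebra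
    also have "\<dots> = a \<otimes> (u \<otimes> r)"
      unfolding r(3) using S(1)[OF r(2)] S(1)[OF u] aE(2) by algebra
    finally have "t \<otimes> (u \<otimes> b) = a \<otimes> (u \<otimes> r)" .
    then show "t \<in> L (u \<otimes> b)" unfolding L_def using r(1) S(5)[OF u r(2)] by blast
  qed
  have shift: "v \<in> L (u \<otimes> b) \<longleftrightarrow> u \<otimes> v \<in> L b" if uv: "u \<in> E" "v \<in> E" for u v
  proof -
    have "v \<otimes> (u \<otimes> b) = (u \<otimes> v) \<otimes> b" using S(1)[OF uv(1)] S(1)[OF uv(2)] bc by (simp add: m_assoc m_lcomm)
    then show ?thesis unfolding L_def using uv S(5)[OF uv] by auto
  qed
  have "primeideal (L b) (restrict_ring R E)"
    unfolding subring_primeideal_iff[OF E]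
  proof (intro conjI ballI impI L_ideal b(1))
    show "\<one> \<notin> L b" using b(2) Mi(2) by blast
    fix u v assume u: "u \<in> E" and v: "v \<in> E" and uv: "u \<otimes> v \<in> L b"
    show "u \<in> L b \<or> v \<in> L b"
    proof (cases "L (u \<otimes> b) \<subseteq> M")
      case True
      then have "L (u \<otimes> b) = L b" using b(3)[OF S(5)[OF u b(1)]] mono[OF u] by blast
      then show ?thesis using shift[OF u v] uv by blast
    next
      case False
      \<comment> \<open>Exchange u for s: since us is in L b, the ideal L (sb) stays inside
        \<open>M\<close>, so it equals L b by maximality, and it contains u.\<close>
      then obtain s where s: "s \<in> L (u \<otimes> b)" "s \<notin> M" by blast
      have sE: "s \<in> E" using s(1) L_def by blast
      have us: "u \<otimes> s \<in> L b" using shift[OF u sE] s(1) by blast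
      have "L (s \<otimes> b) \<subseteq> M"
      proof
        fix t assume t: "t \<in> L (s \<otimes> b)"
        have tE: "t \<in> E" using t L_def by blast
        then have "s \<otimes> t \<in> M" using shift[OF sE] t b(2) by blast
        then show "t \<in> M"
          using subring_primeidealD(3)[OF E subring_maximalideal_prime[OF E M(1)] sE tE] s(2) by blast
      qed
      then have "L (s \<otimes> b) = L b" using b(3)[OF S(5)[OF sE b(1)]] mono[OF sE] by blast
      moreover have "s \<otimes> u \<in> L b" using us S(1) m_comm u sE by simp
      ultimately show ?thesis using shift[OF sE u] by blast
    qed
  qed
  moreover have "a \<in> L b" unfolding L_def using aE b(1) by blast
  ultimately have "maximalideal (L b) (restrict_ring R E)" using dim a(2) by blast
  then have LM: "L b = M"
    using maximalideal.I_maximal[OF _ Mi(1) b(2)] Md(1) Mi(2) S(3) by auto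
  note ia = inv_nonzero[OF aE(2) a(2)]
  \<comment> \<open>As bM <= aE, the fraction b/a carries \<open>M\<close> into
    \<open>E\<close>.\<close>
  define y where "y = b \<otimes> inv a"
  have yc: "y \<in> carrier R" unfolding y_def using bc ia by simp
  have "a \<otimes> y = b \<otimes> (a \<otimes> inv a)" unfolding y_def using bc ia(1) aE(2) by algebra
  then have ay: "a \<otimes> y = b" using bc ia by simp
  have yt: "y \<otimes> t \<in> E" if t: "t \<in> M" for t
  proof -
    obtain r where r: "r \<in> E" "t \<otimes> b = a \<otimes> r" using t LM unfolding L_def by blast
    have "a \<otimes> (y \<otimes> t) = t \<otimes> b" unfolding ay[symmetric] using aE(2) yc Md(2)[OF t] by algebra
    then have "y \<otimes> t = r" using r m_lcancel[OF a(2) aE(2)] yc Md(2)[OF t] S(1)[OF r(1)] by simp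
    then show ?thesis using r by simp
  qed
  have "\<exists>w\<in>M. y \<otimes> w \<notin> M"
  proof (rule ccontr)
    assume "\<not> (\<exists>w\<in>M. y \<otimes> w \<notin> M)"
    then have stable: "\<And>w. w \<in> M \<Longrightarrow> y \<otimes> w \<in> M" by blast
    \<comment> \<open>If yM <= M, then a is a common denominator for the powers of y, so y lies in
      the integrally closed E and b = ay in aE, which makes L b the unit ideal.\<close>
    have "a \<otimes> y [^] k \<in> M" for k :: nat
    proof (induct k)
      case (Suc k)
      have "a \<otimes> y [^] Suc k = y \<otimes> (a \<otimes> y [^] k)" using aE(2) yc by (simp add: m_comm m_lcomm)
      then show ?case using stable[OF Suc] by simp
    qed (use a aE in simp)
    then have "y \<in> almost_integral R E"
      unfolding almost_integral_def using Md(1) yc aE(1) a(2) by blast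
    then have yE: "y \<in> E"
      using almost_integral_subset_integral_closure[OF E noeth] closed by blast
    have "\<one> \<otimes> b = a \<otimes> y" using ay bc by simp
    then have "\<one> \<in> L b" unfolding L_def using yE S(3) by blast
    then show False using b(2) Mi(2) by blast
  qed
  then show ?thesis using yc yt by blast
qed

text \<open>Choose y with yM <= E but not yM <= M. If yx were in M, then 1 = n + ywe would give x =
  nx + (ew)(yx) in M^2. So 1 = k + yxu with k in M, and z = x(uyz) + kz.\<close>

lemma (in field) dedekind_maximalideal_generator:
  assumes ded: "dedekind_domain R E" and M: "maximalideal M (restrict_ring R E)" "M \<noteq> {\<zero>}"
    and x: "x \<in> M - ideal_prod (restrict_ring R E) M M" and z: "z \<in> M"
  shows "\<exists>r\<in>E. \<exists>w\<in>ideal_prod (restrict_ring R E) M M. z = x \<otimes> r \<oplus> w"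
proof -
  have E: "subring E R" using ded unfolding dedekind_domain_def quotient_field_of_iff by blast
  note S = subringD[OF E]
  have Mi: "ideal M (restrict_ring R E)" "\<one> \<notin> M" using M(1) subring_maximalideal_iff[OF E] by auto
  note Md = subring_idealD[OF E Mi(1)]
  have unit: "\<exists>y\<in>E. \<exists>n\<in>M. n \<oplus> v \<otimes> y = \<one>" if "v \<in> E" "v \<notin> M" for v
    using M(1) that unfolding subring_maximalideal_iff[OF E] by blast
  let ?M2 = "ideal_prod (restrict_ring R E) M M"
  have M2: "s \<otimes> t \<in> ?M2" if "s \<in> M" "t \<in> M" for s t
    using ideal_prod.prod[of s M t M "restrict_ring R E"] that by simp
  obtain y w where y: "y \<in> carrier R" "\<And>t. t \<in> M \<Longrightarrow> y \<otimes> t \<in> E" "w \<in> M" "y \<otimes> w \<notin> M"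
    using dedekind_multiplier[OF ded M] by blast
  obtain e n where e: "e \<in> E" "n \<in> M" "n \<oplus> y \<otimes> w \<otimes> e = \<one>" using unit[OF y(2)[OF y(3)] y(4)] by blast
  have xM: "x \<in> M" using x by blast
  note c = Md(2)[OF xM] Md(2)[OF z] Md(2)[OF y(3)] y(1) S(1)[OF e(1)] Md(2)[OF e(2)]
  have yx: "y \<otimes> x \<notin> M"
  proof
    assume yx: "y \<otimes> x \<in> M"
    have "x = (n \<oplus> y \<otimes> w \<otimes> e) \<otimes> x" using e c by simp
    also have "\<dots> = n \<otimes> x \<oplus> (e \<otimes> w) \<otimes> (y \<otimes> x)" using c by algebra
    finally have "x = n \<otimes> x \<oplus> (e \<otimes> w) \<otimes> (y \<otimes> x)" .
    moreover have "n \<otimes> x \<oplus> (e \<otimes> w) \<otimes> (y \<otimes> x) \<in> ?M2"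
      using ideal_prod.sum[of "n \<otimes> x" "restrict_ring R E" M M] M2[OF e(2) xM]
        M2[OF Md(5)[OF y(3) e(1)] yx] by simp
    ultimately show False using x by simp
  qed
  obtain u k where u: "u \<in> E" "k \<in> M" "k \<oplus> y \<otimes> x \<otimes> u = \<one>" using unit[OF y(2)[OF xM] yx] by blast
  have "z = (k \<oplus> y \<otimes> x \<otimes> u) \<otimes> z" using u c by simp
  also have "\<dots> = x \<otimes> (u \<otimes> (y \<otimes> z)) \<oplus> k \<otimes> z" using c S(1)[OF u(1)] Md(2)[OF u(2)] by algebra
  finally show ?thesis using S(5)[OF u(1) y(2)[OF z]] M2[OF u(2) z] by blast
qed

text \<open>The factor 1 = n + e is inserted as often as needed: each e moves an element of M into
  N, and each n is in N already.\<close>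

lemma (in field) residually_principal_descend:
  assumes D: "subring D R" and ded: "dedekind_domain R E" and DE: "D \<subseteq> E"
    and M: "maximalideal M (restrict_ring R E)" "M \<noteq> {\<zero>}"
    and N: "ideal N (restrict_ring R D)" "N \<subseteq> M"
    and e: "e \<in> D" "n \<in> N" "n \<oplus> e = \<one>" "\<And>t. t \<in> M \<Longrightarrow> e \<otimes> t \<in> N"
  shows "residually_principal (restrict_ring R D) N"
proof -
  have E: "subring E R" using ded unfolding dedekind_domain_def quotient_field_of_iff by blast
  note S = subringD[OF D]
  have Mi: "ideal M (restrict_ring R E)" "\<one> \<notin> M" using M(1) subring_maximalideal_iff[OF E] by auto
  note Md = subring_idealD[OF E Mi(1)] and Nd = subring_idealD[OF D N(1)]
  let ?M2 = "ideal_prod (restrict_ring R E) M M"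
  let ?N2 = "ideal_prod (restrict_ring R D) N N"
  let ?N3 = "ideal_prod (restrict_ring R D) N ?N2"
  have ids: "ideal ?N2 (restrict_ring R D)" "ideal ?N3 (restrict_ring R D)"
    using ring.ideal_prod_is_ideal[OF subring_is_ring[OF D]] N(1) by blast+
  note N2d = subring_idealD[OF D ids(1)] and N3d = subring_idealD[OF D ids(2)]
  have N2: "s \<otimes> t \<in> ?N2" if "s \<in> N" "t \<in> N" for s t
    using ideal_prod.prod[of s N t N "restrict_ring R D"] that by simp
  have N3: "s \<otimes> t \<in> ?N3" if "s \<in> N" "t \<in> ?N2" for s t
    using ideal_prod.prod[of s N t ?N2 "restrict_ring R D"] that by simp
  have M2i: "ideal ?M2 (restrict_ring R E)"
    using ring.ideal_prod_is_ideal[OF subring_is_ring[OF E] Mi(1) Mi(1)] .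
  note M2d = subring_idealD[OF E M2i]
  have ec: "e \<in> carrier R" "n \<in> carrier R" using S(1)[OF e(1)] Nd(2)[OF e(2)] by auto
  \<comment> \<open>One factor e for each of the two elements of \<open>M\<close> in a
    product.\<close>
  have eeM2: "(e \<otimes> e) \<otimes> z \<in> ?N2" if "z \<in> ?M2" for z
    using that
  proof (induct z rule: ideal_prod.induct)
    case (prod i j)
    have "(e \<otimes> e) \<otimes> (i \<otimes> j) = (e \<otimes> i) \<otimes> (e \<otimes> j)"
      using ec Md(2)[OF prod(1)] Md(2)[OF prod(2)] by algebra
    then show ?case using N2[OF e(4)[OF prod(1)] e(4)[OF prod(2)]] by simp
  next
    case (sum s1 s2)
    have "(e \<otimes> e) \<otimes> (s1 \<oplus> s2) = (e \<otimes> e) \<otimes> s1 \<oplus> (e \<otimes> e) \<otimes> s2"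
      using ec M2d(2)[OF sum(1)] M2d(2)[OF sum(3)] by algebra
    then show ?case using N2d(4)[OF sum(2,4)] by simp
  qed
  have main: "\<exists>r\<in>D. \<exists>z\<in>?N3. a \<otimes> b = z \<oplus> x \<otimes> r"
    if x: "x \<in> N - ?N2" and ab: "a \<in> N" "b \<in> N" for x a b
  proof -
    have xN: "x \<in> N" using x by blast
    note xc = Nd(2)[OF xN]
    have "x \<notin> ?M2"
    proof
      assume xM: "x \<in> ?M2"
      \<comment> \<open>In (n + e)^2 x the part e^2 x would be in N^2 by \<open>eeM2\<close>, and
        every other term contains nx.\<close>
      have "x = (n \<oplus> e) \<otimes> ((n \<oplus> e) \<otimes> x)" using e(3) xc by simp
      also have "\<dots> = (e \<otimes> e) \<otimes> x \<oplus> (n \<oplus> e \<oplus> e) \<otimes> (n \<otimes> x)" using ec xc by algebra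
      also have "\<dots> \<in> ?N2"
        using N2d(4)[OF eeM2[OF xM] N2d(5)[OF N2[OF e(2) xN]]] S(4) Nd(1)[OF e(2)] e(1) by simp
      finally show False using x by blast
    qed
    then have xM: "x \<in> M - ?M2" using xN N(2) by blast
    have aM: "a \<in> M" "b \<in> M" using ab N(2) by auto
    obtain r w where r: "r \<in> E" "w \<in> ?M2" "a = x \<otimes> r \<oplus> w"
      using dedekind_maximalideal_generator[OF ded M xM aM(1)] by blast
    note c = Md(2)[OF aM(2)] subringD(1)[OF E r(1)] M2d(2)[OF r(2)] Md(2)[OF aM(1)]
    \<comment> \<open>From (n + e)^3 = e^3 + kn, that is, k = n^2 + 3ne + 3e^2. Two factors e are
      spent on w in M^2 and the third on b, so that (eb)(e^2 w) lands in N^3.\<close>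
    define k where "k = n \<otimes> n \<oplus> (n \<otimes> e \<oplus> n \<otimes> e \<oplus> n \<otimes> e) \<oplus> (e \<otimes> e \<oplus> e \<otimes> e \<oplus> e \<otimes> e)"
    have kD: "k \<in> D" unfolding k_def using S(4,5) Nd(1)[OF e(2)] e(1) by simp
    have kc: "k \<in> carrier R" using S(1)[OF kD] .
    have k: "(n \<oplus> e) \<otimes> ((n \<oplus> e) \<otimes> (n \<oplus> e)) = e \<otimes> (e \<otimes> e) \<oplus> k \<otimes> n"
      unfolding k_def using ec by algebra
    have "a \<otimes> b = ((n \<oplus> e) \<otimes> ((n \<oplus> e) \<otimes> (n \<oplus> e))) \<otimes> (a \<otimes> b)" using e(3) c by simp
    also have "\<dots> = k \<otimes> (n \<otimes> (a \<otimes> b)) \<oplus> (e \<otimes> (e \<otimes> e)) \<otimes> (a \<otimes> b)"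
      unfolding k using ec kc c by algebra
    also have "(e \<otimes> (e \<otimes> e)) \<otimes> (a \<otimes> b) =
        (e \<otimes> b) \<otimes> ((e \<otimes> e) \<otimes> w) \<oplus> x \<otimes> ((e \<otimes> e) \<otimes> (e \<otimes> (r \<otimes> b)))"
      unfolding r(3) using ec c xc by algebra
    finally have eq: "a \<otimes> b = k \<otimes> (n \<otimes> (a \<otimes> b)) \<oplus>
        ((e \<otimes> b) \<otimes> ((e \<otimes> e) \<otimes> w) \<oplus> x \<otimes> ((e \<otimes> e) \<otimes> (e \<otimes> (r \<otimes> b))))" .
    have 1: "k \<otimes> (n \<otimes> (a \<otimes> b)) \<in> ?N3" using N3d(5)[OF N3[OF e(2) N2[OF ab]] kD] .
    have 2: "(e \<otimes> b) \<otimes> ((e \<otimes> e) \<otimes> w) \<in> ?N3" using N3[OF e(4)[OF aM(2)] eeM2[OF r(2)]] .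
    have 3: "(e \<otimes> e) \<otimes> (e \<otimes> (r \<otimes> b)) \<in> D"
      using S(5)[OF S(5)[OF e(1) e(1)] Nd(1)[OF e(4)[OF Md(5)[OF aM(2) r(1)]]]] .
    have "a \<otimes> b = (k \<otimes> (n \<otimes> (a \<otimes> b)) \<oplus> (e \<otimes> b) \<otimes> ((e \<otimes> e) \<otimes> w)) \<oplus> x \<otimes> ((e \<otimes> e) \<otimes> (e \<otimes> (r \<otimes> b)))"
      unfolding eq[symmetric] using N3d(2)[OF 1] N3d(2)[OF 2] S(1)[OF 3] xc
      by (subst eq) (simp add: a_assoc)
    then show ?thesis using N3d(4)[OF 1 2] 3 by blast
  qed
  show ?thesis unfolding residually_principal_def using main by simp
qed

text \<open>The pullback, with \<open>K\<^sub>i \<subseteq> E/M\<^sub>i\<close> replaced by its preimage \<open>H i\<close> in \<open>E\<close>.\<close>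

locale pullback = field R for R (structure) +
  fixes E D :: "'a set" and I :: "'i set" and M H :: "'i \<Rightarrow> 'a set"
  assumes ded: "dedekind_domain R E" and D: "subring D R" and finite: "finite I" and inj: "inj_on M I"
    and M: "\<And>i. i \<in> I \<Longrightarrow> maximalideal (M i) (restrict_ring R E)"
    and H: "\<And>i. i \<in> I \<Longrightarrow> subring (H i) R" "\<And>i. i \<in> I \<Longrightarrow> M i \<subseteq> H i" "\<And>i. i \<in> I \<Longrightarrow> H i \<subseteq> E"
    and H_unit: "\<And>i x. i \<in> I \<Longrightarrow> x \<in> H i - M i \<Longrightarrow> \<exists>y\<in>H i. \<exists>m\<in>M i. m \<oplus> x \<otimes> y = \<one>"
    and D_eq: "D = {x \<in> E. \<forall>i\<in>I. x \<in> H i}"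
begin

lemma E: "subring E R"
  using ded unfolding dedekind_domain_def quotient_field_of_iff by blast

lemma Mi: assumes "i \<in> I" shows "ideal (M i) (restrict_ring R E)" "\<one> \<notin> M i"
  using M[OF assms] subring_maximalideal_iff[OF E] by auto

lemmas Md = subring_idealD[OF E Mi(1)]
lemmas SE = subringD[OF E]
lemmas SD = subringD[OF D]

lemma DE: "D \<subseteq> E"
  unfolding D_eq by blast

text \<open>The Chinese remainder element: e is 1 modulo M i and 0 modulo the others. Each new M j
  multiplies e by some b in M j that is 1 modulo M i.\<close>

lemma separate:
  assumes "finite S" "S \<subseteq> I" "i \<in> I" "i \<notin> S"
  shows "\<exists>e\<in>E. (\<forall>j\<in>S. e \<in> M j) \<and> (\<exists>k\<in>M i. k \<oplus> e = \<one>)"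
  using assms
proof (induct S rule: finite_induct)
  case empty
  have "\<zero> \<oplus> \<one> = \<one>" by simp
  then show ?case using SE(3) Md(3)[OF empty(2)] by blast
next
  case (insert j S)
  then obtain e k where e: "e \<in> E" "\<forall>j\<in>S. e \<in> M j" "k \<in> M i" "k \<oplus> e = \<one>" by blast
  have ij: "i \<in> I" "j \<in> I" "M i \<noteq> M j" using insert inj by (auto dest: inj_onD)
  obtain a b where ab: "a \<in> M i" "b \<in> M j" "a \<oplus> b = \<one>"
    using cring.comaximal_maximalideals[OF subring_cring[OF E] M[OF ij(1)] M[OF ij(2)] ij(3)]
    unfolding comaximal_def by auto
  note c = Md(2)[OF ij(1) ab(1)] Md(2)[OF ij(2) ab(2)] SE(1)[OF e(1)] Md(2)[OF ij(1) e(3)]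
  have bE: "b \<in> E" using Md(1)[OF ij(2) ab(2)] .
  have "(k \<oplus> e \<otimes> a) \<oplus> e \<otimes> b = k \<oplus> e \<otimes> (a \<oplus> b)" using c by algebra
  also have "\<dots> = \<one>" using ab e c by simp
  finally have "(k \<oplus> e \<otimes> a) \<oplus> e \<otimes> b = \<one>" .
  moreover have "k \<oplus> e \<otimes> a \<in> M i" using Md(4)[OF ij(1) e(3) Md(5)[OF ij(1) ab(1) e(1)]] .
  moreover have "e \<otimes> b \<in> M l" if l: "l \<in> insert j S" for l
    using l Md(5)[OF ij(2) ab(2) e(1)] Md(6)[of l e b] e(2) bE insert(4) by auto
  ultimately show ?case using SE(5)[OF e(1) bE] by blast
qed

section \<open>Maximal ideals of the pullback and of the Dedekind domain\<close>

abbreviation "J \<equiv> {x \<in> E. \<forall>i\<in>I. x \<in> M i}"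

lemma J_subset: "J \<subseteq> D"
  unfolding D_eq using H(2) by blast

lemma J_mult: "x \<in> J \<Longrightarrow> y \<in> E \<Longrightarrow> x \<otimes> y \<in> J"
  using Md(6) SE(5) by simp

text \<open>P and Q agree once e is inverted, and e is 1 modulo P; this is the local comparison that
  carries the condition from Q to P.\<close>

definition lifted :: "'a set \<Rightarrow> 'a set \<Rightarrow> bool" where
  "lifted P Q \<longleftrightarrow> maximalideal P (restrict_ring R D) \<and> maximalideal Q (restrict_ring R E) \<and> P \<subseteq> Q \<and>
     (\<exists>e\<in>D. \<exists>k\<in>P. k \<oplus> e = \<one> \<and> (\<forall>t\<in>Q. e \<otimes> t \<in> P))"

text \<open>A prime containing the finite intersection J contains the contraction of some M i. An e
  in D that is 1 modulo M i and 0 modulo the other M j satisfies e M i <= J <= P.\<close>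

lemma lift_over_J:
  assumes P: "primeideal P (restrict_ring R D)" and J: "J \<subseteq> P"
  shows "\<exists>Q. lifted P Q"
proof -
  note Pd = subring_primeidealD[OF D P]
  note Pi = subring_idealD[OF D Pd(1)]
  have "\<exists>i\<in>I. \<forall>x\<in>D. x \<in> M i \<longrightarrow> x \<in> P"
  proof (rule ccontr)
    assume *: "\<not> ?thesis"
    \<comment> \<open>Otherwise elements of M j outside the prime \<open>P\<close> could be
      multiplied to give an element of \<open>J\<close> outside \<open>P\<close>.\<close>
    have "\<exists>x\<in>D - P. \<forall>i\<in>S. x \<in> M i" if "finite S" "S \<subseteq> I" for S
      using that
    proof (induct S rule: finite_induct)
      case empty
      then show ?case using SD(3) Pd(2) by blast
    next
      case (insert j S)
      obtain x where x: "x \<in> D - P" "\<forall>i\<in>S. x \<in> M i" using insert by blast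
      obtain y where y: "y \<in> D - P" "y \<in> M j" using * insert(4) by blast
      have E: "x \<in> E" "y \<in> E" using x y DE by auto
      have "x \<otimes> y \<in> D - P" using SD(5)[of x y] Pd(3)[of x y] x y by blast
      moreover have "x \<otimes> y \<in> M i" if "i \<in> insert j S" for i
        using that Md(5)[of j y x] Md(6)[of i x y] x y E insert(4) by auto
      ultimately show ?case by blast
    qed
    then obtain x where "x \<in> D - P" "\<forall>i\<in>I. x \<in> M i" using finite by blast
    then show False using J DE by blast
  qed
  then obtain i where i: "i \<in> I" "\<And>x. x \<in> D \<Longrightarrow> x \<in> M i \<Longrightarrow> x \<in> P" by blast
  note Mii = Md[OF i(1)]
  obtain e k where e: "e \<in> E" "\<forall>j\<in>I - {i}. e \<in> M j" "k \<in> M i" "k \<oplus> e = \<one>"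
    using separate[of "I - {i}" i] finite i(1) by blast
  have ec: "e \<in> carrier R" "k \<in> carrier R" using SE(1)[OF e(1)] Mii(2)[OF e(3)] by auto
  have minus: "s = \<one> \<oplus> \<ominus> t" "t = \<one> \<oplus> \<ominus> s" if "s \<oplus> t = \<one>" "s \<in> carrier R" "t \<in> carrier R" for s t
    unfolding that(1)[symmetric] using that(2,3) by algebra+
  have eH: "e \<in> H i"
    using minus(2)[OF e(4) ec(2,1)] H(1,2)[OF i(1)] e(3) subringD(3,4,6)[of "H i"] by auto
  \<comment> \<open>Multiplication by e makes an element of \<open>H i\<close> vanish modulo the
    other M j without changing its class modulo \<open>M i\<close>, so it meets all conditions of
    the pullback.\<close>
  have in_D: "y \<otimes> e \<in> D" if y: "y \<in> H i" for y
  proof -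
    have yE: "y \<in> E" using y H(3)[OF i(1)] by blast
    have "y \<otimes> e \<in> H j" if j: "j \<in> I" for j
    proof (cases "j = i")
      case True
      then show ?thesis using subringD(5)[OF H(1)[OF i(1)] y eH] by simp
    next
      case False
      then show ?thesis using Md(5)[OF j _ yE, of e] e(2) H(2)[OF j] j by blast
    qed
    then show ?thesis unfolding D_eq using SE(5)[OF yE e(1)] by blast
  qed
  have eD: "e \<in> D" using in_D[OF subringD(3)[OF H(1)[OF i(1)]]] ec by simp
  have kP: "k \<in> P" using i(2)[OF _ e(3)] minus(1)[OF e(4) ec(2,1)] SD(3,4,6) eD by simp
  \<comment> \<open>The inverse supplied by \<open>H_unit\<close> is moved into \<open>D\<close> by
    e, and k makes up for the difference between e and 1.\<close>
  have unit: "\<exists>y\<in>D. \<exists>n\<in>P. n \<oplus> x \<otimes> y = \<one>" if x: "x \<in> D - M i" for x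
  proof -
    have xH: "x \<in> H i - M i" using x i(1) unfolding D_eq by blast
    obtain y m where y: "y \<in> H i" "m \<in> M i" "m \<oplus> x \<otimes> y = \<one>" using H_unit[OF i(1) xH] by blast
    have c: "y \<in> carrier R" "m \<in> carrier R" "x \<in> carrier R"
      using subringD(1)[OF H(1)[OF i(1)]] y(1) xH Mii(2)[OF y(2)] by auto
    define n where "n = k \<oplus> m \<otimes> e"
    have nM: "n \<in> M i" unfolding n_def using Mii(4)[OF e(3) Mii(6)[OF y(2) e(1)]] .
    have yD: "y \<otimes> e \<in> D" using in_D[OF y(1)] .
    have "n \<oplus> x \<otimes> (y \<otimes> e) = k \<oplus> (m \<oplus> x \<otimes> y) \<otimes> e" unfolding n_def using c ec by algebra
    also have "\<dots> = \<one>" using y e ec by simp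
    finally have n: "n \<oplus> x \<otimes> (y \<otimes> e) = \<one>" .
    have "n = \<one> \<oplus> \<ominus> (x \<otimes> (y \<otimes> e))" using minus(1)[OF n] Mii(2)[OF nM] c ec by simp
    then have "n \<in> D" using SD(3,4,5,6) x yD by simp
    then show ?thesis using i(2) nM n yD by blast
  qed
  have PM: "P \<subseteq> M i"
  proof
    fix x assume x: "x \<in> P"
    show "x \<in> M i"
    proof (rule ccontr)
      assume "x \<notin> M i"
      then obtain y n where "y \<in> D" "n \<in> P" "n \<oplus> x \<otimes> y = \<one>" using unit Pi(1)[OF x] by blast
      then show False using Pi(4,6) x Pd(2) by metis
    qed
  qed
  have "maximalideal P (restrict_ring R D)"
    unfolding subring_maximalideal_iff[OF D] using Pd(1,2) unit i(2) by blast
  moreover have "e \<otimes> t \<in> P" if t: "t \<in> M i" for t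
  proof -
    have tE: "t \<in> E" using Mii(1)[OF t] .
    have "e \<otimes> t \<in> M j" if j: "j \<in> I" for j
      using Mii(5)[OF t e(1)] Md(6)[OF j _ tE, of e] e(2) j by (cases "j = i") auto
    then have "e \<otimes> t \<in> J" using SE(5)[OF e(1) tE] by blast
    then show ?thesis using J by blast
  qed
  ultimately show ?thesis unfolding lifted_def using M[OF i(1)] PM eD kP e(4) by blast
qed

text \<open>An e in J - P satisfies eE <= D. Thus D and E become equal once e is inverted, and P
  corresponds to a prime of E.\<close>

lemma lift_not_over_J:
  assumes P: "primeideal P (restrict_ring R D)" "P \<noteq> {\<zero>}" and J: "\<not> J \<subseteq> P"
  shows "\<exists>Q. lifted P Q"
proof -
  note Pd = subring_primeidealD[OF D P(1)]
  note Pi = subring_idealD[OF D Pd(1)]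
  obtain e where e: "e \<in> J" "e \<notin> P" using J by blast
  have eD: "e \<in> D" "e \<in> E" "e \<in> carrier R" using e J_subset DE SD(1) by auto
  have eJ: "e \<otimes> x \<in> D" if "x \<in> E" for x using J_mult[OF e(1) that] J_subset by blast
  \<comment> \<open>The contraction to \<open>E\<close> of P after inverting e; by
    \<open>cancel\<close>, one factor e suffices in place of an arbitrary power.\<close>
  define Q where "Q = {x \<in> E. e \<otimes> x \<in> P}"
  have cancel: "x \<in> P" if "x \<in> D" "e \<otimes> x \<in> P" for x using Pd(3)[OF eD(1)] that e(2) by blast
  have Qi: "ideal Q (restrict_ring R E)"
  proof (rule subring_idealI[OF E])
    show "\<zero> \<in> Q" unfolding Q_def using SE(2) Pi(3) eD by simp
    show "x \<oplus> y \<in> Q" if "x \<in> Q" "y \<in> Q" for x y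
      using that SE(1,4) Pi(4) eD(3) unfolding Q_def by (simp add: r_distr)
    show "x \<otimes> y \<in> Q" if x: "x \<in> E" and y: "y \<in> Q" for x y
    proof -
      have yE: "y \<in> E" "e \<otimes> y \<in> P" using y unfolding Q_def by auto
      have "e \<otimes> (e \<otimes> (x \<otimes> y)) = (e \<otimes> x) \<otimes> (e \<otimes> y)"
        using eD(3) SE(1)[OF x] SE(1)[OF yE(1)] by algebra
      then have "e \<otimes> (e \<otimes> (x \<otimes> y)) \<in> P" using Pi(5)[OF yE(2) eJ[OF x]] by simp
      then have "e \<otimes> (x \<otimes> y) \<in> P" using cancel[OF eJ[OF SE(5)[OF x yE(1)]]] by blast
      then show ?thesis unfolding Q_def using SE(5)[OF x yE(1)] by blast
    qed
  qed (simp add: Q_def)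
  have QD: "x \<in> P" if "x \<in> Q" "x \<in> D" for x using cancel that unfolding Q_def by blast
  have PQ: "P \<subseteq> Q" unfolding Q_def using Pi(1,5) eD(1) DE by blast
  have prime: "primeideal Q (restrict_ring R E)"
    unfolding subring_primeideal_iff[OF E]
  proof (intro conjI ballI impI Qi)
    show "\<one> \<notin> Q" unfolding Q_def using e(2) eD by simp
    fix x y assume x: "x \<in> E" and y: "y \<in> E" and xy: "x \<otimes> y \<in> Q"
    have "(e \<otimes> x) \<otimes> (e \<otimes> y) = e \<otimes> (e \<otimes> (x \<otimes> y))"
      using eD(3) SE(1)[OF x] SE(1)[OF y] by algebra
    then have "(e \<otimes> x) \<otimes> (e \<otimes> y) \<in> P" using xy Pi(5) eD(1) unfolding Q_def by simp
    then show "x \<in> Q \<or> y \<in> Q" using Pd(3)[OF eJ[OF x] eJ[OF y]] x y unfolding Q_def by blast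
  qed
  have "Q \<noteq> {\<zero>}" using PQ P(2) Pi(3) by blast
  then have max: "maximalideal Q (restrict_ring R E)" using prime ded unfolding dedekind_domain_def by blast
  \<comment> \<open>If y inverts xe modulo \<open>Q\<close>, then ey lies in \<open>D\<close> and
    inverts x; the error term is in both \<open>Q\<close> and \<open>D\<close>, hence in
    \<open>P\<close>.\<close>
  have unit: "\<exists>y\<in>D. \<exists>n\<in>P. n \<oplus> x \<otimes> y = \<one>" if x: "x \<in> D - P" for x
  proof -
    have xe: "x \<otimes> e \<in> D" "x \<otimes> e \<notin> P" using SD(5)[of x e] Pd(3)[of x e] x eD(1) e(2) by blast+
    then have "x \<otimes> e \<in> E - Q" using QD DE by blast
    then obtain y q where y: "y \<in> E" "q \<in> Q" "q \<oplus> x \<otimes> e \<otimes> y = \<one>"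
      using max unfolding subring_maximalideal_iff[OF E] by blast
    have c: "q \<in> carrier R" "y \<in> carrier R" "x \<in> carrier R"
      using subring_idealD(2)[OF E Qi y(2)] SE(1)[OF y(1)] SD(1) x by auto
    have q: "q \<oplus> x \<otimes> (e \<otimes> y) = \<one>" using y(3) c eD(3) by (simp add: m_assoc)
    then have "q = \<one> \<oplus> \<ominus> (x \<otimes> (e \<otimes> y))" unfolding q[symmetric] using c eD(3) by algebra
    moreover have "\<one> \<oplus> \<ominus> (x \<otimes> (e \<otimes> y)) \<in> D" using SD(3-6) x eJ[OF y(1)] by simp
    ultimately have "q \<in> P" using QD y(2) by simp
    then show ?thesis using eJ[OF y(1)] q by blast
  qed
  have maxP: "maximalideal P (restrict_ring R D)"
    unfolding subring_maximalideal_iff[OF D] using Pd(1,2) unit by blast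
  \<comment> \<open>The element e need not be 1 modulo \<open>P\<close>; multiplying it by an
    inverse d corrects this.\<close>
  obtain d k where d: "d \<in> D" "k \<in> P" "k \<oplus> e \<otimes> d = \<one>" using unit eD(1) e(2) by blast
  have "(e \<otimes> d) \<otimes> t \<in> P" if t: "t \<in> Q" for t
  proof -
    have "(e \<otimes> d) \<otimes> t = d \<otimes> (e \<otimes> t)"
      using eD(3) SD(1)[OF d(1)] subring_idealD(2)[OF E Qi t] by algebra
    then show ?thesis using Pi(5) d(1) t unfolding Q_def by simp
  qed
  then show ?thesis unfolding lifted_def using maxP max PQ d SD(5)[OF eD(1) d(1)] by blast
qed

theorem TAF_domain_pullback:
  assumes noeth: "noetherian_domain (restrict_ring R D)"
  shows "TAF_domain (restrict_ring R D)"
proof (rule noetherian_domain.TAF_domain_if_residually_principal[OF noeth])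
  have lift: "\<exists>Q. lifted P Q" if "primeideal P (restrict_ring R D)" "P \<noteq> {\<zero>}" for P
    using lift_over_J[OF that(1)] lift_not_over_J[OF that] by blast
  fix P assume P0: "P \<noteq> {\<zero>\<^bsub>restrict_ring R D\<^esub>}"
  then have P0: "P \<noteq> {\<zero>}" by simp
  show "maximalideal P (restrict_ring R D)" if "primeideal P (restrict_ring R D)"
    using lift[OF that P0] unfolding lifted_def by blast
  assume P: "maximalideal P (restrict_ring R D)"
  have Pi: "ideal P (restrict_ring R D)" using P subring_maximalideal_iff[OF D] by blast
  obtain Q e k where Q: "maximalideal Q (restrict_ring R E)" "P \<subseteq> Q"
    and e: "e \<in> D" "k \<in> P" "k \<oplus> e = \<one>" "\<And>t. t \<in> Q \<Longrightarrow> e \<otimes> t \<in> P"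
    using lift[OF subring_maximalideal_prime[OF D P] P0] unfolding lifted_def by blast
  have "Q \<noteq> {\<zero>}" using Q(2) P0 subring_idealD(3)[OF D Pi] by blast
  then show "residually_principal (restrict_ring R D) P"
    using residually_principal_descend[OF D ded DE Q(1) _ Pi Q(2) e] by blast
qed

end

section \<open>From pseudo-valuation domains to pullbacks\<close>

text \<open>An inverse e of x modulo M exists in E and is integral over D. Multiplying its equation
  of degree k by x^k turns it into 1 + xd = 0 modulo M with d in D, so -d is an inverse in
  D.\<close>

lemma (in field) integral_unit_mod_maximal:
  assumes D: "subring D R" and E: "subring E R" "D \<subseteq> E" "E \<subseteq> integral_closure R D"
    and M: "maximalideal M (restrict_ring R E)" and x: "x \<in> D - M"
  shows "\<exists>y\<in>D. \<exists>k\<in>M. k \<oplus> x \<otimes> y = \<one>"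
proof -
  note S = subringD[OF D] and SE = subringD[OF E(1)]
  have Mi: "ideal M (restrict_ring R E)" using M subring_maximalideal_iff[OF E(1)] by blast
  note Md = subring_idealD[OF E(1) Mi]
  have xD: "x \<in> D" "x \<in> E" "x \<in> carrier R" using x E(2) S(1) by auto
  obtain e n where e: "e \<in> E" "n \<in> M" "n \<oplus> x \<otimes> e = \<one>"
    using M x E(2) unfolding subring_maximalideal_iff[OF E(1)] by blast
  note ec = SE(1)[OF e(1)] and nc = Md(2)[OF e(2)]
  have xe: "x \<otimes> e = \<one> \<oplus> \<ominus> n" unfolding e(3)[symmetric] using ec nc xD by algebra
  have "e \<in> integral_closure R D" using e(1) E(3) by blast
  then obtain q where q: "set q \<subseteq> D" "e [^] length q \<oplus> eval q e = \<zero>" by (rule integral_closureE[OF D])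
  have "\<exists>d\<in>D. \<exists>z\<in>M. x [^] length q \<otimes> (e [^] length q \<oplus> eval q e) = \<one> \<oplus> x \<otimes> d \<oplus> z"
    using q(1)
  proof (induct q rule: rev_induct)
    case Nil
    have "\<one> \<otimes> (\<one> \<oplus> \<zero>) = \<one> \<oplus> x \<otimes> \<zero> \<oplus> \<zero>" using xD by simp
    then show ?case using S(2) Md(3) by auto
  next
    case (snoc d q)
    have qc: "set q \<subseteq> carrier R" "d \<in> carrier R" "d \<in> D" using snoc(2) S(1) by auto
    obtain d' z where z: "d' \<in> D" "z \<in> M"
      "x [^] length q \<otimes> (e [^] length q \<oplus> eval q e) = \<one> \<oplus> x \<otimes> d' \<oplus> z"
      using snoc by auto
    note c = Md(2)[OF z(2)] S(1)[OF z(1)] nat_pow_closed[OF xD(3), of "length q"]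
      nat_pow_closed[OF ec, of "length q"] eval_in_carrier[OF qc(1) ec]
    let ?u = "\<one> \<oplus> x \<otimes> d' \<oplus> z"
    have "x [^] length (q @ [d]) \<otimes> (e [^] length (q @ [d]) \<oplus> eval (q @ [d]) e) =
      (x [^] length q \<otimes> x) \<otimes> (e [^] length q \<otimes> e \<oplus> (e \<otimes> eval q e \<oplus> d))"
      unfolding eval_snoc[OF qc(1,2) ec] by simp
    also have "\<dots> = (x \<otimes> e) \<otimes> (x [^] length q \<otimes> (e [^] length q \<oplus> eval q e)) \<oplus> x \<otimes> (x [^] length q \<otimes> d)"
      using c xD ec qc by algebra
    also have "\<dots> = \<one> \<oplus> x \<otimes> (d' \<oplus> x [^] length q \<otimes> d) \<oplus> (z \<oplus> \<ominus> (?u \<otimes> n))"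
      unfolding xe z(3) using c xD nc qc by algebra
    finally have "x [^] length (q @ [d]) \<otimes> (e [^] length (q @ [d]) \<oplus> eval (q @ [d]) e) =
      \<one> \<oplus> x \<otimes> (d' \<oplus> x [^] length q \<otimes> d) \<oplus> (z \<oplus> \<ominus> (?u \<otimes> n))" .
    moreover have "d' \<oplus> x [^] length q \<otimes> d \<in> D"
      using S(4,5) z(1) subring_pow_closed[OF D xD(1)] qc(3) by blast
    moreover have "?u \<in> E" using SE(3,4,5) xD(2) E(2) z(1) Md(1)[OF z(2)] by auto
    then have "z \<oplus> \<ominus> (?u \<otimes> n) \<in> M" using Md(4)[OF z(2) Md(7)[OF Md(5)[OF e(2)]]] by blast
    ultimately show ?case by blast
  qed
  then obtain d z where d: "d \<in> D" "z \<in> M" "x [^] length q \<otimes> \<zero> = \<one> \<oplus> x \<otimes> d \<oplus> z" using q(2) by auto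
  note c = S(1)[OF d(1)] Md(2)[OF d(2)]
  have 0: "\<one> \<oplus> x \<otimes> d \<oplus> z = \<zero>" using d(3) xD by simp
  have "\<ominus> z \<oplus> x \<otimes> (\<ominus> d) = \<one> \<oplus> \<ominus> (\<one> \<oplus> x \<otimes> d \<oplus> z)" using c xD by algebra
  then have "\<ominus> z \<oplus> x \<otimes> (\<ominus> d) = \<one>" unfolding 0 by simp
  then show ?thesis using S(6)[OF d(1)] Md(7)[OF d(2)] by blast
qed

section \<open>Maximal ideals and residue fields of the overring\<close>

lemma (in ring) prime_supset_prod_list:
  assumes "primeideal M R" "\<And>P. P \<in> set Ps \<Longrightarrow> ideal P R" "ideal_prod_list R Ps \<subseteq> M"
  shows "\<exists>P\<in>set Ps. P \<subseteq> M"
  using assms(2,3)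
proof (induct Ps)
  case Nil
  then show ?case
    using primeideal.I_notcarr[OF assms(1)] idealD(1)[OF primeideal.axioms(1)[OF assms(1)]] by auto
next
  case (Cons P Ps)
  have "ideal (ideal_prod_list R Ps) R" using Cons(2) by (intro ideal_ideal_prod_list) auto
  then have "P \<subseteq> M \<or> ideal_prod_list R Ps \<subseteq> M"
    using primeideal_divides_ideal_prod[OF assms(1)] Cons(2,3) by auto
  then show ?case using Cons by auto
qed

text \<open>I contains a product of finitely many nonzero primes. A maximal ideal over I contains
  one of them and equals it, because they are maximal themselves.\<close>

lemma (in field) finite_maximalideals_over:
  assumes ded: "dedekind_domain R E" and I: "ideal I (restrict_ring R E)" "I \<noteq> {\<zero>}"
  shows "finite {M. maximalideal M (restrict_ring R E) \<and> I \<subseteq> M}"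
proof -
  have qf: "quotient_field_of R E" and noeth: "noetherian_domain (restrict_ring R E)"
    and dim: "\<And>P. primeideal P (restrict_ring R E) \<Longrightarrow> P \<noteq> {\<zero>} \<Longrightarrow> maximalideal P (restrict_ring R E)"
    using ded unfolding dedekind_domain_def by blast+
  have E: "subring E R" using qf quotient_field_of_iff by blast
  obtain Ps where Ps: "\<And>P. P \<in> set Ps \<Longrightarrow> primeideal P (restrict_ring R E) \<and> P \<noteq> {\<zero>}"
    "ideal_prod_list (restrict_ring R E) Ps \<subseteq> I"
    using noetherian_domain.ideal_supset_prod_primes[OF noeth I(1)] I(2) by auto
  have "{M. maximalideal M (restrict_ring R E) \<and> I \<subseteq> M} \<subseteq> set Ps"
  proof
    fix M assume "M \<in> {M. maximalideal M (restrict_ring R E) \<and> I \<subseteq> M}"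
    then have M: "maximalideal M (restrict_ring R E)" "I \<subseteq> M" by auto
    have "\<exists>P\<in>set Ps. P \<subseteq> M"
    proof (rule ring.prime_supset_prod_list[OF subring_is_ring[OF E] subring_maximalideal_prime[OF E M(1)]])
      show "ideal P (restrict_ring R E)" if "P \<in> set Ps" for P
        using Ps(1)[OF that] primeideal.axioms(1) by blast
    qed (use Ps(2) M(2) in blast)
    then obtain P where P: "P \<in> set Ps" "P \<subseteq> M" by blast
    have Mi: "ideal M (restrict_ring R E)" "\<one> \<notin> M" using M(1) subring_maximalideal_iff[OF E] by auto
    have "maximalideal P (restrict_ring R E)" using Ps(1)[OF P(1)] dim by blast
    then have "M = P \<or> M = E"
      using maximalideal.I_maximal[OF _ Mi(1) P(2)] subring_idealD(1)[OF E Mi(1)] by auto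
    then show "M \<in> set Ps" using P(1) Mi(2) subringD(3)[OF E] by blast
  qed
  then show ?thesis using finite_subset by blast
qed

text \<open>The ideal cE of D is finitely generated, so E is a finitely generated D-module, and the
  classes of its generators span E/M over the image of D. That image is a field by
  integrality.\<close>

lemma (in field) finite_subextension_image:
  assumes noeth: "noetherian_domain (restrict_ring R D)"
    and D: "subring D R" and E: "subring E R" "D \<subseteq> E" "E \<subseteq> integral_closure R D"
    and c: "c \<in> carrier R" "c \<noteq> \<zero>" "\<And>y. y \<in> E \<Longrightarrow> c \<otimes> y \<in> D"
    and M: "maximalideal M (restrict_ring R E)"
  shows "finite_subextension ((\<lambda>d. M +>\<^bsub>restrict_ring R E\<^esub> d) ` D) (restrict_ring R E Quot M)"
proof -
  let ?S = "restrict_ring R E"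
  let ?F = "?S Quot M"
  let ?h = "(+>\<^bsub>?S\<^esub>) M"
  let ?L = "?h ` D"
  have Mi: "ideal M ?S" using M subring_maximalideal_iff[OF E(1)] by blast
  note Md = subring_idealD[OF E(1) Mi]
  note S = subringD[OF D] and SE = subringD[OF E(1)]
  interpret F: field ?F using maximalideal.quotient_is_field[OF M subring_cring[OF E(1)]] .
  interpret h: ring_hom_ring ?S ?F ?h using ideal.rcos_ring_hom_ring[OF Mi] .
  have h0: "?h x = \<zero>\<^bsub>?F\<^esub>" if "x \<in> M" for x
    using ring.a_rcos_zero[OF subring_is_ring[OF E(1)] Mi that] by (simp add: FactRing_def)
  have "subring D ?S"
    using ring.subring_iff[OF subring_is_ring[OF E(1)], of D] E(2) subring_is_ring[OF D] by simp
  then have Lring: "subring ?L ?F" by (rule h.img_is_subring)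
  have L: "subfield ?L ?F"
  proof (rule F.subfieldI'[OF Lring])
    fix k assume "k \<in> ?L - {\<zero>\<^bsub>?F\<^esub>}"
    then obtain x where x: "x \<in> D" "k = ?h x" "x \<notin> M" using h0 by auto
    obtain y n where y: "y \<in> D" "n \<in> M" "n \<oplus> x \<otimes> y = \<one>"
      using integral_unit_mod_maximal[OF D E M] x by blast
    have xyE: "x \<in> E" "y \<in> E" "n \<in> E" "x \<otimes> y \<in> E" 
      using x(1) y(1) E(2) Md(1)[OF y(2)] SE(5)[of x y] by auto
    have "\<one>\<^bsub>?F\<^esub> = ?h (n \<oplus> x \<otimes> y)" using h.hom_one y(3) by simp
    also have "\<dots> = ?h n \<oplus>\<^bsub>?F\<^esub> ?h (x \<otimes> y)" using h.hom_add[of n "x \<otimes> y"] xyE by simp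
    also have "\<dots> = ?h (x \<otimes> y)" using h0[OF y(2)] h.hom_closed[of "x \<otimes> y"] xyE(4) F.l_zero by simp
    also have "\<dots> = ?h x \<otimes>\<^bsub>?F\<^esub> ?h y" using h.hom_mult[of x y] xyE by simp
    finally have 1: "k \<otimes>\<^bsub>?F\<^esub> ?h y = \<one>\<^bsub>?F\<^esub>" using x(2) by simp
    have cl: "k \<in> carrier ?F" "?h y \<in> carrier ?F" using x(2) h.hom_closed xyE by auto
    have "?h y = inv\<^bsub>?F\<^esub> k"
      using F.inv_unique'[OF cl 1] 1 F.m_comm[OF cl] by simp
    then show "inv\<^bsub>?F\<^esub> k \<in> ?L" using y(1) by auto
  qed
  have cE: "ideal ((\<lambda>y. c \<otimes> y) ` E) (restrict_ring R D)"
    by (rule ideal_of_scaled_submodule[OF D E(1,2) c(1,3)]) (use SE(2,4,5) E(2) in auto)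
  obtain A where A: "A \<subseteq> D" "finite A" "(\<lambda>y. c \<otimes> y) ` E = genideal (restrict_ring R D) A"
    using noetherian_ring.finetely_gen[OF noetherian_domain.axioms(1)[OF noeth] cE] by auto
  have "A \<subseteq> (\<lambda>y. c \<otimes> y) ` E"
    unfolding A(3) using ring.genideal_self[OF subring_is_ring[OF D], of A] A(1) by simp
  then obtain B where B: "B \<subseteq> E" "finite B" "A = (\<lambda>y. c \<otimes> y) ` B"
    using finite_subset_image[OF A(2)] by blast
  obtain us where us: "set us = B" using finite_list[OF B(2)] by blast
  let ?hs = "map ?h us"
  have hs: "set ?hs \<subseteq> carrier ?F" using B(1) us h.hom_closed by auto
  interpret sub: subalgebra ?L "F.Span ?L ?hs" ?F using F.Span_is_subalgebra[OF L hs] .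
  \<comment> \<open>The elements with class in the span form a D-submodule containing the
    generators. Scaled by c it becomes an ideal of \<open>D\<close>, which therefore contains all of
    cE.\<close>
  define W where "W = {w \<in> E. ?h w \<in> F.Span ?L ?hs}"
  have "ideal ((\<lambda>y. c \<otimes> y) ` W) (restrict_ring R D)"
  proof (rule ideal_of_scaled_submodule[OF D E(1,2) c(1,3)])
    show "W \<subseteq> E" unfolding W_def by blast
    show "\<zero> \<in> W" unfolding W_def using h0[OF Md(3)] SE(2) sub.one_closed by simp
    show "a \<oplus> b \<in> W" if "a \<in> W" "b \<in> W" for a b
      using that h.hom_add[of a b] SE(4) sub.m_closed[of "?h a" "?h b"] unfolding W_def by simp
    show "a \<otimes> b \<in> W" if "a \<in> D" "b \<in> W" for a b
      using that h.hom_mult[of a b] SE(5) E(2) sub.smult_closed[of "?h a" "?h b"]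
      unfolding W_def by auto
  qed
  moreover have "B \<subseteq> W"
    unfolding W_def using B(1) F.Span_base_incl[OF L hs] us by auto
  then have "A \<subseteq> (\<lambda>y. c \<otimes> y) ` W" using B(3) by blast
  ultimately have cEW: "(\<lambda>y. c \<otimes> y) ` E \<subseteq> (\<lambda>y. c \<otimes> y) ` W"
    unfolding A(3) using ring.genideal_minimal[OF subring_is_ring[OF D]] by blast
  have EW: "E \<subseteq> W"
  proof
    fix x assume x: "x \<in> E"
    then obtain w where w: "w \<in> W" "c \<otimes> x = c \<otimes> w" using cEW by blast
    then have "x = w" using m_lcancel[OF c(2,1)] SE(1) x unfolding W_def by simp
    then show "x \<in> W" using w by simp
  qed
  have "carrier ?F = ?h ` E" unfolding FactRing_def A_RCOSETS_def' by auto
  then have "carrier ?F \<subseteq> F.Span ?L ?hs" using EW unfolding W_def by auto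
  then have "F.Span ?L ?hs = carrier ?F" using sub.subset by auto
  then have "F.finite_dimension ?L (carrier ?F)" using F.Span_finite_dimension[OF L hs] by simp
  then show ?thesis unfolding finite_subextension_def using L F.field_axioms by blast
qed

section \<open>The conductor and the localizations at primes over it\<close>

context noetherian_with_conductor
begin

abbreviation "f \<equiv> conductor R D D'"

lemma f_iff: "x \<in> f \<longleftrightarrow> x \<in> D \<and> (\<forall>y\<in>D'. x \<otimes> y \<in> D)"
  unfolding conductor_def colon_def by blast

lemma c_in_f: "c \<in> f"
  unfolding f_iff using c by blast

text \<open>For e in D' and x in f, (ex)y = x(ey). As an ideal of D', the conductor has only
  finitely many maximal ideals of D' above it.\<close>

lemma f_ideal: "ideal f (restrict_ring R D')"
proof (rule subring_idealI[OF D'(1)])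
  note S = subringD[OF D] and S' = subringD[OF D'(1)]
  show "x \<in> D'" if "x \<in> f" for x using that D'(2) unfolding f_iff by blast
  show "\<zero> \<in> f" unfolding f_iff using S(2) S'(1) by simp
  show "x \<oplus> y \<in> f" if "x \<in> f" "y \<in> f" for x y
    using that S(1,4) S'(1) unfolding f_iff by (simp add: l_distr)
  show "e \<otimes> x \<in> f" if e: "e \<in> D'" and x: "x \<in> f" for e x
  proof -
    have xc: "x \<in> carrier R" "e \<in> carrier R" using x e S(1) S'(1) unfolding f_iff by auto
    have "(e \<otimes> x) \<otimes> y \<in> D" if y: "y \<in> D'" for y
    proof -
      have "(e \<otimes> x) \<otimes> y = x \<otimes> (e \<otimes> y)" using xc S'(1)[OF y] by algebra
      then show ?thesis using x S'(5)[OF e y] unfolding f_iff by simp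
    qed
    moreover have "e \<otimes> x \<in> D" using x e xc m_comm unfolding f_iff by auto
    ultimately show ?thesis unfolding f_iff by blast
  qed
qed

lemma max_V_contraction:
  assumes pvd: "pseudo_valuation_domain R (localization R D N)"
    and N: "primeideal N (restrict_ring R D)" "f \<subseteq> N" and ded: "dedekind_domain R D'"
  shows "\<exists>Q. maximalideal Q (restrict_ring R D') \<and> f \<subseteq> Q \<and> Q \<subseteq> localization R D N"
proof -
  interpret L: localization_at_prime R D N by (intro localization_at_prime.intro localization_at_prime_axioms.intro field_axioms D N(1))
  let ?A = "localization R D N" and ?m = "localization_ideal R D N"
  have cm: "c \<in> ?m" using c_in_f N(2) L.N_subset by blast
  obtain m' where m': "local_ring_with (restrict_ring R ?A) m'"
    "field (restrict_ring R ?A) \<or> valuation_domain R (colon R (carrier R) m' m') \<and>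
      local_ring_with (R\<lparr>carrier := colon R (carrier R) m' m'\<rparr>) m'"
    using pvd unfolding pseudo_valuation_domain_def Let_def by blast
  have eq: "m' = ?m" using m'(1) L.local_A unfolding local_ring_with_def by blast
  \<comment> \<open>The nonzero c lies in N and is a nonunit of the localization, which excludes the
    field case of a pseudo-valuation domain.\<close>
  have "\<not> field (restrict_ring R ?A)"
  proof
    assume "field (restrict_ring R ?A)"
    then interpret F: field "restrict_ring R ?A" .
    have "c \<in> Units (restrict_ring R ?A)"
      using F.field_Units c(1,2) L.D_subset by auto
    then obtain a where "a \<in> ?A" "a \<otimes> c = \<one>" unfolding Units_def by auto
    then show False using subring_idealD(5)[OF L.A L.m(1) cm] L.m(2) by metis
  qed
  then have val: "valuation_domain R (colon R (carrier R) ?m ?m)"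
    and loc: "local_ring_with (R\<lparr>carrier := colon R (carrier R) ?m ?m\<rparr>) ?m"
    using m'(2) eq by auto
  define V where "V = colon R (carrier R) ?m ?m"
  have V: "subring V R" using val unfolding V_def valuation_domain_def quotient_field_of_iff by blast
  have max: "maximalideal ?m (restrict_ring R V)" using loc unfolding V_def local_ring_with_def by blast
  have mV: "ideal ?m (restrict_ring R V)" using max subring_maximalideal_iff[OF V] by blast
  note mVd = subring_idealD[OF V mV]
  have AV: "?A \<subseteq> V"
    unfolding V_def colon_def using subring_idealD(5)[OF L.A L.m(1)] subringD(1)[OF L.A] by blast
  have DV: "D \<subseteq> V" using L.D_subset AV by blast
  \<comment> \<open>Valuation rings are integrally closed: for y outside V the inverse lies in V and
    is a nonunit, so y cannot be integral over \<open>D\<close>.\<close>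
  have D'V: "D' \<subseteq> V"
  proof
    fix y assume y: "y \<in> D'"
    show "y \<in> V"
    proof (rule ccontr)
      assume yV: "y \<notin> V"
      have yc: "y \<in> carrier R" "y \<noteq> \<zero>"
        using y subringD(1)[OF D'(1)] yV subringD(2)[OF V] by auto
      note iy = inv_nonzero[OF yc]
      have iV: "inv y \<in> V" using val yc yV unfolding valuation_domain_def V_def[symmetric] by blast
      \<comment> \<open>If not, some multiple u = y^-1 v with v in V is 1 modulo m. As m lies in the
        localization, u is a unit there, and y = v u^-1 would be in V.\<close>
      have "inv y \<in> ?m"
      proof (rule ccontr)
        assume "inv y \<notin> ?m"
        then obtain v k where v: "v \<in> V" "k \<in> ?m" "k \<oplus> inv y \<otimes> v = \<one>"
          using max iV unfolding subring_maximalideal_iff[OF V] by blast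
        have vc: "v \<in> carrier R" "k \<in> carrier R" using v(1,2) subringD(1)[OF V] mVd(2) by auto
        define u where "u = inv y \<otimes> v"
        have uc: "u \<in> carrier R" unfolding u_def using iy vc by simp
        have u: "u = \<one> \<oplus> \<ominus> k" unfolding v(3)[symmetric] u_def using iy(1) vc by algebra
        have kA: "k \<in> ?A" using subring_idealD(1)[OF L.A L.m(1) v(2)] .
        have uA: "u \<in> ?A" unfolding u using subringD(3,4,6)[OF L.A] kA by blast
        have "u \<notin> ?m"
        proof
          assume "u \<in> ?m"
          then have "k \<oplus> u \<in> ?m" using mVd(4)[OF v(2)] by blast
          then show False using v(3) L.m(2) unfolding u_def by simp
        qed
        then have "inv u \<in> V" using L.A_unit uA AV by blast
        moreover have "u \<noteq> \<zero>" using \<open>u \<notin> ?m\<close> mVd(3) by blast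
        note iu = inv_nonzero[OF uc this]
        have "y \<otimes> u = (y \<otimes> inv y) \<otimes> v" unfolding u_def using yc iy(1) vc by algebra
        then have vy: "v = y \<otimes> u" using iy vc by simp
        have "v \<otimes> inv u = (u \<otimes> inv u) \<otimes> y" unfolding vy using yc(1) uc iu(1) by algebra
        then have "y = v \<otimes> inv u" using iu yc by simp
        ultimately show False using yV subringD(5)[OF V v(1)] by simp
      qed
      then show False
        using inverse_of_nonunit_not_integral[OF V mV L.m(2) D DV y] iy(3) by blast
    qed
  qed
  define Q where "Q = ?m \<inter> D'"
  note S' = subringD[OF D'(1)]
  have Qi: "ideal Q (restrict_ring R D')"
    unfolding Q_def by (rule subring_idealI[OF D'(1)]) (use mVd(3,4,5) S'(2,4,5) D'V in auto)
  have "primeideal Q (restrict_ring R D')"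
    unfolding subring_primeideal_iff[OF D'(1)]
    using Qi L.m(2) subring_primeidealD(3)[OF V subring_maximalideal_prime[OF V max]] D'V
    unfolding Q_def by blast
  \<comment> \<open>Containing c keeps the contraction nonzero, so dimension one of D' makes it
    maximal.\<close>
  moreover have "Q \<noteq> {\<zero>}" unfolding Q_def using cm c(1,2) D'(2) by blast
  ultimately have "maximalideal Q (restrict_ring R D')" using ded unfolding dedekind_domain_def by blast
  moreover have "f \<subseteq> Q"
    unfolding Q_def using N(2) L.N_subset subring_idealD(1)[OF D'(1) f_ideal] by blast
  moreover have "Q \<subseteq> ?A" unfolding Q_def using subring_idealD(1)[OF L.A L.m(1)] by blast
  ultimately show ?thesis by blast
qed

text \<open>If x is not in D, the ideal T of denominators of x lies in a maximal N, and f <= T <= N.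
  Over such N there is a Q inside D_N, so x = q + d lies in D_N and has a denominator outside N, a
  contradiction.\<close>

lemma pullback_if_PVD:
  assumes ded: "dedekind_domain R D'"
    and pvd: "\<And>N. N \<in> prime_ideals_over (restrict_ring R D) f \<Longrightarrow>
      pseudo_valuation_domain R (localization R D N)"
    and over: "\<And>Q. maximalideal Q (restrict_ring R D') \<Longrightarrow> f \<subseteq> Q \<Longrightarrow> Q \<in> Ms"
    and x: "x \<in> D'" "\<And>Q. Q \<in> Ms \<Longrightarrow> \<exists>d\<in>D. \<exists>q\<in>Q. x = q \<oplus> d"
  shows "x \<in> D"
proof (rule ccontr)
  assume xD: "x \<notin> D"
  note S = subringD[OF D]
  have xc: "x \<in> carrier R" using x(1) subringD(1)[OF D'(1)] by blast
  define T where "T = {d \<in> D. d \<otimes> x \<in> D}"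
  have T: "ideal T (restrict_ring R D)"
  proof (rule subring_idealI[OF D])
    show "\<zero> \<in> T" unfolding T_def using S(2) xc by simp
    show "a \<oplus> b \<in> T" if "a \<in> T" "b \<in> T" for a b
      using that S(1,4) xc unfolding T_def by (simp add: l_distr)
    show "a \<otimes> b \<in> T" if "a \<in> D" "b \<in> T" for a b
      using that S(1,5) xc unfolding T_def by (simp add: m_assoc)
  qed (simp add: T_def)
  have "\<one> \<notin> T" unfolding T_def using xD xc by simp
  then obtain N where N: "maximalideal N (restrict_ring R D)" "T \<subseteq> N"
    using noetherian_domain.exists_maximalideal[OF noeth T] S(3) by auto
  have Np: "primeideal N (restrict_ring R D)" using subring_maximalideal_prime[OF D N(1)] .
  have "f \<subseteq> T" unfolding T_def using f_iff x(1) by auto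
  then have fN: "f \<subseteq> N" using N(2) by blast
  then have "N \<in> prime_ideals_over (restrict_ring R D) f" unfolding prime_ideals_over_def using Np by blast
  then obtain Q where Q: "maximalideal Q (restrict_ring R D')" "f \<subseteq> Q" "Q \<subseteq> localization R D N"
    using max_V_contraction[OF pvd Np fN ded] by blast
  interpret L: localization_at_prime R D N by (intro localization_at_prime.intro localization_at_prime_axioms.intro field_axioms D Np)
  obtain d q where d: "d \<in> D" "q \<in> Q" "x = q \<oplus> d" using x(2)[OF over[OF Q(1,2)]] by blast
  have "x \<in> localization R D N"
    unfolding d(3) using L.A_add Q(3) d(1,2) L.D_subset by blast
  then obtain s where "s \<in> D - N" "s \<otimes> x \<in> D" by (rule L.AE)
  then show False using N(2) unfolding T_def by blast
qed

end

section \<open>The implications between the three conditions\<close>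

context noetherian_with_conductor
begin

lemma PVD_if_TAF:
  assumes TAF: "TAF_domain (restrict_ring R D)"
  shows "dedekind_domain R D' \<and> (\<forall>N\<in>prime_ideals_over (restrict_ring R D) f.
    pseudo_valuation_domain R (localization R D N))"
proof -
  have rp: "residually_principal (restrict_ring R D) N" if "maximalideal N (restrict_ring R D)" for N
    using domain.TAF_domain_residually_principal[OF noetherian_domain.axioms(2)[OF noeth] TAF that] .
  have dim: "maximalideal P (restrict_ring R D)"
    if "primeideal P (restrict_ring R D)" "P \<noteq> {\<zero>}" for P
    using noetherian_domain.maximalideal_if_residually_principal[OF noeth rp that(1)] that(2) by simp
  have "pseudo_valuation_domain R (localization R D N)"
    if N: "N \<in> prime_ideals_over (restrict_ring R D) f" for N
  proof -
    have Np: "primeideal N (restrict_ring R D)" and N0: "N \<noteq> {\<zero>}"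
      using N c_in_f c(2) unfolding prime_ideals_over_def by auto
    interpret localization_residually_principal R D N
      by (intro localization_residually_principal.intro localization_at_prime.intro
          localization_at_prime_axioms.intro localization_residually_principal_axioms.intro
          field_axioms D Np qf noeth dim[OF Np N0] rp[OF dim[OF Np N0]] N0)
    show ?thesis by (rule pseudo_valuation_domain_A)
  qed
  then show ?thesis using dedekind_if_dim_le_1[OF dim] by blast
qed

lemma pullback_description:
  assumes ded: "dedekind_domain R D'"
    and pvd: "\<And>N. N \<in> prime_ideals_over (restrict_ring R D) f \<Longrightarrow>
      pseudo_valuation_domain R (localization R D N)"
  shows "\<exists>n M L. n \<ge> 1 \<and> inj_on M {1..n} \<and>
    (\<forall>i\<in>{1..n}. maximalideal (M i) (restrict_ring R D') \<and>
      finite_subextension (L i) (restrict_ring R D' Quot M i)) \<and>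
    D = {x \<in> D'. canonical_map (restrict_ring R D') n M x \<in> (\<Pi>\<^sub>E i\<in>{1..n}. L i)}"
proof -
  let ?E = "restrict_ring R D'"
  have f0: "f \<noteq> {\<zero>}" using c_in_f c(2) by blast
  have "{\<zero>} \<noteq> carrier ?E" using subringD(3)[OF D'(1)] one_not_zero by force
  moreover have "ideal {\<zero>} ?E" using ring.zeroideal[OF subring_is_ring[OF D'(1)]] by simp
  ultimately obtain M0 where M0: "maximalideal M0 ?E"
    using noetherian_domain.exists_maximalideal[OF noeth'] by blast
  \<comment> \<open>Adding \<open>M0\<close> keeps the family nonempty when the conductor is the
    unit ideal.\<close>
  define Ms where "Ms = insert M0 {Q. maximalideal Q ?E \<and> f \<subseteq> Q}"
  have fin: "finite Ms" unfolding Ms_def using finite_maximalideals_over[OF ded f_ideal f0] by simp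
  have Mmax: "maximalideal Q ?E" if "Q \<in> Ms" for Q using that M0 unfolding Ms_def by blast
  define n where "n = card Ms"
  have "Ms \<noteq> {}" unfolding Ms_def by blast
  then have "n \<ge> 1" unfolding n_def using fin by (simp add: Suc_leI card_gt_0_iff)
  obtain M where M: "bij_betw M {1..n} Ms"
    using ex_bij_betw_nat_finite_1[OF fin] unfolding n_def by blast
  then have inj: "inj_on M {1..n}" and img: "M ` {1..n} = Ms" unfolding bij_betw_def by auto
  \<comment> \<open>The residue subfield at each ideal is the image of \<open>D\<close> itself, so
    an element of the pullback is congruent to an element of \<open>D\<close> modulo each of
    them.\<close>
  define L where "L i = (\<lambda>d. M i +>\<^bsub>?E\<^esub> d) ` D" for i
  have max: "maximalideal (M i) ?E" if "i \<in> {1..n}" for i using Mmax img that by blast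
  have sub: "finite_subextension (L i) (?E Quot M i)" if "i \<in> {1..n}" for i
    unfolding L_def using finite_subextension_image[OF noeth D D' subset_refl cc c(2,3) max[OF that]] .
  have "D = {x \<in> D'. canonical_map ?E n M x \<in> (\<Pi>\<^sub>E i\<in>{1..n}. L i)}"
  proof
    show "D \<subseteq> {x \<in> D'. canonical_map ?E n M x \<in> (\<Pi>\<^sub>E i\<in>{1..n}. L i)}"
      using D'(2) unfolding canonical_map_def L_def by auto
    show "{x \<in> D'. canonical_map ?E n M x \<in> (\<Pi>\<^sub>E i\<in>{1..n}. L i)} \<subseteq> D"
    proof
      fix x assume "x \<in> {x \<in> D'. canonical_map ?E n M x \<in> (\<Pi>\<^sub>E i\<in>{1..n}. L i)}"
      then have x: "x \<in> D'" and xL: "\<And>i. i \<in> {1..n} \<Longrightarrow> M i +>\<^bsub>?E\<^esub> x \<in> L i"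
        unfolding canonical_map_def by (auto simp: PiE_def Pi_def)
      have "\<exists>d\<in>D. \<exists>q\<in>Q. x = q \<oplus> d" if Q: "Q \<in> Ms" for Q
      proof -
        obtain i where i: "i \<in> {1..n}" "Q = M i" using Q img by blast
        then obtain d where d: "d \<in> D" "Q +>\<^bsub>?E\<^esub> x = Q +>\<^bsub>?E\<^esub> d" using xL unfolding L_def by blast
        have "ideal Q ?E" using Mmax[OF Q] subring_maximalideal_iff[OF D'(1)] by blast
        then have "\<zero> \<oplus> x \<in> Q +>\<^bsub>?E\<^esub> x"
          using subring_idealD(3)[OF D'(1)] unfolding a_r_coset_def' by auto
        moreover have "\<zero> \<oplus> x = x" using subringD(1)[OF D'(1) x] by simp
        ultimately have "x \<in> Q +>\<^bsub>?E\<^esub> d" using d(2) by simp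
        then show ?thesis using d(1) unfolding a_r_coset_def' by auto
      qed
      then show "x \<in> D"
        using pullback_if_PVD[OF ded pvd, of Ms x] x unfolding Ms_def by blast
    qed
  qed
  then show ?thesis using \<open>n \<ge> 1\<close> inj max sub by blast
qed

end

text \<open>Cosets are translated into the elementwise data of \<open>pullback\<close>: H i is the
  preimage of the subfield L i, and a representative of an inverse in L i is an inverse modulo M
  i.\<close>

lemma (in field) TAF_domain_if_pullback:
  assumes D: "subring D R" and noeth: "noetherian_domain (restrict_ring R D)"
    and ded: "dedekind_domain R E" and inj: "inj_on M {1..n}"
    and M: "\<And>i. i \<in> {1..n} \<Longrightarrow> maximalideal (M i) (restrict_ring R E)"
    and L: "\<And>i. i \<in> {1..n} \<Longrightarrow> subfield (L i) (restrict_ring R E Quot M i)"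
    and D_eq: "D = {x \<in> E. canonical_map (restrict_ring R E) n M x \<in> (\<Pi>\<^sub>E i\<in>{1..n}. L i)}"
  shows "TAF_domain (restrict_ring R D)"
proof -
  let ?S = "restrict_ring R E"
  have E: "subring E R" using ded unfolding dedekind_domain_def quotient_field_of_iff by blast
  note SE = subringD[OF E]
  define H where "H i = {x \<in> E. M i +>\<^bsub>?S\<^esub> x \<in> L i}" for i
  have pb: "pullback R E D {1..n} M H"
  proof (intro pullback.intro pullback_axioms.intro field_axioms ded D inj M finite_atLeastAtMost)
    show "D = {x \<in> E. \<forall>i\<in>{1..n}. x \<in> H i}"
      unfolding D_eq H_def canonical_map_def by (auto simp: PiE_def Pi_def extensional_def)
    fix i assume i: "i \<in> {1..n}"
    have Mi: "ideal (M i) ?S" using M[OF i] subring_maximalideal_iff[OF E] by blast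
    note Md = subring_idealD[OF E Mi]
    let ?F = "?S Quot M i" and ?h = "(+>\<^bsub>?S\<^esub>) (M i)"
    interpret h: ring_hom_ring ?S ?F ?h using ideal.rcos_ring_hom_ring[OF Mi] .
    note Ld = subringE[OF subfieldE(1)[OF L[OF i]]]
    have h0: "?h x = \<zero>\<^bsub>?F\<^esub>" if "x \<in> M i" for x
      using ring.a_rcos_zero[OF subring_is_ring[OF E] Mi that] by (simp add: FactRing_def)
    have hc: "?h x \<in> carrier ?F" if "x \<in> E" for x using h.hom_closed that by simp
    show "M i \<subseteq> H i" unfolding H_def using h0 Ld(2) Md(1) by auto
    show "H i \<subseteq> E" unfolding H_def by blast
    show "subring (H i) R"
    proof (rule subringI)
      show "H i \<subseteq> carrier R" unfolding H_def using SE(1) by blast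
      show "\<one> \<in> H i" unfolding H_def using h.hom_one Ld(3) SE(3) by simp
      show mult: "x \<otimes> y \<in> H i" if "x \<in> H i" "y \<in> H i" for x y
        using that h.hom_mult[of x y] Ld(6) SE(5) unfolding H_def by auto
      show "x \<oplus> y \<in> H i" if "x \<in> H i" "y \<in> H i" for x y
        using that h.hom_add[of x y] Ld(7) SE(4) unfolding H_def by auto
      have "?h (\<ominus> \<one>) \<in> L i"
      proof -
        have mo: "\<ominus> \<one> \<in> E" using SE(3,6) by blast
        have "?h (\<ominus> \<one>) \<oplus>\<^bsub>?F\<^esub> \<one>\<^bsub>?F\<^esub> = ?h (\<ominus> \<one> \<oplus> \<one>)"
          using h.hom_add[of "\<ominus> \<one>" \<one>] h.hom_one mo SE(3) by simp
        also have "\<dots> = \<zero>\<^bsub>?F\<^esub>" using h0[OF Md(3)] by (simp add: l_neg)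
        finally have "?h (\<ominus> \<one>) = \<ominus>\<^bsub>?F\<^esub> \<one>\<^bsub>?F\<^esub>"
          using h.S.minus_equality[OF _ h.S.one_closed hc[OF mo]] by simp
        then show ?thesis using Ld(3,5) by simp
      qed
      then have mo: "\<ominus> \<one> \<in> H i" unfolding H_def using SE(3,6) by blast
      show "\<ominus> x \<in> H i" if x: "x \<in> H i" for x
      proof -
        have "x \<in> carrier R" using x SE(1) unfolding H_def by blast
        then have "(\<ominus> \<one>) \<otimes> x = \<ominus> x" by algebra
        then show ?thesis using mult[OF mo x] by simp
      qed
    qed
    fix x assume x: "x \<in> H i - M i"
    have xE: "x \<in> E" "?h x \<in> L i" using x unfolding H_def by auto
    have "?h x \<noteq> \<zero>\<^bsub>?F\<^esub>"
      using ideal.rcos_const_imp_mem[OF Mi, of x] x xE(1) by (auto simp: FactRing_def)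
    then have k: "?h x \<in> L i - {\<zero>\<^bsub>?F\<^esub>}" using xE(2) by blast
    note inv = h.S.subfield_m_inv[OF L[OF i] k]
    have "inv\<^bsub>?F\<^esub> ?h x \<in> carrier ?F" using inv(1) Ld(1) by blast
    then obtain y where y: "y \<in> E" "inv\<^bsub>?F\<^esub> ?h x = ?h y"
      unfolding FactRing_def A_RCOSETS_def' by auto
    have yH: "y \<in> H i" unfolding H_def using y inv(1) by auto
    have "?h (x \<otimes> y) = \<one>\<^bsub>?F\<^esub>" using h.hom_mult[of x y] xE(1) y inv(2) by simp
    then have "?h (x \<otimes> y) = ?h \<one>" using h.hom_one by simp
    \<comment> \<open>Equality of cosets becomes a congruence because 1 belongs to its own
      coset.\<close>
    moreover have "\<exists>m\<in>M i. \<one> = m \<oplus> \<one>" using Md(3) by (intro bexI[of _ \<zero>]) simp_all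
    then have "\<one> \<in> ?h \<one>" unfolding a_r_coset_def' by auto
    ultimately have "\<one> \<in> ?h (x \<otimes> y)" by simp
    then obtain m where "m \<in> M i" "\<one> = m \<oplus> x \<otimes> y" unfolding a_r_coset_def' by auto
    then show "\<exists>y\<in>H i. \<exists>m\<in>M i. m \<oplus> x \<otimes> y = \<one>" using yH by metis
  qed
  show ?thesis using pullback.TAF_domain_pullback[OF pb noeth] .
qed

theorem corollary4p10:
  fixes K :: "('a, 'm) ring_scheme" and D D' :: "'a set"
  assumes "quotient_field_of K D"
    and "noetherian_domain (restrict_ring K D)"
    and "D' = integral_closure K D"
    and "conductor K D D' \<noteq> {\<zero>\<^bsub>K\<^esub>}"
  shows "(TAF_domain (restrict_ring K D) \<longleftrightarrow>
          dedekind_domain K D' \<and>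
          (\<forall>M \<in> prime_ideals_over (restrict_ring K D) (conductor K D D').
             pseudo_valuation_domain K (localization K D M)))
       \<and> (TAF_domain (restrict_ring K D) \<longleftrightarrow>
          (\<exists>(E :: 'a set) (n :: nat) (M :: nat \<Rightarrow> 'a set) (L :: nat \<Rightarrow> 'a set set).
             overring K D E \<and> dedekind_domain K E \<and> n \<ge> 1 \<and>
             inj_on M {1..n} \<and>
             (\<forall>i\<in>{1..n}. maximalideal (M i) (restrict_ring K E) \<and>
                finite_subextension (L i) (restrict_ring K E Quot M i)) \<and>
             D = {x \<in> E. canonical_map (restrict_ring K E) n M x \<in> (\<Pi>\<^sub>E i\<in>{1..n}. L i)}))"
    (is "(?a \<longleftrightarrow> ?b) \<and> (?a \<longleftrightarrow> ?c)")
proof -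
  interpret field K using assms(1) unfolding quotient_field_of_def by blast
  have D: "subring D K" using assms(1) quotient_field_of_iff by blast
  note qf = assms(1) and noeth = assms(2) and D' = assms(3)
  have "D' \<subseteq> carrier K" unfolding D' integral_closure_def by blast
  \<comment> \<open>Since zero belongs to the conductor, being different from the zero ideal yields
    a nonzero element.\<close>
  then have "\<zero>\<^bsub>K\<^esub> \<in> conductor K D D'"
    unfolding conductor_def colon_def using subringD(2)[OF D] by auto
  then obtain c where c: "c \<in> conductor K D D'" "c \<noteq> \<zero>\<^bsub>K\<^esub>" using assms(4) by blast
  interpret C: noetherian_with_conductor K D c
  proof (intro noetherian_with_conductor.intro noetherian_with_conductor_axioms.intro
      field_axioms qf noeth c(2))
    show "c \<in> D" using c(1) unfolding conductor_def colon_def by blast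
    show "c \<otimes>\<^bsub>K\<^esub> y \<in> D" if "y \<in> integral_closure K D" for y
      using c(1) that unfolding conductor_def colon_def D' by blast
  qed
  have ab: "?b" if "?a" using C.PVD_if_TAF[OF that] unfolding D' .
  have bc: "?c" if b: "?b"
  proof -
    have "overring K D D'" unfolding overring_def D' using qf C.D' by blast
    moreover have ded: "dedekind_domain K D'" using b by blast
    moreover have "\<exists>n M L. n \<ge> 1 \<and> inj_on M {1..n} \<and>
      (\<forall>i\<in>{1..n}. maximalideal (M i) (restrict_ring K D') \<and>
        finite_subextension (L i) (restrict_ring K D' Quot M i)) \<and>
      D = {x \<in> D'. canonical_map (restrict_ring K D') n M x \<in> (\<Pi>\<^sub>E i\<in>{1..n}. L i)}"
      using C.pullback_description b unfolding D' by blast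
    ultimately show ?thesis by blast
  qed
  have ca: "?a" if c: "?c"
  proof -
    obtain E n M L where "dedekind_domain K E" "inj_on M {1..n::nat}"
      and max: "\<forall>i\<in>{1..n}. maximalideal (M i) (restrict_ring K E) \<and>
        finite_subextension (L i) (restrict_ring K E Quot M i)"
      and "D = {x \<in> E. canonical_map (restrict_ring K E) n M x \<in> (\<Pi>\<^sub>E i\<in>{1..n}. L i)}"
      using c by blast
    then show ?thesis
      using TAF_domain_if_pullback[OF D noeth, of E M n L] unfolding finite_subextension_def by blast
  qed
  show ?thesis using ab bc ca by blast
qed

end
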